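(* Let $p$ be a prime, $H$ a positive integer and $\mathcal I=\{1,2,\dots,H\}\pmod p\subset\mathbb F_p$ (so $|\mathcal I|=H$). Let $\mathcal G$ be either a subgroup of $\mathbb F_p^*$, or a set $\{1,g,g^2,\dots,g^{N-1}\}\pmod p$ with $|\mathcal G|=N$ elements, where $g$ is a primitive root modulo $p$. For any fixed $\varepsilon>0$ there is $\delta=\delta(\varepsilon)>0$ such that if $|\mathcal I|>p^{5/8+\varepsilon}$ and $|\mathcal G|>p^{3/8}$, then $$|\mathcal I\cdot\mathcal G|=p+O(p^{1-\delta}),$$ where the implied constant depends only on $\varepsilon$.
   Context: $\mathbb F_p$ is the field of residue classes modulo $p$ and $\mathcal A\cdot\mathcal B=\{ab:a\in\mathcal A,b\in\mathcal B\}$. *)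

theory Defs
  imports Complex_Main "HOL-Number_Theory.Number_Theory"
begin

text \<open>
  The field of residues modulo \<open>p\<close> is \<open>residue_ring (int p)\<close>, with carrier \<open>{0..int p - 1}\<close>; a type-indexed
  version would not allow quantification over \<open>p\<close> inside a formula.
\<close>

definition interval_mod :: "nat \<Rightarrow> nat \<Rightarrow> int set" where
  "interval_mod p H = (\<lambda>h. int h mod int p) ` {1..H}"

definition power_set_mod :: "nat \<Rightarrow> nat \<Rightarrow> nat \<Rightarrow> int set" where
  "power_set_mod p g N = (\<lambda>i. int g ^ i mod int p) ` {..<N}"

end

theory Submission
  imports Defs "HOL-Analysis.Analysis" "HOL-Algebra.Algebraic_Closure_Type"
    "HOL-Computational_Algebra.Computational_Algebra" "Berlekamp_Zassenhaus.Finite_Field"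
begin

text \<open>
  The structure of \<open>G\<close> plays no role: any \<open>N\<close> nonzero residues will do. Let \<open>S\<^sub>D(\<phi>)\<close> be the sum of a
  character \<open>\<phi>\<close> modulo \<open>p\<close> over \<open>{1..D}\<close>. By orthogonality, the residues that are not of the form
  \<open>a * u\<^sub>1 * \<dots> * u\<^sub>j * g\<close> with \<open>a \<le> A\<close>, \<open>u\<^sub>i \<le> U\<close>, \<open>g \<in> G\<close> are few as soon as the second moment of
  \<open>S\<^sub>A(\<phi>) * S\<^sub>U(\<phi>) ^ j * S\<^sub>G(\<phi>)\<close> over the nonprincipal \<open>\<phi>\<close> is small. Here \<open>U\<close> is a small power of \<open>p\<close>, \<open>A = U ^ m\<close> is
  slightly larger than \<open>p powr (1/4)\<close>, and \<open>A * U ^ j\<close> is just below \<open>p powr (5/8 + \<epsilon>)\<close>.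

  Two ingredients control this moment. First, Burgess' bound gives a power saving in \<open>S\<^sub>A(\<phi>)\<close>; it rests on Weil's
  bound for complete sums, obtained by Stepanov's method applied to the prime polynomials over the prime field.
  Secondly, if \<open>N * D\<^sub>1 * \<dots> * D\<^sub>l \<le> p\<close>, the multiplicative energy of \<open>G\<close> and the box \<open>{1..D\<^sub>1} \<times> \<dots> \<times> {1..D\<^sub>l}\<close> is,
  up to \<open>p powr \<kappa>\<close>, only its diagonal \<open>N * D\<^sub>1 * \<dots> * D\<^sub>l\<close>. To see this, fix \<open>g\<close> and \<open>g'\<close>: the solutions of
  \<open>g * x = g' * y\<close> form a lattice, and either they are all multiples of one short vector, whose coordinates again
  factor along a box of volume \<open>O(N)\<close>, or they are equidistributed. This bounds all energies by those of boxes of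
  volume \<open>O(N)\<close>, and the log-convexity of the energy lets the inequality improve itself.

  If \<open>S\<^sub>U(\<phi>)\<close> is small, save on one factor \<open>S\<^sub>U\<close>; otherwise save on \<open>S\<^sub>A\<close> and replace it by \<open>m - 1\<close> further factors
  \<open>S\<^sub>U\<close>. In both cases a box of volume about \<open>p / N\<close> remains, for which the energy bound is sharp.
\<close>

text \<open>The exponents fit with nothing to spare. Log-convexity doubles an entry that may be as
  large as \<open>A\<close>, in a box of volume about \<open>N\<close>, so the energy argument needs
  \<open>N * A * N \<le> p\<close> up to constants. Burgess' bound forces \<open>A\<close> above
  \<open>p powr (1/4)\<close>, and 3/8 + 1/4 + 3/8 = 1. A larger \<open>G\<close> is therefore cut
  down to about \<open>p powr (3/8)\<close> elements, and the 5/8 of the interval is the exponent of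
  \<open>p / N\<close>.

  In Weil's bound the constants of Stepanov's method may depend on the prime, the character and the
  points. The L-function is a polynomial, and the growth of its power sums, known up to any constant
  factor, already keeps its zeros away from 0. The price is that every degree \<open>n\<close> has
  to be treated. Prime polynomials of degree dividing \<open>n\<close> stand for the Frobenius
  orbits of the field with \<open>p ^ n\<close> elements, so all \<open>n\<close> are handled over
  one and the same field; an algebraic closure enters only in the computation of norms.\<close>

hide_const (open) Divisibility.prime Divisibility.irreducible Polynomials.lead_coeff Polynomials.degree
  UnivPoly.coeff UnivPoly.monom Module.smult Ring_Divisibility.mult_of

section \<open>Stepanov's method\<close>

definition taylor_poly :: "'a::comm_ring_1 poly \<Rightarrow> 'a poly poly" where
  "taylor_poly R = pcompose (map_poly (\<lambda>c. [:c:]) R) [:[:0, 1:], 1:]"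

lemma taylor_poly_0 [simp]: "taylor_poly 0 = 0"
  by (simp add: taylor_poly_def)

lemma taylor_poly_pCons:
  "taylor_poly (pCons a R) = [:[:a:]:] + [:[:0, 1:], 1:] * taylor_poly R"
  by (cases "pCons a R = 0") (simp_all add: taylor_poly_def map_poly_pCons pcompose_pCons)

lemma taylor_poly_const [simp]: "taylor_poly [:a:] = [:[:a:]:]"
  by (simp add: taylor_poly_pCons)

lemma taylor_poly_1 [simp]: "taylor_poly 1 = 1"
  using taylor_poly_const[of 1] by (simp add: one_pCons)

lemma taylor_poly_add: "taylor_poly (R + Q) = taylor_poly R + taylor_poly Q"
proof (induction R Q rule: poly_induct2)
  case (pCons a R b Q)
  have "[:[:a + b:]:] = [:[:a:]:] + [:[:b:]:]" by simp
  then have "[:[:a + b:]:] + [:[:0, 1:], 1:] * (taylor_poly R + taylor_poly Q) =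
      ([:[:a:]:] + [:[:0, 1:], 1:] * taylor_poly R) + ([:[:b:]:] + [:[:0, 1:], 1:] * taylor_poly Q)"
    by (simp only: distrib_left add_ac)
  then show ?case
    by (simp only: taylor_poly_pCons pCons.IH add_pCons[of a R b Q])
qed simp

lemma taylor_poly_smult: "taylor_poly (smult a R) = [:[:a:]:] * taylor_poly R"
  by (induction R) (simp_all add: taylor_poly_pCons algebra_simps)

lemma taylor_poly_diff: "taylor_poly (R - Q) = taylor_poly R - taylor_poly Q"
  using taylor_poly_add[of "R - Q" Q] by simp

lemma taylor_poly_mult: "taylor_poly (R * Q) = taylor_poly R * taylor_poly Q"
  by (induction R) (simp_all add: taylor_poly_pCons taylor_poly_add taylor_poly_smult algebra_simps)

lemma taylor_poly_power: "taylor_poly (R ^ n) = taylor_poly R ^ n"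
  by (induction n) (simp_all add: taylor_poly_mult)

lemma taylor_poly_sum: "taylor_poly (\<Sum>i\<in>A. f i) = (\<Sum>i\<in>A. taylor_poly (f i))"
  by (induction A rule: infinite_finite_induct) (simp_all add: taylor_poly_add)

lemma taylor_poly_prod: "taylor_poly (\<Prod>i\<in>A. f i) = (\<Prod>i\<in>A. taylor_poly (f i))"
  by (induction A rule: infinite_finite_induct) (simp_all add: taylor_poly_mult)

lemma taylor_poly_linear: "taylor_poly [:a, 1:] = [:[:a, 1:], 1:]"
  by (simp add: taylor_poly_pCons)

lemma coeff_taylor_poly_0: "coeff (taylor_poly R) 0 = R"
  by (induction R) (simp_all add: taylor_poly_pCons)

lemma coeff_taylor_poly_1: "coeff (taylor_poly R) (Suc 0) = pderiv R"
proof (induction R)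
  case (pCons a R)
  show ?case
    using pCons.IH
    by (simp add: taylor_poly_pCons coeff_pCons pderiv_pCons coeff_taylor_poly_0)
qed simp

section \<open>Spaces of polynomials of bounded degree\<close>

definition polys_below :: "nat \<Rightarrow> 'a::zero poly set" where
  "polys_below n = {h. \<forall>i\<ge>n. coeff h i = 0}"

lemma polys_below_0 [simp]: "polys_below 0 = {0}"
  by (auto simp: polys_below_def poly_eq_iff)

lemma zero_in_polys_below [simp]: "0 \<in> polys_below n"
  by (simp add: polys_below_def)

lemma polys_below_mono: "m \<le> n \<Longrightarrow> polys_below m \<subseteq> polys_below n"
  by (auto simp: polys_below_def)

lemma polys_below_add: "f \<in> polys_below n \<Longrightarrow> g \<in> polys_below n \<Longrightarrow> f + g \<in> polys_below n"
  by (auto simp: polys_below_def)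

lemma polys_below_diff:
  fixes f g :: "'a::ab_group_add poly"
  shows "f \<in> polys_below n \<Longrightarrow> g \<in> polys_below n \<Longrightarrow> f - g \<in> polys_below n"
  by (auto simp: polys_below_def)

lemma polys_below_sum:
  "(\<And>i. i \<in> A \<Longrightarrow> f i \<in> polys_below n) \<Longrightarrow> (\<Sum>i\<in>A. f i) \<in> polys_below n"
  by (induction A rule: infinite_finite_induct) (auto intro: polys_below_add)

lemma polys_below_iff_degree: "h \<in> polys_below n \<longleftrightarrow> h = 0 \<or> degree h < n"
proof
  assume h: "h \<in> polys_below n"
  show "h = 0 \<or> degree h < n"
  proof (rule ccontr)
    assume "\<not> ?thesis"
    then have "coeff h (degree h) = 0" "h \<noteq> 0" using h by (auto simp: polys_below_def)
    then show False by simp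
  qed
qed (auto simp: polys_below_def intro: coeff_eq_0)

lemma polys_below_mult:
  fixes f g :: "'a::comm_ring_1 poly"
  assumes "f \<in> polys_below (Suc m)" "g \<in> polys_below n"
  shows "f * g \<in> polys_below (m + n)"
proof (cases "f = 0 \<or> g = 0")
  case False
  then have "degree f \<le> m" "degree g < n" using assms by (auto simp: polys_below_iff_degree)
  then have "degree (f * g) < m + n" using degree_mult_le[of f g] by linarith
  then show ?thesis by (simp add: polys_below_iff_degree)
qed auto

lemma polys_below_Suc: "polys_below (Suc n) = (\<lambda>(a, h). pCons a h) ` (UNIV \<times> polys_below n)"
proof (intro equalityI subsetI)
  fix h :: "'a poly" assume h: "h \<in> polys_below (Suc n)"
  obtain a g where g: "h = pCons a g" by (cases h)
  have "g \<in> polys_below n"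
    unfolding polys_below_def
  proof safe
    fix i assume "n \<le> i"
    then have "coeff h (Suc i) = 0" using h by (simp add: polys_below_def)
    then show "coeff g i = 0" by (simp add: g)
  qed
  then show "h \<in> (\<lambda>(a, h). pCons a h) ` (UNIV \<times> polys_below n)" using g by auto
qed (auto simp: polys_below_def coeff_pCons split: nat.splits)

lemma finite_polys_below [simp]: "finite (polys_below n :: 'a::{finite, zero} poly set)"
  by (induction n) (simp_all add: polys_below_Suc)

lemma card_polys_below: "card (polys_below n :: 'a::{finite, zero} poly set) = CARD('a) ^ n"
proof (induction n)
  case (Suc n)
  have "inj_on (\<lambda>(a, h). pCons a h) (UNIV \<times> (polys_below n :: 'a poly set))"
    by (auto simp: inj_on_def)
  then show ?case
    by (simp add: polys_below_Suc card_image card_cartesian_product Suc)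
qed simp

text \<open>Hasse derivatives do not raise the degree. This enters the count of linear conditions in
  Stepanov's method.\<close>

lemma coeff_taylor_poly_below: "h \<in> polys_below n \<Longrightarrow> coeff (taylor_poly h) k \<in> polys_below n"
proof (induction n arbitrary: h k)
  case 0
  then show ?case by simp
next
  case (Suc n)
  then obtain a g where g: "h = pCons a g" "g \<in> polys_below n" by (auto simp: polys_below_Suc)
  have 1: "[:0, 1:] * coeff (taylor_poly g) i \<in> polys_below (Suc n)" for i
    using polys_below_mult[of "[:0, 1:]" 1 "coeff (taylor_poly g) i" n] Suc.IH[OF g(2), of i]
    by (simp add: polys_below_def coeff_pCons split: nat.splits)
  have 2: "coeff (taylor_poly g) i \<in> polys_below (Suc n)" for i
    using Suc.IH[OF g(2), of i] polys_below_mono[of n "Suc n"] by auto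
  have 3: "[:a:] \<in> polys_below (Suc n)"
    by (simp add: polys_below_def coeff_pCons split: nat.splits)
  show ?case
  proof (cases k)
    case 0
    then show ?thesis using polys_below_add[OF 3 1[of 0]]
      by (simp add: g taylor_poly_pCons)
  next
    case (Suc k')
    then show ?thesis using polys_below_add[OF 1[of k] 2[of k']]
      by (simp add: g taylor_poly_pCons coeff_pCons)
  qed
qed

section \<open>Congruence modulo \<open>T ^ M\<close> and vanishing to high order\<close>

definition trunc_eq :: "nat \<Rightarrow> 'a::comm_ring_1 poly \<Rightarrow> 'a poly \<Rightarrow> bool" where
  "trunc_eq M f g \<longleftrightarrow> (\<forall>k<M. coeff f k = coeff g k)"

lemma trunc_eq_refl [simp]: "trunc_eq M f f"
  by (simp add: trunc_eq_def)

lemma trunc_eq_mult: "trunc_eq M f f' \<Longrightarrow> trunc_eq M g g' \<Longrightarrow> trunc_eq M (f * g) (f' * g')"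
  by (auto simp: trunc_eq_def coeff_mult intro!: sum.cong)

lemma trunc_eq_sum: "(\<And>i. i \<in> A \<Longrightarrow> trunc_eq M (f i) (g i)) \<Longrightarrow> trunc_eq M (sum f A) (sum g A)"
  by (auto simp: trunc_eq_def coeff_sum intro!: sum.cong)

lemma trunc_eq_prod: "(\<And>i. i \<in> A \<Longrightarrow> trunc_eq M (f i) (g i)) \<Longrightarrow> trunc_eq M (prod f A) (prod g A)"
  by (induction A rule: infinite_finite_induct) (auto intro: trunc_eq_mult)

lemma trunc_eq_power: "trunc_eq M f g \<Longrightarrow> trunc_eq M (f ^ n) (g ^ n)"
  by (induction n) (auto intro: trunc_eq_mult)

text \<open>Modulo \<open>P\<close>, the expansion of \<open>P\<close> is \<open>T * Z\<close>,
  where \<open>Z\<close> has constant term \<open>P'\<close>. Hence the \<open>j\<close>-th Taylor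
  coefficient of \<open>P ^ j * Q\<close> is \<open>P' ^ j * Q\<close> modulo \<open>P\<close>, and
  since \<open>P\<close> does not divide \<open>P'\<close>, it divides \<open>Q\<close>. Each
  coefficient thus yields one more factor \<open>P\<close>.\<close>

lemma taylor_vanishing_imp_power_dvd:
  fixes P R :: "'a::field_gcd poly"
  assumes P: "prime_elem P" and sep: "\<not> P dvd pderiv P"
    and van: "\<And>k. k < M \<Longrightarrow> P dvd coeff (taylor_poly R) k"
  shows "P ^ M dvd R"
proof -
  have "j \<le> M \<Longrightarrow> P ^ j dvd R" for j
  proof (induction j)
    case (Suc j)
    then have "P ^ j dvd R" by simp
    then obtain Q where Q: "R = P ^ j * Q" by (rule dvdE)
    obtain a Z where Z: "taylor_poly P = pCons a Z" by (cases "taylor_poly P")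
    have a: "a = P" using coeff_taylor_poly_0[of P] Z by simp
    have Z0: "coeff Z 0 = pderiv P" using coeff_taylor_poly_1[of P] Z by simp
    define T where "T = [:0, 1 :: 'a poly:]"
    have tP: "taylor_poly P = [:P:] + T * Z" by (simp add: Z a T_def)
    have "[:P:] dvd (([:P:] + T * Z) ^ j - (T * Z) ^ j)"
    proof -
      have "([:P:] + T * Z) - T * Z dvd (([:P:] + T * Z) ^ j - (T * Z) ^ j)"
        by (metis dvd_triv_left power_diff_sumr2)
      then show ?thesis by simp
    qed
    then obtain W where W: "taylor_poly P ^ j = [:P:] * W + (T * Z) ^ j"
      unfolding tP by (metis dvd_def diff_add_cancel)
    have Tj: "T ^ j = monom 1 j" by (simp add: T_def monom_altdef)
    have "taylor_poly R = [:P:] * (W * taylor_poly Q) + monom 1 j * (Z ^ j * taylor_poly Q)"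
      by (simp add: Q taylor_poly_mult taylor_poly_power W Tj power_mult_distrib algebra_simps)
    then have "coeff (taylor_poly R) j = P * coeff (W * taylor_poly Q) j + coeff (Z ^ j * taylor_poly Q) 0"
      by (simp add: coeff_monom_mult)
    moreover have "coeff (Z ^ j * taylor_poly Q) 0 = pderiv P ^ j * Q"
      by (simp add: coeff_mult_0 coeff_0_power Z0 coeff_taylor_poly_0)
    ultimately have "P dvd P * coeff (W * taylor_poly Q) j + pderiv P ^ j * Q"
      using van[of j] Suc.prems by simp
    then have "P dvd pderiv P ^ j * Q" by (metis dvd_add_right_iff dvd_triv_left)
    then have "P dvd Q" using P sep prime_elem_dvd_mult_iff prime_elem_dvd_power by blast
    then show ?case using Q by (metis mult.commute mult_dvd_mono dvd_refl power_Suc2)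
  qed simp
  then show ?thesis by simp
qed

lemma coeffs_below_mult:
  fixes f g :: "'a::comm_ring_1 poly poly"
  assumes "\<And>k. coeff f k \<in> polys_below (Suc a)" "\<And>k. coeff g k \<in> polys_below b"
  shows "coeff (f * g) k \<in> polys_below (a + b)"
  unfolding coeff_mult by (intro polys_below_sum polys_below_mult assms)

lemma coeffs_below_prod:
  fixes f :: "'b \<Rightarrow> 'a::comm_ring_1 poly poly"
  assumes "finite A" "\<And>c k. c \<in> A \<Longrightarrow> coeff (f c) k \<in> polys_below (Suc a)"
  shows "coeff (\<Prod>c\<in>A. f c) k \<in> polys_below (Suc (card A * a))"
  using assms
proof (induction A arbitrary: k rule: finite_induct)
  case empty
  then show ?case by (cases k) (auto simp: polys_below_def coeff_pCons one_pCons split: nat.splits)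
next
  case (insert x A)
  have "coeff (f x * (\<Prod>c\<in>A. f c)) k \<in> polys_below (a + Suc (card A * a))"
    using insert by (intro coeffs_below_mult) auto
  then show ?case using insert by simp
qed

lemma linear_power_below: "[:a, 1 :: 'a::comm_ring_1:] ^ k \<in> polys_below (Suc k)"
  unfolding polys_below_def
  using degree_power_le[of "[:a, 1:]" k] by (auto intro!: coeff_eq_0)

lemma freshman_linear_power:
  fixes x y :: "'a::comm_ring_1"
  assumes "prime CHAR('a)" "q = CHAR('a) ^ n"
  shows "(x + y) ^ q = x ^ q + y ^ q"
  using assms by (simp add: freshmans_dream')

text \<open>The auxiliary polynomial \<open>R h\<close> vanishes to order \<open>M\<close> at every root of a polynomial modulo which
  \<open>\<pi> ^ q \<equiv> \<pi>\<close> and \<open>g \<equiv> \<alpha>\<close>, provided all \<open>Y h k\<close> vanish. Taylor coefficients replace derivatives, as the order of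
  vanishing exceeds the characteristic.\<close>

locale stepanov =
  fixes S :: "'a::prime_card mod_ring set" and ec :: "'a mod_ring \<Rightarrow> nat" and c1 :: "'a mod_ring"
    and n d e q M K :: nat and \<alpha> :: "'a mod_ring"
  assumes c1: "c1 \<in> S" "ec c1 = 1" and q: "q = CARD('a) ^ n" and de: "d * e = q - 1"
    and M: "M \<le> q" and big: "M * (K + card S * M + e) < K * d * e"
begin

definition \<pi> where "\<pi> = [:- c1, 1:]"
definition lin where "lin c = [:- c, 1 :: 'a mod_ring:]"
definition F where "F = (\<Prod>c\<in>S. lin c)"
definition f where "f = (\<Prod>c\<in>S. lin c ^ ec c)"
definition g where "g = f ^ e"
definition I where "I = {..<d} \<times> {..<K}"
text \<open>A Taylor coefficient of order below \<open>M\<close> costs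
  \<open>lin c ^ (M + E)\<close> at most \<open>M\<close> factors. \<open>Bc\<close> is what is
  left, modulo \<open>T ^ M\<close>, after \<open>lin c ^ E\<close> has been taken out. The factor
  \<open>F ^ M\<close> in \<open>R\<close> is there to make this possible for every
  \<open>E\<close>.\<close>

definition Bc where "Bc c E = (\<Sum>k<M. monom (of_nat ((M + E) choose k) * lin c ^ (M - k)) k)"
definition BB where "BB j = (\<Prod>c\<in>S. Bc c (j * e * ec c))"
text \<open>The \<open>k\<close>-th Taylor coefficient of \<open>R h\<close> after
  \<open>g ^ j\<close> and \<open>\<pi> ^ (q * k')\<close> have been replaced by their residues
  \<open>\<alpha> ^ j\<close> and \<open>\<pi> ^ k'\<close> modulo the prime polynomials in
  question. This lowers the degree so much that its vanishing imposes fewer conditions than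
  \<open>h\<close> has coefficients.\<close>

definition Y where "Y h k = (\<Sum>(j, k')\<in>I. smult (\<alpha> ^ j) (\<pi> ^ k' * coeff (taylor_poly (h (j, k')) * BB j) k))"
definition R where "R h = F ^ M * (\<Sum>(j, k)\<in>I. h (j, k) * g ^ j * \<pi> ^ (q * k))"

lemma finS [simp]: "finite S" by simp

lemma coeff_Bc: "coeff (Bc c E) k \<in> polys_below (Suc M)"
proof -
  have "coeff (Bc c E) k = (\<Sum>i<M. if i = k then of_nat ((M + E) choose i) * lin c ^ (M - i) else 0)"
    by (simp add: Bc_def coeff_sum)
  also have "\<dots> \<in> polys_below (Suc M)"
  proof (intro polys_below_sum)
    fix i
    have "lin c ^ (M - i) \<in> polys_below (Suc M)"
      unfolding lin_def using linear_power_below[of "- c" "M - i"] polys_below_mono[of "Suc (M - i)" "Suc M"] by auto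
    then show "(if i = k then of_nat ((M + E) choose i) * lin c ^ (M - i) else 0) \<in> polys_below (Suc M)"
      by (auto simp: polys_below_def of_nat_poly)
  qed
  finally show ?thesis .
qed

lemma taylor_lin_power: "trunc_eq M (taylor_poly (lin c ^ (M + E))) ([:lin c ^ E:] * Bc c E)"
proof -
  have "coeff (taylor_poly (lin c ^ (M + E))) k = coeff ([:lin c ^ E:] * Bc c E) k" if k: "k < M" for k
  proof -
    have "coeff (taylor_poly (lin c ^ (M + E))) k = of_nat ((M + E) choose k) * lin c ^ (M + E - k)"
      using k by (simp add: taylor_poly_power lin_def taylor_poly_linear coeff_linear_poly_power)
    also have "lin c ^ (M + E - k) = lin c ^ E * lin c ^ (M - k)"
      using k by (simp flip: power_add) (simp add: add.commute)
    also have "coeff (Bc c E) k = of_nat ((M + E) choose k) * lin c ^ (M - k)"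
      using k by (simp add: Bc_def coeff_sum)
    ultimately show ?thesis by simp
  qed
  then show ?thesis by (simp add: trunc_eq_def)
qed

lemma taylor_FMg: "trunc_eq M (taylor_poly (F ^ M * g ^ j)) ([:g ^ j:] * BB j)"
proof -
  have 1: "F ^ M * g ^ j = (\<Prod>c\<in>S. lin c ^ (M + j * e * ec c))"
    by (simp add: F_def g_def f_def power_add prod.distrib prod_power_distrib mult_ac flip: power_mult)
  have 2: "[:g ^ j:] = (\<Prod>c\<in>S. [:lin c ^ (j * e * ec c):])"
  proof -
    have "g ^ j = (\<Prod>c\<in>S. lin c ^ (j * e * ec c))"
      by (simp add: g_def f_def prod_power_distrib mult_ac flip: power_mult)
    moreover have "[:\<Prod>c\<in>A. h c:] = (\<Prod>c\<in>A. [:h c:])" for A and h :: "'a mod_ring \<Rightarrow> 'a mod_ring poly"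
    proof (induction A rule: infinite_finite_induct)
      case (insert x A)
      then show ?case by (simp flip: insert.IH)
    qed (auto simp: one_pCons)
    ultimately show ?thesis by simp
  qed
  show ?thesis
    unfolding 1 2 BB_def taylor_poly_prod prod.distrib[symmetric]
    by (intro trunc_eq_prod taylor_lin_power)
qed

lemma prime_CARD: "prime CARD('a)" by (rule prime_card)

text \<open>By the freshman's dream \<open>(\<pi> + T) ^ q = \<pi> ^ q + T ^ q\<close>, and
  \<open>T ^ q\<close> is invisible below order \<open>M\<close> because \<open>M \<le> q\<close>.
  So powers of \<open>\<pi> ^ q\<close> behave like constants under Taylor expansion.\<close>

lemma taylor_pi_q: "trunc_eq M (taylor_poly (\<pi> ^ q)) [:\<pi> ^ q:]"
proof -
  have "[:\<pi>, 1:] = [:\<pi>:] + monom 1 1" by (simp add: monom_altdef)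
  then have "taylor_poly (\<pi> ^ q) = ([:\<pi>:] + monom 1 1) ^ q"
    by (simp add: taylor_poly_power \<pi>_def taylor_poly_linear)
  also have "\<dots> = [:\<pi>:] ^ q + monom 1 1 ^ q"
    by (rule freshman_linear_power[where n = n]) (simp_all add: q prime_CARD)
  also have "[:\<pi>:] ^ q = [:\<pi> ^ q:]" by (simp add: poly_const_pow)
  also have "monom 1 1 ^ q = (monom 1 q :: 'a mod_ring poly poly)" by (simp add: monom_power)
  finally show ?thesis using M by (simp add: trunc_eq_def)
qed

lemma coeff_taylor_R:
  assumes "k < M"
  shows "coeff (taylor_poly (R h)) k =
    (\<Sum>(j, k')\<in>I. g ^ j * \<pi> ^ (q * k') * coeff (taylor_poly (h (j, k')) * BB j) k)"
proof -
  have "taylor_poly (R h) =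
      (\<Sum>(j, k')\<in>I. taylor_poly (h (j, k')) * taylor_poly (F ^ M * g ^ j) * taylor_poly (\<pi> ^ q) ^ k')"
    by (simp add: R_def sum_distrib_left taylor_poly_sum taylor_poly_mult taylor_poly_power
        power_mult split_def mult_ac flip: power_mult)
  moreover have "trunc_eq M (\<Sum>(j, k')\<in>I. taylor_poly (h (j, k')) * taylor_poly (F ^ M * g ^ j) * taylor_poly (\<pi> ^ q) ^ k')
     (\<Sum>(j, k')\<in>I. taylor_poly (h (j, k')) * ([:g ^ j:] * BB j) * [:\<pi> ^ q:] ^ k')"
    unfolding split_def
    by (intro trunc_eq_sum trunc_eq_mult trunc_eq_refl taylor_FMg trunc_eq_power taylor_pi_q)
  ultimately have "coeff (taylor_poly (R h)) k =
      coeff (\<Sum>(j, k')\<in>I. taylor_poly (h (j, k')) * ([:g ^ j:] * BB j) * [:\<pi> ^ q:] ^ k') k"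
    using assms by (simp add: trunc_eq_def)
  also have "\<dots> = (\<Sum>(j, k')\<in>I. g ^ j * \<pi> ^ (q * k') * coeff (taylor_poly (h (j, k')) * BB j) k)"
  proof -
    have "taylor_poly (h (j, k')) * ([:g ^ j:] * BB j) * [:\<pi> ^ q:] ^ k' =
        smult (g ^ j * \<pi> ^ (q * k')) (taylor_poly (h (j, k')) * BB j)" for j k'
      by (simp add: poly_const_pow mult_ac flip: power_mult)
    then show ?thesis by (simp add: coeff_sum split_def)
  qed
  finally show ?thesis .
qed

lemma dvd_coeff_taylor_R:
  assumes PX: "P dvd monom 1 q - monom 1 1" and Pg: "P dvd g - [:\<alpha>:]" and k: "k < M" and Y: "Y h k = 0"
  shows "P dvd coeff (taylor_poly (R h)) k"
proof -
  \<comment> \<open>\<open>c1\<close> lies in the prime field, so \<open>c1 ^ q = c1\<close>, and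
    \<open>\<pi> ^ q - \<pi>\<close> is just \<open>X ^ q - X\<close>.\<close>
  have pq: "\<pi> ^ q = monom 1 q - [:c1:]"
  proof -
    have "\<pi> ^ q = (monom 1 1 + [:- c1:]) ^ q" by (simp add: \<pi>_def monom_altdef)
    also have "\<dots> = monom 1 1 ^ q + [:- c1:] ^ q"
      by (rule freshman_linear_power[where n = n]) (simp_all add: q prime_CARD)
    also have "[:- c1:] ^ q = [:- c1:]"
      by (simp add: poly_const_pow q finite_field_power_card_power_eq_same)
    finally show ?thesis by (simp add: monom_power)
  qed
  have "\<pi> ^ q - \<pi> = monom 1 q - monom 1 1" unfolding pq by (simp add: \<pi>_def monom_altdef)
  then have P\<pi>: "P dvd \<pi> ^ q - \<pi>" using PX by simp
  have pw: "P dvd a ^ i - b ^ i" if "P dvd a - b" for a b i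
    using that by (metis dvd_trans dvd_triv_left power_diff_sumr2)
  have "P dvd g ^ j * \<pi> ^ (q * k') - [:\<alpha>:] ^ j * \<pi> ^ k'" for j k'
  proof -
    have "g ^ j * \<pi> ^ (q * k') - [:\<alpha>:] ^ j * \<pi> ^ k' =
        (g ^ j - [:\<alpha>:] ^ j) * (\<pi> ^ q) ^ k' + [:\<alpha>:] ^ j * ((\<pi> ^ q) ^ k' - \<pi> ^ k')"
      by (simp add: algebra_simps flip: power_mult)
    then show ?thesis using pw[OF P\<pi>, of k'] pw[OF Pg, of j] by simp
  qed
  then have "P dvd (\<Sum>(j, k')\<in>I. (g ^ j * \<pi> ^ (q * k') - [:\<alpha>:] ^ j * \<pi> ^ k') * coeff (taylor_poly (h (j, k')) * BB j) k)"
    by (auto intro!: dvd_sum)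
  also have "\<dots> = coeff (taylor_poly (R h)) k - Y h k"
    by (simp add: coeff_taylor_R[OF k] Y_def sum_subtractf[symmetric] split_def algebra_simps poly_const_pow)
  finally show ?thesis using Y by simp
qed

lemma Y_below:
  assumes "\<And>i. i \<in> I \<Longrightarrow> h i \<in> polys_below e"
  shows "Y h k \<in> polys_below (K + card S * M + e)"
  unfolding Y_def
proof (intro polys_below_sum, clarify)
  fix j k' assume jk: "(j, k') \<in> I"
  have "coeff (BB j * taylor_poly (h (j, k'))) k \<in> polys_below (card S * M + e)"
    unfolding BB_def
    by (intro coeffs_below_mult coeffs_below_prod coeff_Bc coeff_taylor_poly_below assms jk finS)
  moreover have "\<pi> ^ k' \<in> polys_below (Suc K)"
    using jk linear_power_below[of "- c1" k'] polys_below_mono[of "Suc k'" "Suc K"]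
    unfolding \<pi>_def I_def by auto
  ultimately have "\<pi> ^ k' * coeff (BB j * taylor_poly (h (j, k'))) k \<in> polys_below (K + (card S * M + e))"
    by (intro polys_below_mult)
  then show "smult (\<alpha> ^ j) (\<pi> ^ k' * coeff (taylor_poly (h (j, k')) * BB j) k) \<in> polys_below (K + card S * M + e)"
    by (auto simp: polys_below_def mult.commute add.assoc)
qed

lemma Y_diff: "Y (\<lambda>i. h1 i - h2 i) k = Y h1 k - Y h2 k"
proof -
  have "taylor_poly (h1 i - h2 i) * b = taylor_poly (h1 i) * b - taylor_poly (h2 i) * b" for i b
    by (simp add: taylor_poly_diff left_diff_distrib)
  then show ?thesis
    by (simp add: Y_def sum_subtractf[symmetric] split_def right_diff_distrib smult_diff_right)
qed

text \<open>Siegel's lemma by counting: by \<open>big\<close>, the families \<open>h\<close>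
  outnumber the possible values of all \<open>Y h k\<close> together. Two families agree, and
  \<open>Y\<close> respects differences.\<close>

lemma exists_family:
  "\<exists>h. (\<forall>i\<in>I. h i \<in> polys_below e) \<and> (\<exists>i\<in>I. h i \<noteq> 0) \<and> (\<forall>k<M. Y h k = 0)"
proof -
  define D1 where "D1 = K + card S * M + e"
  define HH where "HH = PiE I (\<lambda>_. polys_below e :: 'a mod_ring poly set)"
  define TT where "TT = PiE {..<M} (\<lambda>_. polys_below D1 :: 'a mod_ring poly set)"
  define \<Phi> where "\<Phi> h = restrict (Y h) {..<M}" for h
  have "card HH = (CARD('a) ^ e) ^ (d * K)"
    by (simp add: HH_def card_PiE I_def card_polys_below card_cartesian_product)
  also have "\<dots> = CARD('a) ^ (K * d * e)" by (simp add: power_mult[symmetric] mult_ac)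
  finally have cH: "card HH = CARD('a) ^ (K * d * e)" .
  have cT: "card TT = CARD('a) ^ (M * D1)"
    by (simp add: TT_def card_PiE card_polys_below power_mult[symmetric] mult_ac)
  have "1 < CARD('a)" using prime_CARD prime_gt_1_nat by blast
  then have "card TT < card HH" unfolding cH cT D1_def using big by simp
  moreover have "finite TT" by (simp add: TT_def finite_PiE)
  moreover have "\<Phi> ` HH \<subseteq> TT"
    unfolding \<Phi>_def TT_def HH_def D1_def by (auto intro!: restrict_PiE_iff[THEN iffD2] Y_below)
  ultimately have "\<not> inj_on \<Phi> HH" by (meson card_inj_on_le leD)
  then obtain h1 h2 where h: "h1 \<in> HH" "h2 \<in> HH" "h1 \<noteq> h2" "\<Phi> h1 = \<Phi> h2" by (auto simp: inj_on_def)
  have "\<exists>i\<in>I. h1 i \<noteq> h2 i" using h unfolding HH_def by (meson PiE_ext)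
  moreover have "Y h1 k = Y h2 k" if "k < M" for k
    using fun_cong[OF h(4), of k] that by (simp add: \<Phi>_def)
  ultimately show ?thesis
    using h by (intro exI[of _ "\<lambda>i. h1 i - h2 i"]) (auto simp: Y_diff HH_def PiE_iff intro!: polys_below_diff)
qed

text \<open>As \<open>c1\<close> has exponent 1, the term with index \<open>(j, k)\<close> contains
  \<open>\<pi>\<close> exactly \<open>j * e + q * k\<close> times, apart from what
  \<open>h (j, k)\<close> contributes. These weights are at least \<open>e\<close> apart because
  \<open>j * e + e \<le> q - 1\<close>, whereas a nonzero \<open>h (j, k)\<close>, of degree below
  \<open>e\<close>, contributes less than \<open>e\<close>. So the term of least weight cannot
  cancel.\<close>

lemma R_nonzero:
  assumes hb: "\<And>i. i \<in> I \<Longrightarrow> h i \<in> polys_below e" and nz: "\<exists>i\<in>I. h i \<noteq> 0"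
  shows "R h \<noteq> 0"
proof
  assume R0: "R h = 0"
  have linnz: "lin c \<noteq> 0" for c by (simp add: lin_def)
  have "F \<noteq> 0" using linnz by (simp add: F_def)
  then have sum0: "(\<Sum>i\<in>I. h i * g ^ fst i * \<pi> ^ (q * snd i)) = 0"
    using R0 by (simp add: R_def split_def)
  define w where "w i = fst i * e + q * snd i" for i :: "nat \<times> nat"
  define N where "N = {i\<in>I. h i \<noteq> 0}"
  have "finite N" "N \<noteq> {}" using nz by (auto simp: N_def I_def)
  then obtain i0 where i0: "i0 \<in> N" "\<And>i. i \<in> N \<Longrightarrow> w i0 \<le> w i"
    using arg_min_if_finite[of N w] by (metis leI)
  define f' where "f' = (\<Prod>c\<in>S-{c1}. lin c ^ ec c)"
  have ff: "f = \<pi> * f'"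
    unfolding f_def f'_def using c1 by (subst prod.remove[of _ c1]) (auto simp: \<pi>_def lin_def)
  have gf: "g ^ j = \<pi> ^ (j * e) * f' ^ (j * e)" for j
    by (simp add: g_def ff power_mult_distrib flip: power_mult) (simp add: mult.commute)
  have tm: "h i * g ^ fst i * \<pi> ^ (q * snd i) = \<pi> ^ w i * (h i * f' ^ (fst i * e))" for i
    by (simp add: gf w_def power_add mult_ac)
  have q0: "q > 0" using q by (simp add: prime_gt_0_nat[OF prime_CARD])
  have e0: "h i0 \<noteq> 0" "i0 \<in> I" using i0 by (auto simp: N_def)
  have epos: "e > 0" using hb[OF e0(2)] e0(1) by (cases e) auto
  have sep: "w i0 + e \<le> w i" if i: "i \<in> N" "i \<noteq> i0" for i
  proof -
    obtain j k j0 k0 where jk: "i = (j, k)" "i0 = (j0, k0)" by (cases i, cases i0)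
    have le: "w i0 \<le> w i" using i0 i by simp
    have jd: "j < d" "j0 < d" using i i0 jk by (auto simp: N_def I_def)
    have jb: "j0 * e + e \<le> q - 1" "j * e + e \<le> q - 1"
      using jd de mult_le_mono1[of "Suc j0" d e] mult_le_mono1[of "Suc j" d e] by auto
    consider "k = k0" | "k < k0" | "k0 < k" by linarith
    then show ?thesis
    proof cases
      case 1
      then have "j0 * e \<le> j * e" using le jk by (simp add: w_def)
      moreover have "j \<noteq> j0" using 1 jk i by auto
      ultimately have "Suc j0 \<le> j" using epos by simp
      then have "Suc j0 * e \<le> j * e" by (rule mult_le_mono1)
      then show ?thesis using 1 jk by (simp add: w_def)
    next
      case 2
      then have "q * k + q \<le> q * k0" using mult_le_mono2[of "Suc k" k0 q] by simp
      then show ?thesis using le jk jb q0 by (simp add: w_def)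
    next
      case 3
      then have "q * k0 + q \<le> q * k" using mult_le_mono2[of "Suc k0" k q] by simp
      then show ?thesis using jk jb q0 by (simp add: w_def)
    qed
  qed
  have "finite I" by (simp add: I_def)
  then have "h i0 * g ^ fst i0 * \<pi> ^ (q * snd i0) = - (\<Sum>i\<in>I-{i0}. h i * g ^ fst i * \<pi> ^ (q * snd i))"
    using sum0 e0(2) by (simp add: sum.remove eq_neg_iff_add_eq_0)
  moreover have "\<pi> ^ (w i0 + e) dvd (\<Sum>i\<in>I-{i0}. h i * g ^ fst i * \<pi> ^ (q * snd i))"
  proof (intro dvd_sum)
    fix i assume "i \<in> I - {i0}"
    then show "\<pi> ^ (w i0 + e) dvd h i * g ^ fst i * \<pi> ^ (q * snd i)"
    proof (cases "h i = 0")
      case False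
      then have "w i0 + e \<le> w i" using sep[of i] \<open>i \<in> I - {i0}\<close> by (auto simp: N_def)
      then show ?thesis unfolding tm by (intro dvd_mult2 le_imp_power_dvd)
    qed simp
  qed
  ultimately have "\<pi> ^ (w i0 + e) dvd \<pi> ^ w i0 * (h i0 * f' ^ (fst i0 * e))"
    by (simp only: tm[symmetric] dvd_minus_iff)
  then have "\<pi> ^ e dvd h i0 * f' ^ (fst i0 * e)"
    by (simp add: power_add \<pi>_def)
  moreover have "coprime (\<pi> ^ e) (f' ^ (fst i0 * e))"
  proof -
    have "coprime \<pi> f'"
    proof (rule prime_elem_imp_coprime)
      show "prime_elem \<pi>" unfolding \<pi>_def by (rule prime_elem_linear_field_poly) simp
      show "\<not> \<pi> dvd f'"
        by (auto simp: \<pi>_def f'_def lin_def dvd_iff_poly_eq_0 poly_prod)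
    qed
    then show ?thesis by simp
  qed
  ultimately have "\<pi> ^ e dvd h i0" by (metis coprime_dvd_mult_left_iff)
  then have "degree (\<pi> ^ e) \<le> degree (h i0)" using e0 by (intro dvd_imp_degree_le) auto
  then have "e \<le> degree (h i0)" by (simp add: \<pi>_def degree_linear_power)
  then show False using hb[OF e0(2)] e0(1) by (auto simp: polys_below_iff_degree)
qed

lemma degree_R_le:
  assumes hb: "\<And>i. i \<in> I \<Longrightarrow> h i \<in> polys_below e"
  shows "degree (R h) \<le> card S * M + (e + q * (\<Sum>c\<in>S. ec c) + q * K)"
proof -
  have dl: "degree (lin c ^ k) = k" for c k by (simp add: lin_def degree_linear_power)
  have "degree (F ^ M) \<le> card S * M"
  proof -
    have "degree F \<le> (\<Sum>c\<in>S. 1)"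
      unfolding F_def using degree_prod_sum_le[OF finS, of lin] by (simp add: lin_def)
    then show ?thesis using degree_power_le[of F M] by (simp add: mult_le_mono1 order_trans)
  qed
  moreover have "degree (\<Sum>(j, k)\<in>I. h (j, k) * g ^ j * \<pi> ^ (q * k)) \<le> e + q * (\<Sum>c\<in>S. ec c) + q * K"
  proof (rule degree_sum_le)
    show "finite I" by (simp add: I_def)
    fix i assume i: "i \<in> I"
    obtain j k where jk: "i = (j, k)" by (cases i)
    have "degree f \<le> (\<Sum>c\<in>S. ec c)"
      unfolding f_def using degree_prod_sum_le[OF finS, of "\<lambda>c. lin c ^ ec c"] by (simp add: dl)
    then have "degree (g ^ j) \<le> (j * e) * (\<Sum>c\<in>S. ec c)"
      unfolding g_def power_mult[symmetric]
      using degree_power_le[of f "e * j"] by (simp add: mult.commute) (meson le_trans mult_le_mono2)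
    also have "\<dots> \<le> q * (\<Sum>c\<in>S. ec c)"
    proof -
      have "j * e \<le> d * e" using i jk by (simp add: I_def)
      then have "j * e \<le> q" using de by simp
      then show ?thesis by (rule mult_le_mono1)
    qed
    finally have 1: "degree (g ^ j) \<le> q * (\<Sum>c\<in>S. ec c)" .
    have 2: "degree (\<pi> ^ (q * k)) \<le> q * K"
      using i jk by (simp add: \<pi>_def degree_linear_power I_def)
    have 3: "degree (h i) \<le> e" using hb[OF i] by (auto simp: polys_below_iff_degree)
    have "degree (h i * g ^ j * \<pi> ^ (q * k)) \<le> degree (h i) + degree (g ^ j) + degree (\<pi> ^ (q * k))"
      by (meson add_le_mono1 degree_mult_le le_trans)
    then show "degree (case i of (j, k) \<Rightarrow> h (j, k) * g ^ j * \<pi> ^ (q * k)) \<le> e + q * (\<Sum>c\<in>S. ec c) + q * K"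
      using 1 2 3 jk by simp
  qed
  ultimately show ?thesis
    unfolding R_def by (meson add_le_mono degree_mult_le le_trans)
qed

text \<open>Distinct monic primes are coprime, so their multiplicities \<open>M\<close> add up in
  the degree of \<open>R h\<close>. After division by \<open>M\<close> the bound is close to
  \<open>q * K / M\<close>.\<close>

theorem stepanov_degree_bound:
  assumes fin: "finite PP"
    and PP: "\<And>P. P \<in> PP \<Longrightarrow> prime_elem P \<and> lead_coeff P = 1 \<and> P dvd monom 1 q - monom 1 1 \<and> P dvd f ^ e - [:\<alpha>:]"
  shows "M * (\<Sum>P\<in>PP. degree P) \<le> card S * M + (e + q * (\<Sum>c\<in>S. ec c) + q * K)"
proof -
  obtain h where hh: "\<forall>i\<in>I. h i \<in> polys_below e" "\<exists>i\<in>I. h i \<noteq> 0" "\<forall>k<M. Y h k = 0"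
    using exists_family by (elim exE conjE)
  have h: "\<And>i. i \<in> I \<Longrightarrow> h i \<in> polys_below e" "\<exists>i\<in>I. h i \<noteq> 0" "\<And>k. k < M \<Longrightarrow> Y h k = 0"
    using hh by auto
  have nz: "R h \<noteq> 0" using R_nonzero h by blast
  have PM: "P ^ M dvd R h" if P: "P \<in> PP" for P
  proof (rule taylor_vanishing_imp_power_dvd)
    show "prime_elem P" using PP[OF P] by simp
    \<comment> \<open>Divisors of \<open>X ^ q - X\<close> are separable, since that polynomial has
      derivative \<open>- 1\<close>.\<close>
    show "\<not> P dvd pderiv P"
    proof
      assume dv: "P dvd pderiv P"
      obtain Z where Z: "monom 1 q - monom 1 1 = P * Z" using PP[OF P] by (auto elim: dvdE)
      have "pderiv (monom 1 q - monom 1 1 :: 'a mod_ring poly) = P * pderiv Z + Z * pderiv P"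
        unfolding Z by (simp add: pderiv_mult)
      then have d1: "P dvd pderiv (monom 1 q - monom 1 1 :: 'a mod_ring poly)" using dv by simp
      show False
      proof (cases "n = 0")
        \<comment> \<open>Here \<open>q = 1\<close>, so \<open>d * e = 0\<close> and
          \<open>big\<close> is violated.\<close>
        case True
        then have "d * e = 0" using q de by simp
        then have "K * d * e = 0" by simp
        then show ?thesis using big by linarith
      next
        case False
        then have "of_nat q = (0 :: 'a mod_ring)" by (simp add: q)
        then have "pderiv (monom 1 q - monom 1 1 :: 'a mod_ring poly) = - 1"
          by (simp add: pderiv_diff pderiv_monom)
        then have "P dvd 1" using d1 by simp
        then show False using PP[OF P] prime_elem_not_unit by blast
      qed
    qed
    show "P dvd coeff (taylor_poly (R h)) k" if "k < M" for k
      using PP[OF P] that h(3) by (intro dvd_coeff_taylor_R) (auto simp: g_def)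
  qed
  have cop: "coprime P Q" if PQ: "P \<in> PP" "Q \<in> PP" "P \<noteq> Q" for P Q
  proof -
    have "prime P" "prime Q"
      using PP[OF PQ(1)] PP[OF PQ(2)] by (simp_all add: normalization_semidom_class.prime_def normalize_monic)
    then show ?thesis using PQ(3) by (rule primes_coprime)
  qed
  have "(\<Prod>P\<in>A. P ^ M) dvd R h" if "A \<subseteq> PP" for A
    using finite_subset[OF that fin] that
  proof (induction A rule: finite_induct)
    case (insert P A)
    have "coprime (P ^ M) (Q ^ M)" if "Q \<in> A" for Q
      using cop[of P Q] insert that by (metis coprime_power_left_iff coprime_power_right_iff insert_subset subsetD)
    then have "coprime (P ^ M) (\<Prod>P\<in>A. P ^ M)" by (rule prod_coprime_right)
    moreover have "(\<Prod>P\<in>A. P ^ M) dvd R h" "P ^ M dvd R h" using insert PM by blast+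
    ultimately show ?case using insert.hyps by (simp add: divides_mult)
  qed simp
  then have "(\<Prod>P\<in>PP. P ^ M) dvd R h" by blast
  then have "degree (\<Prod>P\<in>PP. P ^ M) \<le> degree (R h)" using nz by (rule dvd_imp_degree_le)
  moreover have "degree (\<Prod>P\<in>PP. P ^ M) = (\<Sum>P\<in>PP. M * degree P)"
  proof -
    have "P \<noteq> 0" if "P \<in> PP" for P using PP[OF that] by auto
    then show ?thesis by (subst degree_prod_sum_eq) (simp_all add: degree_power_eq mult.commute)
  qed
  ultimately show ?thesis
    using le_trans[OF _ degree_R_le[of h, OF h(1)]] by (simp only: sum_distrib_left)
qed

end

section \<open>Prime polynomials and Weil's bound\<close>

lemma frobenius_diff:
  fixes x y :: "'a::comm_ring_1"
  assumes "prime CHAR('a)"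
  shows "(x - y) ^ (CHAR('a) ^ n) = x ^ (CHAR('a) ^ n) - y ^ (CHAR('a) ^ n)"
proof -
  have "((x - y) + y) ^ (CHAR('a) ^ n) = (x - y) ^ (CHAR('a) ^ n) + y ^ (CHAR('a) ^ n)"
    by (rule freshmans_dream') (use assms in auto)
  then show ?thesis by simp
qed

context
  fixes P :: "'a::prime_card mod_ring poly" and \<xi> :: "'a mod_ring alg_closure"
  assumes P: "prime_elem P" "lead_coeff P = 1" and root: "poly (map_poly to_ac P) \<xi> = 0"
begin

interpretation ac: map_poly_comm_ring_hom "to_ac :: 'a mod_ring \<Rightarrow> _"
  by unfold_locales auto

lemma dvd_if_root:
  assumes "poly (map_poly to_ac R) \<xi> = 0"
  shows "P dvd R"
proof (rule ccontr)
  assume "\<not> P dvd R"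
  then have "coprime P R" using P by (simp add: prime_elem_imp_coprime)
  then obtain a b where "a * P + b * R = 1"
    using bezout_coefficients_fst_snd[of P R] by auto
  then have "poly (map_poly to_ac (a * P + b * R)) \<xi> = 1" by simp
  then show False using assms root by (simp add: hom_distribs)
qed

lemma prime_CHAR_ac: "prime CHAR('a mod_ring alg_closure)"
  by (simp add: prime_card)

lemma frob_eval:
  fixes R :: "'a mod_ring poly"
  shows "poly (map_poly to_ac R) \<zeta> ^ (CARD('a) ^ n) = poly (map_poly to_ac R) (\<zeta> ^ (CARD('a) ^ n))"
proof (induction R)
  case (pCons a R)
  have "(to_ac a + \<zeta> * poly (map_poly to_ac R) \<zeta>) ^ (CARD('a) ^ n) =
      to_ac a ^ (CARD('a) ^ n) + (\<zeta> * poly (map_poly to_ac R) \<zeta>) ^ (CARD('a) ^ n)"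
    by (rule freshmans_dream'[where n = n]) (simp_all add: prime_card)
  moreover have "to_ac a ^ (CARD('a) ^ n) = to_ac a"
    by (simp add: finite_field_power_card_power_eq_same flip: to_ac_power)
  ultimately show ?case
    using pCons.hyps by (simp add: map_poly_pCons power_mult_distrib pCons.IH)
qed (simp add: zero_power prime_card prime_gt_0_nat)

lemma frob_root: "poly (map_poly to_ac P) (\<xi> ^ (CARD('a) ^ n)) = 0"
proof -
  have "CARD('a) > 0" by (simp)
  then show ?thesis using frob_eval[of P \<xi> n] root by (simp add: zero_power)
qed

text \<open>With \<open>p = CARD('a)\<close>: the polynomials of degree below
  \<open>degree P\<close> take distinct values at \<open>\<xi>\<close>, and all these values are
  fixed by the \<open>l\<close>-th power of Frobenius if \<open>\<xi>\<close> is. So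
  \<open>X ^ (p ^ l) - X\<close> has at least \<open>p ^ degree P\<close> zeros.\<close>

lemma frob_period_ge: assumes "0 < l" "\<xi> ^ (CARD('a) ^ l) = \<xi>" shows "degree P \<le> l"
proof (rule ccontr)
  assume "\<not> ?thesis"
  then have l: "l < degree P" by simp
  define Z where "Z = {y. poly (monom 1 (CARD('a) ^ l) - monom 1 1) y = (0 :: 'a mod_ring alg_closure)}"
  have p1: "1 < CARD('a)" using prime_card prime_gt_1_nat by blast
  then have q1: "1 < CARD('a) ^ l" using assms(1) by (rule one_less_power)
  have dg: "degree (monom 1 (CARD('a) ^ l) - monom 1 1 :: 'a mod_ring alg_closure poly) = CARD('a) ^ l"
    using q1 unfolding diff_conv_add_uminus by (subst degree_add_eq_left) (auto simp: degree_monom_eq)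
  then have nz: "monom 1 (CARD('a) ^ l) - monom 1 1 \<noteq> (0 :: 'a mod_ring alg_closure poly)"
    using q1 by (metis degree_0 less_numeral_extra(3) not_less_zero)
  have fin: "finite Z" unfolding Z_def by (rule poly_roots_finite[OF nz])
  have "card Z \<le> CARD('a) ^ l"
    unfolding Z_def using poly_roots_degree[OF nz] dg by simp
  moreover have "(\<lambda>h. poly (map_poly to_ac h) \<xi>) ` polys_below (degree P) \<subseteq> Z"
    by (auto simp: Z_def poly_monom frob_eval assms(2))
  moreover have "inj_on (\<lambda>h. poly (map_poly to_ac h) \<xi>) (polys_below (degree P))"
  proof (rule inj_onI)
    fix g h assume gh: "g \<in> polys_below (degree P)" "h \<in> polys_below (degree P)"
      "poly (map_poly to_ac g) \<xi> = poly (map_poly to_ac h) \<xi>"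
    then have "poly (map_poly to_ac (g - h)) \<xi> = 0" by (simp add: hom_distribs)
    then have "P dvd g - h" by (rule dvd_if_root)
    moreover have "g - h \<in> polys_below (degree P)" using gh by (intro polys_below_diff)
    ultimately show "g = h"
      by (metis dvd_imp_degree_le eq_iff_diff_eq_0 leD polys_below_iff_degree)
  qed
  ultimately have "card (polys_below (degree P) :: 'a mod_ring poly set) \<le> CARD('a) ^ l"
    using fin by (meson card_inj_on_le le_trans)
  then show False using l p1 by (simp add: card_polys_below)
qed

lemma frob_cancel: assumes "i < j" "\<xi> ^ (CARD('a) ^ i) = \<xi> ^ (CARD('a) ^ j)" shows "\<xi> ^ (CARD('a) ^ (j - i)) = \<xi>"
proof -
  have "(\<xi> ^ (CARD('a) ^ (j - i)) - \<xi>) ^ (CARD('a) ^ i) = \<xi> ^ (CARD('a) ^ j) - \<xi> ^ (CARD('a) ^ i)"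
    using frobenius_diff[OF prime_CHAR_ac, of "\<xi> ^ (CARD('a) ^ (j - i))" \<xi> i] assms(1)
    by (simp flip: power_mult power_add)
  then show ?thesis using assms(2) by simp
qed

text \<open>The first \<open>degree P\<close> Frobenius conjugates of \<open>\<xi>\<close> are
  distinct roots of both sides. A nonzero difference would have all of them as roots, but its degree
  is smaller because the leading terms cancel.\<close>

lemma map_P_eq: "map_poly to_ac P = (\<Prod>i<degree P. [:- (\<xi> ^ (CARD('a) ^ i)), 1:])"
proof (rule ccontr)
  define A where "A = (\<lambda>i. \<xi> ^ (CARD('a) ^ i)) ` {..<degree P}"
  define Q where "Q = (\<Prod>i<degree P. [:- (\<xi> ^ (CARD('a) ^ i)), 1:])"
  assume "map_poly to_ac P \<noteq> (\<Prod>i<degree P. [:- (\<xi> ^ (CARD('a) ^ i)), 1:])"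
  then have nz: "map_poly to_ac P - Q \<noteq> 0" by (simp add: Q_def)
  have D0: "degree P > 0" using P by (metis prime_elem_not_unit is_unit_iff_degree prime_elem_not_zeroI gr0I)
  have inj: "inj_on (\<lambda>i. \<xi> ^ (CARD('a) ^ i)) {..<degree P}"
  proof (rule linorder_inj_onI)
    fix i j assume ij: "i < j" "i \<in> {..<degree P}" "j \<in> {..<degree P}"
    show "\<xi> ^ (CARD('a) ^ i) \<noteq> \<xi> ^ (CARD('a) ^ j)"
    proof
      assume "\<xi> ^ (CARD('a) ^ i) = \<xi> ^ (CARD('a) ^ j)"
      then have "degree P \<le> j - i" using frob_cancel[of i j] frob_period_ge[of "j - i"] ij by simp
      then show False using ij by simp
    qed
  qed auto
  have degQ: "degree Q = degree P" "lead_coeff Q = 1"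
    unfolding Q_def by (simp add: degree_prod_sum_eq) (simp only: lead_coeff_prod, simp)
  have degP: "degree (map_poly to_ac P) = degree P" "lead_coeff (map_poly to_ac P) = 1"
    using P by (simp_all add: degree_map_poly coeff_map_poly)
  have "degree (map_poly to_ac P - Q) < degree P"
  proof -
    have "coeff (map_poly to_ac P - Q) (degree P) = 0" using degQ degP by simp
    moreover have "degree (map_poly to_ac P - Q) \<le> degree P" using degQ degP by (metis degree_diff_le le_refl)
    ultimately show ?thesis using nz D0 by (metis leading_coeff_0_iff le_neq_implies_less)
  qed
  moreover have "A \<subseteq> {x. poly (map_poly to_ac P - Q) x = 0}"
    by (auto simp: A_def Q_def poly_prod frob_root)
  then have "card A \<le> card {x. poly (map_poly to_ac P - Q) x = 0}"
    by (intro card_mono poly_roots_finite nz)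
  then have "card A \<le> degree (map_poly to_ac P - Q)" using poly_roots_degree[OF nz] by simp
  moreover have "card A = degree P" unfolding A_def using inj by (simp add: card_image)
  ultimately show False by simp
qed

lemma frob_period: "\<xi> ^ (CARD('a) ^ degree P) = \<xi>"
proof -
  have "poly (map_poly to_ac P) (\<xi> ^ (CARD('a) ^ degree P)) = 0" by (rule frob_root)
  then obtain i where i: "i < degree P" "\<xi> ^ (CARD('a) ^ degree P) = \<xi> ^ (CARD('a) ^ i)"
    by (subst (asm) map_P_eq) (auto simp: poly_prod)
  show ?thesis
  proof (cases "i = 0")
    case False
    then have "degree P \<le> degree P - i"
      using frob_cancel[of i "degree P"] i by (intro frob_period_ge) auto
    then show ?thesis using False i by simp
  qed (use i in simp)
qed

lemma frob_period_mult: "\<xi> ^ (CARD('a) ^ (degree P * k)) = \<xi>"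
proof (induction k)
  case (Suc k)
  have "CARD('a) ^ (degree P * Suc k) = CARD('a) ^ degree P * CARD('a) ^ (degree P * k)"
    by (simp add: power_add)
  then show ?case
    using power_mult[of \<xi> "CARD('a) ^ degree P" "CARD('a) ^ (degree P * k)"] frob_period Suc by metis
qed simp

text \<open>For \<open>n = degree P * k\<close> the exponent is \<open>(p ^ n - 1) / (p - 1)\<close>
  with \<open>p = CARD('a)\<close>, so the power is the product of \<open>n\<close> Frobenius
  conjugates of \<open>\<xi> - to_ac c\<close>. They repeat with period \<open>degree P\<close>, and
  one period multiplies to \<open>(- 1) ^ degree P * P(c)\<close>.\<close>

lemma norm_linear:
  "(\<xi> - to_ac c) ^ (\<Sum>i<degree P * k. CARD('a) ^ i) = (- 1) ^ (degree P * k) * to_ac (poly P c) ^ k"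
proof -
  have "(\<xi> - to_ac c) ^ (\<Sum>i<n. CARD('a) ^ i) = (\<Prod>i<n. \<xi> ^ (CARD('a) ^ i) - to_ac c)" for n
  proof -
    have "(\<xi> - to_ac c) ^ (CARD('a) ^ i) = \<xi> ^ (CARD('a) ^ i) - to_ac c" for i
    proof -
      have "to_ac c ^ (CARD('a) ^ i) = to_ac c"
        by (simp add: finite_field_power_card_power_eq_same flip: to_ac_power)
      then show ?thesis using frobenius_diff[OF prime_CHAR_ac, of \<xi> "to_ac c" i] by simp
    qed
    then show ?thesis by (simp add: power_sum)
  qed
  moreover have "(\<Prod>i<degree P * k. \<xi> ^ (CARD('a) ^ i) - to_ac c) = ((- 1) ^ degree P * to_ac (poly P c)) ^ k"
  proof (induction k)
    case (Suc k)
    have sh: "\<xi> ^ (CARD('a) ^ (degree P * k + i)) = \<xi> ^ (CARD('a) ^ i)" for i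
      by (simp only: power_add power_mult[of \<xi>] frob_period_mult)
    have "(\<Prod>i<degree P * Suc k. \<xi> ^ (CARD('a) ^ i) - to_ac c) =
        (\<Prod>i<degree P * k + degree P. \<xi> ^ (CARD('a) ^ i) - to_ac c)" by (simp add: add.commute)
    also have "\<dots> = (\<Prod>i<degree P * k. \<xi> ^ (CARD('a) ^ i) - to_ac c) * (\<Prod>i<degree P. \<xi> ^ (CARD('a) ^ i) - to_ac c)"
    proof -
      have "(\<Prod>i<a + b. u i) = (\<Prod>i<a. u i) * (\<Prod>i<b. u (a + i))"
        for a b and u :: "nat \<Rightarrow> 'a mod_ring alg_closure"
        by (induction b) (simp_all add: mult.assoc)
      then show ?thesis by (simp add: sh)
    qed
    also have "(\<Prod>i<degree P. \<xi> ^ (CARD('a) ^ i) - to_ac c) = (- 1) ^ degree P * to_ac (poly P c)"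
    proof -
      have "to_ac (poly R c) = poly (map_poly to_ac R) (to_ac c)" for R
        by (induction R) (simp_all add: map_poly_pCons)
      then have "to_ac (poly P c) = poly (map_poly to_ac P) (to_ac c)" .
      also have "\<dots> = (\<Prod>i<degree P. to_ac c - \<xi> ^ (CARD('a) ^ i))"
        by (subst map_P_eq) (simp add: poly_prod)
      also have "\<dots> = (\<Prod>i<degree P. (- 1) * (\<xi> ^ (CARD('a) ^ i) - to_ac c))" by simp
      also have "\<dots> = (- 1) ^ degree P * (\<Prod>i<degree P. \<xi> ^ (CARD('a) ^ i) - to_ac c)"
        by (simp only: prod.distrib prod_constant card_lessThan)
      finally show ?thesis by (simp flip: power_mult_distrib mult.assoc)
    qed
    finally show ?case using Suc by (simp add: mult.commute)
  qed simp
  ultimately show ?thesis by (simp add: power_mult_distrib power_mult)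
qed

lemma prime_poly_norm_aux:
  "P dvd monom 1 (CARD('a) ^ (degree P * k)) - monom 1 1"
  "P dvd [:- c, 1:] ^ (\<Sum>i<degree P * k. CARD('a) ^ i) - [:(- 1) ^ (degree P * k) * poly P c ^ k:]"
proof -
  show "P dvd monom 1 (CARD('a) ^ (degree P * k)) - monom 1 1"
    by (rule dvd_if_root) (simp add: hom_distribs map_poly_monom poly_monom frob_period_mult)
  have "poly (map_poly to_ac [:- c, 1:]) \<xi> = \<xi> - to_ac c" by (simp add: map_poly_pCons)
  then show "P dvd [:- c, 1:] ^ (\<Sum>i<degree P * k. CARD('a) ^ i) - [:(- 1) ^ (degree P * k) * poly P c ^ k:]"
    by (intro dvd_if_root) (simp add: hom_distribs norm_linear)
qed

end

text \<open>The two congruences from which the hypotheses of \<open>stepanov_degree_bound\<close>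
  are obtained, with the root in the algebraic closure eliminated.\<close>

lemma prime_poly_norm:
  fixes P :: "'a::prime_card mod_ring poly"
  assumes P: "prime_elem P" "lead_coeff P = 1"
  shows "P dvd monom 1 (CARD('a) ^ (degree P * k)) - monom 1 1"
    "P dvd [:- c, 1:] ^ (\<Sum>i<degree P * k. CARD('a) ^ i) - [:(- 1) ^ (degree P * k) * poly P c ^ k:]"
proof -
  have D0: "degree P > 0" using P by (metis prime_elem_not_unit is_unit_iff_degree prime_elem_not_zeroI gr0I)
  then obtain \<xi> :: "'a mod_ring alg_closure" where "poly (map_poly to_ac P) \<xi> = 0"
    using alg_closed_imp_poly_has_root[of "map_poly to_ac P"] by (auto simp: degree_map_poly)
  then show "P dvd monom 1 (CARD('a) ^ (degree P * k)) - monom 1 1"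
    "P dvd [:- c, 1:] ^ (\<Sum>i<degree P * k. CARD('a) ^ i) - [:(- 1) ^ (degree P * k) * poly P c ^ k:]"
    using prime_poly_norm_aux[OF P] by blast+
qed

section \<open>Monic polynomials and Newton's identities\<close>

definition monics :: "nat \<Rightarrow> 'a::comm_ring_1 poly set" where
  "monics n = {g. lead_coeff g = 1 \<and> degree g = n}"

definition prime_monics :: "'a::field_gcd poly set" where
  "prime_monics = {P. prime_elem P \<and> lead_coeff P = 1}"

lemma monics_eq_image: "monics n = (\<lambda>h. monom 1 n + h) ` (polys_below n :: 'a::comm_ring_1 poly set)"
proof (intro equalityI subsetI)
  fix g :: "'a poly" assume g: "g \<in> monics n"
  have "g - monom 1 n \<in> polys_below n"
    using g by (auto simp: polys_below_def monics_def coeff_eq_0)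
  then show "g \<in> (\<lambda>h. monom 1 n + h) ` polys_below n" by (intro image_eqI[of _ _ "g - monom 1 n"]) auto
next
  fix g :: "'a poly" assume "g \<in> (\<lambda>h. monom 1 n + h) ` polys_below n"
  then obtain h where h: "g = monom 1 n + h" "h \<in> polys_below n" by auto
  have c: "coeff g n = 1" using h by (simp add: polys_below_def)
  have "degree g \<le> n" using h by (intro degree_le) (auto simp: polys_below_def)
  moreover have "n \<le> degree g" using c by (intro le_degree) auto
  ultimately show "g \<in> monics n" using c by (auto simp: monics_def)
qed

lemma finite_monics [simp]: "finite (monics n :: 'a::{finite, comm_ring_1} poly set)"
  by (simp add: monics_eq_image)

lemma card_monics: "card (monics n :: 'a::{finite, comm_ring_1} poly set) = CARD('a) ^ n"
  unfolding monics_eq_image by (subst card_image) (auto simp: inj_on_def card_polys_below)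

lemma monics_0: "monics 0 = {1 :: 'a::comm_ring_1 poly}"
  by (auto simp: monics_eq_image monom_0 one_pCons)

lemma monics_mult: "f \<in> monics m \<Longrightarrow> g \<in> monics n \<Longrightarrow> f * g \<in> monics (m + n)"
  for f :: "'a::idom poly"
proof -
  assume fg: "f \<in> monics m" "g \<in> monics n"
  then have "f \<noteq> 0" "g \<noteq> 0" by (auto simp: monics_def)
  then have "degree (f * g) = m + n" using fg by (simp add: degree_mult_eq monics_def)
  moreover have "lead_coeff (f * g) = 1" using fg by (auto simp: lead_coeff_mult monics_def)
  ultimately show ?thesis by (simp add: monics_def)
qed

lemma monics_power: "f \<in> monics m \<Longrightarrow> f ^ k \<in> monics (k * m)"
  for f :: "'a::idom poly"
  by (induction k) (auto simp: monics_0 intro: monics_mult)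

lemma prime_monics_degree_pos: "P \<in> prime_monics \<Longrightarrow> degree P > 0"
  unfolding prime_monics_def
  by (metis (mono_tags, lifting) gr0I is_unit_iff_degree mem_Collect_eq prime_elem_not_unit prime_elem_not_zeroI)

lemma finite_prime_monics_degree:
  "finite {P \<in> prime_monics. degree P \<le> n \<and> Q P}" for Q :: "'a::{finite, field_gcd} poly \<Rightarrow> bool"
proof (rule finite_subset)
  show "{P \<in> prime_monics. degree P \<le> n \<and> Q P} \<subseteq> (\<Union>i\<le>n. monics i)"
    by (auto simp: monics_def prime_monics_def)
qed auto

text \<open>The degree plays the part of the logarithm: as with the von Mangoldt function, a prime
  factor \<open>P\<close> is counted once for every power \<open>P ^ k\<close> that divides
  \<open>g\<close>.\<close>

lemma degree_eq_sum_prime_powers: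
  fixes g :: "'a::{finite, field_gcd} poly"
  assumes g: "g \<in> monics n"
  shows "n = (\<Sum>(P, k) | P \<in> prime_monics \<and> k > 0 \<and> k * degree P \<le> n \<and> P ^ k dvd g. degree P)"
proof -
  have g0: "g \<noteq> 0" and mon: "lead_coeff g = 1" and deg: "degree g = n" using g by (auto simp: monics_def)
  have pf: "prime_factors g = {P \<in> prime_monics. P dvd g}"
  proof (intro equalityI subsetI)
    fix P assume "P \<in> prime_factors g"
    then have P: "prime P" "P dvd g" by (auto simp: prime_factors_dvd g0)
    then have "normalize P = P" "P \<noteq> 0" by auto
    then have "unit_factor P = 1" by (metis unit_factor_normalize)
    then have "unit_factor (lead_coeff P) = 1" by (simp add: unit_factor_poly_def one_pCons)
    moreover have "normalize (lead_coeff P) = 1"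
      using \<open>P \<noteq> 0\<close> by (intro is_unit_normalize) (simp add: dvd_field_iff)
    ultimately have "lead_coeff P = 1" by (metis mult_1 unit_factor_mult_normalize)
    then show "P \<in> {P \<in> prime_monics. P dvd g}" using P by (auto simp: prime_monics_def)
  next
    fix P assume "P \<in> {P \<in> prime_monics. P dvd g}"
    then show "P \<in> prime_factors g"
      by (auto simp: prime_monics_def prime_factors_dvd g0 normalization_semidom_class.prime_def normalize_monic)
  qed
  have "n = degree (\<Prod>P\<in>prime_factors g. P ^ multiplicity P g)"
    using prod_prime_factors[OF g0] mon deg by (simp add: normalize_monic)
  also have "\<dots> = (\<Sum>P\<in>prime_factors g. degree (P ^ multiplicity P g))"
    by (subst degree_prod_sum_eq) auto
  also have "\<dots> = (\<Sum>P\<in>prime_factors g. multiplicity P g * degree P)"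
  proof (intro sum.cong refl)
    fix P assume "P \<in> prime_factors g"
    then have "P \<noteq> 0" by auto
    then show "degree (P ^ multiplicity P g) = multiplicity P g * degree P" by (simp add: degree_power_eq mult.commute)
  qed
  also have "\<dots> = (\<Sum>P\<in>prime_factors g. \<Sum>k\<in>{1..multiplicity P g}. degree P)" by simp
  also have "\<dots> = (\<Sum>(P, k)\<in>Sigma (prime_factors g) (\<lambda>P. {1..multiplicity P g}). degree P)"
    by (subst sum.Sigma) auto
  also have "Sigma (prime_factors g) (\<lambda>P. {1..multiplicity P g}) =
      {(P, k). P \<in> prime_monics \<and> k > 0 \<and> k * degree P \<le> n \<and> P ^ k dvd g}"
  proof (intro equalityI subsetI)
    fix x assume "x \<in> Sigma (prime_factors g) (\<lambda>P. {1..multiplicity P g})"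
    then obtain P k where x: "x = (P, k)" "P \<in> prime_monics" "P dvd g" "k > 0" "k \<le> multiplicity P g"
      by (auto simp: pf)
    then have dv: "P ^ k dvd g" by (simp add: multiplicity_dvd')
    then have "degree (P ^ k) \<le> n" using g0 deg dvd_imp_degree_le by blast
    moreover have "P \<noteq> 0" using x by (auto simp: prime_monics_def)
    ultimately show "x \<in> {(P, k). P \<in> prime_monics \<and> k > 0 \<and> k * degree P \<le> n \<and> P ^ k dvd g}"
      using x dv by (auto simp: degree_power_eq mult.commute)
  next
    fix x assume "x \<in> {(P, k). P \<in> prime_monics \<and> k > 0 \<and> k * degree P \<le> n \<and> P ^ k dvd g}"
    then obtain P k where x: "x = (P, k)" "P \<in> prime_monics" "k > 0" "P ^ k dvd g" by auto
    then have "\<not> is_unit P" unfolding prime_monics_def using prime_elem_not_unit by blast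
    then have "k \<le> multiplicity P g" using x g0 by (intro multiplicity_geI) auto
    moreover have "P dvd g" using x by (metis dvd_power dvd_trans)
    ultimately show "x \<in> Sigma (prime_factors g) (\<lambda>P. {1..multiplicity P g})" using x by (auto simp: pf)
  qed
  finally show ?thesis .
qed

text \<open>Coefficients of the L-function of a completely multiplicative function on monic polynomials, and of its
  logarithmic derivative.\<close>

definition coeff_sum_L :: "('a::{finite, field_gcd} poly \<Rightarrow> complex) \<Rightarrow> nat \<Rightarrow> complex" where
  "coeff_sum_L \<psi> n = (\<Sum>g\<in>monics n. \<psi> g)"

definition power_sum_L :: "('a::{finite, field_gcd} poly \<Rightarrow> complex) \<Rightarrow> nat \<Rightarrow> complex" where
  "power_sum_L \<psi> n = (\<Sum>P | P \<in> prime_monics \<and> degree P dvd n. of_nat (degree P) * \<psi> P ^ (n div degree P))"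

text \<open>The coefficient form of \<open>t * L' = L * (t * L' / L)\<close>. Write \<open>n\<close>
  as the sum of \<open>degree P\<close> over the prime powers \<open>P ^ k\<close> dividing
  \<open>g\<close>, interchange the sums, and put \<open>g = P ^ k * h\<close> with \<open>h\<close>
  monic of degree \<open>n - k * degree P\<close>.\<close>

lemma newton_L:
  fixes \<psi> :: "'a::{finite, field_gcd} poly \<Rightarrow> complex"
  assumes mult: "\<And>f g. \<psi> (f * g) = \<psi> f * \<psi> g" and one: "\<psi> 1 = 1"
  shows "of_nat n * coeff_sum_L \<psi> n = (\<Sum>i=1..n. power_sum_L \<psi> i * coeff_sum_L \<psi> (n - i))"
proof -
  have psi_pow: "\<psi> (P ^ k) = \<psi> P ^ k" for P k by (induction k) (simp_all add: mult one)
  define \<Omega> where "\<Omega> = {(P :: 'a poly, k). P \<in> prime_monics \<and> k > 0 \<and> k * degree P \<le> n}"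
  have fin: "finite \<Omega>"
  proof (rule finite_subset)
    show "\<Omega> \<subseteq> {P \<in> prime_monics. degree P \<le> n \<and> True} \<times> {..n}"
    proof clarify
      fix P k assume "(P, k) \<in> \<Omega>"
      then have P: "P \<in> prime_monics" "k > 0" "k * degree P \<le> n" by (auto simp: \<Omega>_def)
      have a: "degree P \<le> k * degree P" "k \<le> k * degree P"
        using P prime_monics_degree_pos[of P] by auto
      have "degree P \<le> n" "k \<le> n" using le_trans[OF a(1) P(3)] le_trans[OF a(2) P(3)] .
      then show "P \<in> {P \<in> prime_monics. degree P \<le> n \<and> True} \<and> k \<in> {..n}" using P by auto
    qed
    show "finite ({P \<in> prime_monics. degree P \<le> n \<and> True} \<times> {..n} :: ('a poly \<times> nat) set)"
      by (intro finite_cartesian_product finite_prime_monics_degree) auto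
  qed
  have "of_nat n * coeff_sum_L \<psi> n = (\<Sum>g\<in>monics n. of_nat n * \<psi> g)"
    by (simp add: coeff_sum_L_def sum_distrib_left)
  also have "\<dots> = (\<Sum>g\<in>monics n. \<Sum>x\<in>\<Omega>. if fst x ^ snd x dvd g then of_nat (degree (fst x)) * \<psi> g else 0)"
  proof (intro sum.cong refl)
    fix g :: "'a poly" assume g: "g \<in> monics n"
    have "(\<Sum>x\<in>\<Omega>. if fst x ^ snd x dvd g then of_nat (degree (fst x)) * \<psi> g else 0) =
        (\<Sum>x\<in>{x\<in>\<Omega>. fst x ^ snd x dvd g}. of_nat (degree (fst x)) * \<psi> g)"
      using fin by (simp add: sum.inter_filter)
    also have "\<dots> = of_nat (\<Sum>x\<in>{x\<in>\<Omega>. fst x ^ snd x dvd g}. degree (fst x)) * \<psi> g"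
      by (simp add: sum_distrib_right)
    also have "{x\<in>\<Omega>. fst x ^ snd x dvd g} =
        {(P, k). P \<in> prime_monics \<and> k > 0 \<and> k * degree P \<le> n \<and> P ^ k dvd g}"
      by (auto simp: \<Omega>_def)
    also have "(\<Sum>x\<in>\<dots>. degree (fst x)) = n"
      using degree_eq_sum_prime_powers[OF g] by (simp add: split_def)
    finally show "of_nat n * \<psi> g = (\<Sum>x\<in>\<Omega>. if fst x ^ snd x dvd g then of_nat (degree (fst x)) * \<psi> g else 0)"
      by simp
  qed
  also have "\<dots> = (\<Sum>x\<in>\<Omega>. \<Sum>g\<in>monics n. if fst x ^ snd x dvd g then of_nat (degree (fst x)) * \<psi> g else 0)"
    by (rule sum.swap)
  also have "\<dots> = (\<Sum>x\<in>\<Omega>. of_nat (degree (fst x)) * \<psi> (fst x) ^ snd x * coeff_sum_L \<psi> (n - snd x * degree (fst x)))"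
  proof (intro sum.cong refl)
    fix x assume "x \<in> \<Omega>"
    then obtain P k where x: "x = (P, k)" "P \<in> prime_monics" "k > 0" "k * degree P \<le> n" by (auto simp: \<Omega>_def)
    have Pm: "P ^ k \<in> monics (k * degree P)"
      using x by (intro monics_power) (auto simp: monics_def prime_monics_def)
    have "(\<Sum>g\<in>monics n. if P ^ k dvd g then of_nat (degree P) * \<psi> g else 0) =
        (\<Sum>g\<in>{g\<in>monics n. P ^ k dvd g}. of_nat (degree P) * \<psi> g)"
      by (simp add: sum.inter_filter)
    also have "\<dots> = (\<Sum>h\<in>monics (n - k * degree P). of_nat (degree P) * \<psi> (P ^ k * h))"
    proof (rule sum.reindex_cong[symmetric, where l = "\<lambda>h. P ^ k * h", symmetric])
      have "P \<noteq> 0" using x(2) by (auto simp: prime_monics_def)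
      then have "P ^ k \<noteq> 0" by simp
      then show "inj_on (\<lambda>h. P ^ k * h) (monics (n - k * degree P))" by (auto simp: inj_on_def)
      show "{g \<in> monics n. P ^ k dvd g} = (\<lambda>h. P ^ k * h) ` monics (n - k * degree P)"
      proof (intro equalityI subsetI)
        fix g assume "g \<in> {g \<in> monics n. P ^ k dvd g}"
        then have "g \<in> monics n" "P ^ k dvd g" by auto
        then obtain h where h: "g = P ^ k * h" "g \<in> monics n" by (metis dvdE)
        then have "lead_coeff h = 1" using Pm by (auto simp: monics_def lead_coeff_mult)
        moreover have "degree h = n - k * degree P"
        proof -
          have "h \<noteq> 0" using h by (auto simp: monics_def)
          then have "degree g = degree (P ^ k) + degree h" using h \<open>P ^ k \<noteq> 0\<close> by (simp add: degree_mult_eq)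
          then show ?thesis using h Pm by (auto simp: monics_def)
        qed
        ultimately show "g \<in> (\<lambda>h. P ^ k * h) ` monics (n - k * degree P)" using h by (auto simp: monics_def)
      next
        fix g assume "g \<in> (\<lambda>h. P ^ k * h) ` monics (n - k * degree P)"
        then obtain h where h: "g = P ^ k * h" "h \<in> monics (n - k * degree P)" by auto
        then have "g \<in> monics (k * degree P + (n - k * degree P))" using monics_mult[OF Pm] by blast
        then show "g \<in> {g \<in> monics n. P ^ k dvd g}" using x h by auto
      qed
    qed auto
    finally show "(\<Sum>g\<in>monics n. if fst x ^ snd x dvd g then of_nat (degree (fst x)) * \<psi> g else 0) =
        of_nat (degree (fst x)) * \<psi> (fst x) ^ snd x * coeff_sum_L \<psi> (n - snd x * degree (fst x))"
      unfolding x(1) fst_conv snd_conv by (simp add: mult psi_pow coeff_sum_L_def sum_distrib_left mult_ac)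
  qed
  also have "\<dots> = (\<Sum>i=1..n. \<Sum>x\<in>{x\<in>\<Omega>. snd x * degree (fst x) = i}.
      of_nat (degree (fst x)) * \<psi> (fst x) ^ snd x * coeff_sum_L \<psi> (n - snd x * degree (fst x)))"
  proof (rule sum.group[symmetric])
    show "(\<lambda>x. snd x * degree (fst x)) ` \<Omega> \<subseteq> {1..n}"
    proof clarify
      fix P k assume "(P, k) \<in> \<Omega>"
      then have "P \<in> prime_monics" "k > 0" "k * degree P \<le> n" by (auto simp: \<Omega>_def)
      then show "snd (P, k) * degree (fst (P, k)) \<in> {1..n}" using prime_monics_degree_pos[of P] by auto
    qed
  qed (use fin in auto)
  also have "\<dots> = (\<Sum>i=1..n. power_sum_L \<psi> i * coeff_sum_L \<psi> (n - i))"
  proof (intro sum.cong refl)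
    fix i assume i: "i \<in> {1..n}"
    have "(\<Sum>x\<in>{x\<in>\<Omega>. snd x * degree (fst x) = i}.
        of_nat (degree (fst x)) * \<psi> (fst x) ^ snd x * coeff_sum_L \<psi> (n - snd x * degree (fst x))) =
      (\<Sum>P | P \<in> prime_monics \<and> degree P dvd i. of_nat (degree P) * \<psi> P ^ (i div degree P) * coeff_sum_L \<psi> (n - i))"
    proof (rule sum.reindex_bij_witness[of _ "\<lambda>P. (P, i div degree P)" fst])
      fix x assume "x \<in> {x\<in>\<Omega>. snd x * degree (fst x) = i}"
      then obtain P k where x: "x = (P, k)" "P \<in> prime_monics" "k > 0" "k * degree P = i" by (auto simp: \<Omega>_def)
      have "i div degree P = k" "degree P dvd i" using prime_monics_degree_pos[of P] x(2) by (auto simp flip: x(4))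
      then show "(fst x, i div degree (fst x)) = x" "fst x \<in> {P. P \<in> prime_monics \<and> degree P dvd i}"
        "of_nat (degree (fst x)) * \<psi> (fst x) ^ (i div degree (fst x)) * coeff_sum_L \<psi> (n - i) =
         of_nat (degree (fst x)) * \<psi> (fst x) ^ snd x * coeff_sum_L \<psi> (n - snd x * degree (fst x))"
        using x by auto
    next
      fix P :: "'a poly" assume P: "P \<in> {P. P \<in> prime_monics \<and> degree P dvd i}"
      then have "degree P > 0" "i div degree P * degree P = i" using prime_monics_degree_pos[of P] by auto
      moreover have "i div degree P > 0" using calculation i by (metis atLeastAtMost_iff gr0I mult_0 not_one_le_zero)
      ultimately show "(P, i div degree P) \<in> {x\<in>\<Omega>. snd x * degree (fst x) = i}" using P i by (auto simp: \<Omega>_def)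
    qed auto
    then show "(\<Sum>x\<in>{x\<in>\<Omega>. snd x * degree (fst x) = i}.
        of_nat (degree (fst x)) * \<psi> (fst x) ^ snd x * coeff_sum_L \<psi> (n - snd x * degree (fst x))) =
        power_sum_L \<psi> i * coeff_sum_L \<psi> (n - i)"
      by (simp add: power_sum_L_def sum_distrib_right)
  qed
  finally show ?thesis .
qed

text \<open>For \<open>\<psi> = 1\<close> the coefficient sums are \<open>CARD('a) ^ n\<close>, and
  Newton's identity determines the power sums recursively. In terms of fields, every element of the
  extension of degree \<open>n\<close> is a root of exactly one of these \<open>P\<close>.\<close>

lemma sum_degree_prime_monics:
  assumes "n > 0"
  shows "(\<Sum>P | (P :: 'a::{finite, field_gcd} poly) \<in> prime_monics \<and> degree P dvd n. degree P) = CARD('a) ^ n"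
proof -
  have ps: "power_sum_L (\<lambda>_ :: 'a poly. 1) n = of_nat (\<Sum>P | (P :: 'a poly) \<in> prime_monics \<and> degree P dvd n. degree P)" for n
    by (simp add: power_sum_L_def)
  have cs: "coeff_sum_L (\<lambda>_ :: 'a poly. 1) n = of_nat (CARD('a) ^ n)" for n
    by (simp add: coeff_sum_L_def card_monics)
  have "power_sum_L (\<lambda>_ :: 'a poly. 1) n = of_nat (CARD('a) ^ n)"
    using assms
  proof (induction n rule: less_induct)
    case (less n)
    have "of_nat n * (of_nat (CARD('a) ^ n) :: complex) =
        (\<Sum>i=1..n. power_sum_L (\<lambda>_ :: 'a poly. 1) i * of_nat (CARD('a) ^ (n - i)))"
      using newton_L[of "\<lambda>_ :: 'a poly. 1" n] by (simp add: cs)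
    also have "\<dots> = power_sum_L (\<lambda>_ :: 'a poly. 1) n +
        (\<Sum>i\<in>{1..n}-{n}. power_sum_L (\<lambda>_ :: 'a poly. 1) i * of_nat (CARD('a) ^ (n - i)))"
      using less.prems by (subst sum.remove[of _ n]) auto
    also have "(\<Sum>i\<in>{1..n}-{n}. power_sum_L (\<lambda>_ :: 'a poly. 1) i * of_nat (CARD('a) ^ (n - i))) =
        (\<Sum>i\<in>{1..n}-{n}. (of_nat (CARD('a) ^ n) :: complex))"
      using less.IH by (intro sum.cong refl) (auto simp flip: power_add)
    also have "\<dots> = of_nat (n - 1) * of_nat (CARD('a) ^ n)" using less.prems by simp
    finally show ?case using less.prems by (simp add: of_nat_diff algebra_simps)
  qed
  then show ?thesis unfolding ps by (simp only: of_nat_eq_iff)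
qed

section \<open>Zeros and linear coefficient of the L-function\<close>

lemma coeff_1_le_of_roots_ge:
  fixes p :: "complex poly"
  assumes "\<rho> > 0" "\<And>z. poly p z = 0 \<Longrightarrow> \<rho> \<le> cmod z"
  shows "cmod (coeff p 1) \<le> real (degree p) / \<rho> * cmod (coeff p 0)"
  using assms(2)
proof (induction "degree p" arbitrary: p)
  case 0
  then show ?case by (simp add: coeff_eq_0)
next
  case (Suc n)
  have "\<not> constant (poly p)" using Suc(2) by (simp add: constant_degree)
  then obtain z where z: "poly p z = 0" using fundamental_theorem_of_algebra by blast
  then obtain q where q: "p = [:- z, 1:] * q" by (auto simp: poly_eq_0_iff_dvd elim: dvdE)
  have q0: "q \<noteq> 0" using q Suc(2) by auto
  have dq: "degree p = Suc (degree q)" unfolding q using q0 by (subst degree_mult_eq) auto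
  have "\<rho> \<le> cmod w" if "poly q w = 0" for w using Suc.prems[of w] that q by simp
  then have IH: "cmod (coeff q 1) \<le> real (degree q) / \<rho> * cmod (coeff q 0)"
    using Suc.hyps(1)[of q] Suc(2) dq by auto
  \<comment> \<open>Removing one root at a time amounts to Vieta's formula:
    \<open>coeff p 1 / coeff p 0\<close> is minus the sum of the reciprocals of the roots.\<close>
  have c: "coeff p 0 = - z * coeff q 0" "coeff p 1 = - z * coeff q 1 + coeff q 0"
    by (simp_all add: q coeff_pCons)
  have zr: "\<rho> \<le> cmod z" using Suc.prems z by blast
  have "cmod (coeff p 1) \<le> cmod z * cmod (coeff q 1) + cmod (coeff q 0)"
    unfolding c by (metis norm_minus_cancel norm_mult norm_triangle_ineq)
  moreover have "cmod z * cmod (coeff q 1) \<le> cmod z * (real (degree q) / \<rho> * cmod (coeff q 0))"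
    using IH by (intro mult_left_mono) auto
  moreover have "cmod (coeff q 0) \<le> (cmod z / \<rho>) * cmod (coeff q 0)"
    using zr assms(1) by (intro mult_le_cancel_right1[THEN iffD2]) (auto simp: divide_simps)
  ultimately have "cmod (coeff p 1) \<le> cmod z * (real (degree q) / \<rho> * cmod (coeff q 0)) + cmod z / \<rho> * cmod (coeff q 0)"
    by linarith
  also have "\<dots> = real (degree p) / \<rho> * cmod (coeff p 0)"
    unfolding dq c using assms(1) by (simp add: norm_mult add_divide_distrib algebra_simps)
  finally show ?case .
qed

text \<open>The \<open>e n\<close> are the coefficients of a polynomial \<open>L\<close>, and the
  \<open>S n\<close> are the negatives of the power sums of its inverse zeros. The bound on
  \<open>S\<close> makes \<open>F\<close>, the series of \<open>S n / n * t ^ n\<close>, converge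
  for \<open>cmod t < 1 / r\<close>; there \<open>L = exp F\<close> has no zero. The constant
  \<open>C\<close> has disappeared, which is why losses in Stepanov's method are harmless.\<close>

lemma newton_power_sum_bound:
  fixes e S :: "nat \<Rightarrow> complex"
  assumes e0: "e 0 = 1" and em: "\<And>n. n \<ge> m \<Longrightarrow> e n = 0"
    and newton: "\<And>n. of_nat n * e n = (\<Sum>i=1..n. S i * e (n - i))"
    and S: "\<And>n. n > 0 \<Longrightarrow> cmod (S n) \<le> C * r ^ n" and r: "r > 0"
  shows "cmod (e 1) \<le> real m * r"
proof -
  define L where "L = (\<Sum>i<m. monom (e i) i)"
  have cL: "coeff L i = e i" for i
    using em[of i] by (auto simp: L_def coeff_sum if_distrib cong: if_cong)
  have dL: "degree L \<le> m" by (rule degree_le) (simp add: cL em)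
  define c where "c n = S n / of_nat n" for n
  define F where "F t = (\<Sum>n. c n * t ^ n)" for t
  define F' where "F' t = (\<Sum>n. S (Suc n) * t ^ n)" for t
  have sum_abs: "summable (\<lambda>n. norm (S (Suc n) * t ^ n))" if t: "cmod t < 1 / r" for t
  proof (rule summable_comparison_test')
    have "cmod t * r < 1" using t r by (simp add: field_simps)
    then show "summable (\<lambda>n. C * r * (cmod t * r) ^ n)"
      using r by (intro summable_mult summable_geometric) auto
    show "norm (norm (S (Suc n) * t ^ n)) \<le> C * r * (cmod t * r) ^ n" if "n \<ge> 0" for n
      using mult_right_mono[OF S[of "Suc n"], of "cmod t ^ n"]
      by (simp add: norm_mult norm_power power_mult_distrib mult_ac)
  qed
  have diffs_c: "diffs c n = S (Suc n)" for n by (simp add: diffs_def c_def del: of_nat_Suc)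
  have summ_c: "summable (\<lambda>n. c n * t ^ n)" if t: "cmod t < 1 / r" for t
  proof -
    have "summable (\<lambda>n. c (Suc n) * t ^ Suc n)"
    proof (rule summable_comparison_test')
      show "summable (\<lambda>n. cmod t * norm (S (Suc n) * t ^ n))" by (intro summable_mult sum_abs t)
      show "norm (c (Suc n) * t ^ Suc n) \<le> cmod t * norm (S (Suc n) * t ^ n)" if "n \<ge> 0" for n
      proof -
        have "cmod (c (Suc n)) \<le> cmod (S (Suc n))"
        proof -
          have "cmod (S (Suc n)) / real (Suc n) \<le> cmod (S (Suc n)) / 1" by (intro divide_left_mono) auto
          then show ?thesis by (simp add: c_def norm_divide del: of_nat_Suc)
        qed
        then show ?thesis
          by (simp add: norm_mult mult_ac mult_left_mono mult_right_mono)
      qed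
    qed
    then show ?thesis by (subst (asm) summable_Suc_iff)
  qed
  have derF: "(F has_field_derivative F' t) (at t)" if t: "cmod t < 1 / r" for t
  proof -
    obtain K where K: "cmod t < K" "K < 1 / r" using t dense by blast
    have "((\<lambda>x. \<Sum>n. c n * x ^ n) has_field_derivative (\<Sum>n. diffs c n * t ^ n)) (at t)"
    proof (rule termdiffs_strong)
      show "summable (\<lambda>n. c n * (of_real K) ^ n)"
      proof (intro summ_c)
        have "0 \<le> K" using K norm_ge_zero[of t] by linarith
        then show "cmod (complex_of_real K) < 1 / r" using K by simp
      qed
      show "norm t < norm (complex_of_real K)" using K norm_ge_zero[of t] by auto
    qed
    then show ?thesis by (simp add: F_def[abs_def] F'_def diffs_c)
  qed
  \<comment> \<open>Newton's identities say \<open>L' = L * F'\<close>, by comparison of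
    coefficients in a Cauchy product.\<close>
  have ode: "poly (pderiv L) t = poly L t * F' t" if t: "cmod t < 1 / r" for t
  proof -
    have a: "summable (\<lambda>n. norm (e n * t ^ n))"
      by (rule summable_finite[of "{..<m}"]) (auto simp: em)
    have "(\<lambda>n. \<Sum>i\<le>n. (e i * t ^ i) * (S (Suc (n - i)) * t ^ (n - i))) sums ((\<Sum>n. e n * t ^ n) * F' t)"
      unfolding F'_def by (rule Cauchy_product_sums[OF a sum_abs[OF t]])
    moreover have "(\<Sum>i\<le>n. (e i * t ^ i) * (S (Suc (n - i)) * t ^ (n - i))) = of_nat (Suc n) * e (Suc n) * t ^ n" for n
    proof -
      have "(\<Sum>i\<le>n. (e i * t ^ i) * (S (Suc (n - i)) * t ^ (n - i))) = (\<Sum>i\<le>n. e i * S (Suc n - i)) * t ^ n"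
        unfolding sum_distrib_right
        by (intro sum.cong refl) (simp add: Suc_diff_le mult_ac flip: power_add)
      also have "(\<Sum>i\<le>n. e i * S (Suc n - i)) = (\<Sum>i=1..Suc n. S i * e (Suc n - i))"
        by (rule sum.reindex_bij_witness[of _ "\<lambda>i. Suc n - i" "\<lambda>i. Suc n - i"]) auto
      also have "\<dots> = of_nat (Suc n) * e (Suc n)" using newton[of "Suc n"] by simp
      finally show ?thesis .
    qed
    moreover have "(\<Sum>n. e n * t ^ n) = poly L t"
    proof -
      have "(\<Sum>n. e n * t ^ n) = (\<Sum>n<m. e n * t ^ n)"
        by (rule suminf_finite) (auto simp: em)
      also have "\<dots> = poly L t" by (simp add: L_def poly_sum poly_monom)
      finally show ?thesis .
    qed
    ultimately have "(\<lambda>n. of_nat (Suc n) * e (Suc n) * t ^ n) sums (poly L t * F' t)" by simp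
    moreover have "(\<lambda>n. of_nat (Suc n) * e (Suc n) * t ^ n) sums (\<Sum>n<m. of_nat (Suc n) * e (Suc n) * t ^ n)"
      by (rule sums_finite) (auto simp: em)
    moreover have "(\<Sum>n<m. of_nat (Suc n) * e (Suc n) * t ^ n) = poly (pderiv L) t"
    proof -
      have "pderiv L = (\<Sum>n<m. monom (of_nat (Suc n) * e (Suc n)) n)"
        by (rule poly_eqI) (auto simp: coeff_sum coeff_pderiv cL em if_distrib cong: if_cong)
      then show ?thesis by (simp add: poly_sum poly_monom)
    qed
    ultimately show ?thesis using sums_unique2 by metis
  qed
  have nz: "poly L t \<noteq> 0" if t: "cmod t < 1 / r" for t
  proof -
    \<comment> \<open>By the differential equation \<open>L * exp (- F)\<close> has derivative 0,
      and its value at 0 is 1.\<close>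
    have "\<exists>k. \<forall>z\<in>ball 0 (1 / r). poly L z * exp (- F z) = k"
    proof (rule has_field_derivative_zero_constant)
      fix z assume "z \<in> ball (0::complex) (1 / r)"
      then have z: "cmod z < 1 / r" by simp
      have "((\<lambda>z. poly L z * exp (- F z)) has_field_derivative
          (poly (pderiv L) z * exp (- F z) + (exp (- F z) * - F' z) * poly L z)) (at z)"
        by (intro DERIV_mult poly_DERIV DERIV_chain2[OF DERIV_exp] DERIV_minus derF z)
      then have "((\<lambda>z. poly L z * exp (- F z)) has_field_derivative 0) (at z)"
        by (simp add: ode[OF z])
      then show "((\<lambda>z. poly L z * exp (- F z)) has_field_derivative 0) (at z within ball 0 (1 / r))"
        by (rule DERIV_subset) simp
    qed auto
    then obtain k where k: "\<And>z. cmod z < 1 / r \<Longrightarrow> poly L z * exp (- F z) = k" by auto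
    have "F 0 = c 0" unfolding F_def by (rule powser_zero)
    then have "F 0 = 0" by (simp add: c_def)
    moreover have "poly L 0 = 1" by (simp add: poly_0_coeff_0 cL e0)
    ultimately have "k = 1" using k[of 0] r by simp
    then show ?thesis using k[OF t] by auto
  qed
  have "cmod (coeff L 1) \<le> real (degree L) / (1 / r) * cmod (coeff L 0)"
    using r nz by (intro coeff_1_le_of_roots_ge) (auto simp: not_less[symmetric])
  then have "cmod (e 1) \<le> real (degree L) * r" by (simp add: cL e0)
  also have "\<dots> \<le> real m * r" using dL r by simp
  finally show ?thesis .
qed

section \<open>Multiplicative characters of the prime field\<close>

locale mult_char =
  fixes chi :: "'a::prime_card mod_ring \<Rightarrow> complex" and S :: "'a mod_ring set"
    and ec :: "'a mod_ring \<Rightarrow> nat" and c1 :: "'a mod_ring"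
  assumes chi_mult: "\<And>x y. chi (x * y) = chi x * chi y" and chi_1: "chi 1 = 1" and chi_0: "chi 0 = 0"
    and nontriv: "\<exists>x. x \<noteq> 0 \<and> chi x \<noteq> 1"
    and c1: "c1 \<in> S" "ec c1 = 1"
begin

text \<open>The kernel of the character; \<open>V\<close> below is its group of values, and
  \<open>card V\<close> becomes the \<open>d\<close> of Stepanov's method.\<close>

definition "H = {x. chi x = 1}"
definition "V = chi ` (UNIV - {0})"

lemma fin [simp]: "finite (A :: 'a mod_ring set)" by simp

lemma chi_inverse: "x \<noteq> 0 \<Longrightarrow> chi (inverse x) * chi x = 1"
  by (simp add: chi_1 flip: chi_mult)

lemma chi_nz: "x \<noteq> 0 \<Longrightarrow> chi x \<noteq> 0"
  using chi_inverse[of x] by auto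

lemma chi_power: "chi (x ^ k) = chi x ^ k" by (induction k) (simp_all add: chi_mult chi_1)

lemma chi_prod: "chi (\<Prod>i\<in>A. f i) = (\<Prod>i\<in>A. chi (f i))"
  by (induction A rule: infinite_finite_induct) (simp_all add: chi_mult chi_1)

lemma card_fibre: assumes "a \<in> V" shows "card {x. chi x = a} = card H"
proof -
  obtain y where y: "y \<noteq> 0" "a = chi y" using assms by (auto simp: V_def)
  have "bij_betw (\<lambda>x. y * x) H {x. chi x = a}"
  proof (rule bij_betw_byWitness[where f' = "\<lambda>x. inverse y * x"])
    show "(\<lambda>x. inverse y * x) ` {x. chi x = a} \<subseteq> H" using y chi_inverse by (auto simp: H_def chi_mult)
  qed (use y in \<open>auto simp: H_def chi_mult\<close>)
  then show ?thesis by (simp add: bij_betw_same_card)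
qed

lemma V_H: "card V * card H = CARD('a) - 1"
proof -
  have "card (UNIV - {0 :: 'a mod_ring}) = (\<Sum>a\<in>V. card {x \<in> UNIV - {0}. chi x = a})"
    using sum.group[of "UNIV - {0 :: 'a mod_ring}" V chi "\<lambda>_. 1 :: nat"] by (simp add: V_def)
  also have "\<dots> = (\<Sum>a\<in>V. card H)"
  proof (intro sum.cong refl)
    fix a assume a: "a \<in> V"
    then have "a \<noteq> 0" using chi_nz by (auto simp: V_def)
    then have "{x \<in> UNIV - {0}. chi x = a} = {x. chi x = a}" using chi_0 by auto
    then show "card {x \<in> UNIV - {0}. chi x = a} = card H" using card_fibre[OF a] by simp
  qed
  finally show ?thesis by (simp add: card_Diff_singleton)
qed

lemma V_norm: assumes "a \<in> V" shows "cmod a = 1"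
proof -
  obtain y where y: "y \<noteq> 0" "a = chi y" using assms by (auto simp: V_def)
  have "y ^ (CARD('a) - 1) * y = y"
    using finite_field_power_card_eq_same[of y] by (simp flip: power_Suc2)
  then have "y ^ (CARD('a) - 1) = 1" using y by simp
  then have "a ^ (CARD('a) - 1) = 1" using y chi_power[of y] chi_1 by metis
  moreover have "CARD('a) - 1 > 0" using prime_card[where ?'a = 'a] prime_gt_1_nat by auto
  moreover have "cmod a ^ (CARD('a) - 1) = cmod (a ^ (CARD('a) - 1))" by (simp only: norm_power)
  ultimately have "cmod a ^ (CARD('a) - 1) = 1 ^ (CARD('a) - 1)" by simp
  then show ?thesis using \<open>CARD('a) - 1 > 0\<close> by (intro power_eq_imp_eq_base[of "cmod a" _ 1]) auto
qed

lemma sum_V: "(\<Sum>a\<in>V. a) = 0"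
proof -
  obtain y where y: "y \<noteq> 0" "chi y \<noteq> 1" using nontriv by auto
  have iy: "chi y * chi (inverse y) = 1" using chi_inverse[OF y(1)] by (simp add: mult.commute)
  have im: "(\<lambda>a. chi y * a) ` V = V"
  proof (intro equalityI subsetI)
    fix a assume "a \<in> (\<lambda>a. chi y * a) ` V"
    then obtain x where x: "x \<noteq> 0" "a = chi (y * x)" by (auto simp: V_def chi_mult)
    then show "a \<in> V" unfolding V_def using y by (intro image_eqI[of _ _ "y * x"]) auto
  next
    fix a assume "a \<in> V"
    then obtain x where x: "x \<noteq> 0" "a = chi x" by (auto simp: V_def)
    have "a = chi y * chi (inverse y * x)" using iy x by (simp add: chi_mult flip: mult.assoc)
    moreover have "chi (inverse y * x) \<in> V" unfolding V_def using x y by (intro imageI) auto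
    ultimately show "a \<in> (\<lambda>a. chi y * a) ` V" by blast
  qed
  have "inj_on (\<lambda>a. chi y * a) V" using chi_nz[OF y(1)] by (auto simp: inj_on_def)
  then have "(\<Sum>a\<in>V. a) = (\<Sum>a\<in>V. chi y * a)"
    using sum.reindex[of "\<lambda>a. chi y * a" V "\<lambda>a. a"] im by (simp add: o_def)
  also have "\<dots> = chi y * (\<Sum>a\<in>V. a)" by (simp add: sum_distrib_left)
  finally have "(1 - chi y) * (\<Sum>a\<in>V. a) = 0" by (simp add: algebra_simps)
  then show ?thesis using y by simp
qed

lemma H_power: assumes "x \<in> H" shows "x ^ card H = 1"
proof -
  have x0: "x \<noteq> 0" using assms chi_0 by (auto simp: H_def)
  have "(\<Prod>y\<in>H. y) = (\<Prod>y\<in>H. x * y)"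
  proof (rule prod.reindex_bij_witness[of _ "\<lambda>y. x * y" "\<lambda>y. inverse x * y"])
    fix y assume "y \<in> H"
    then show "inverse x * y \<in> H" "x * y \<in> H"
      using assms chi_inverse[OF x0] by (auto simp: H_def chi_mult)
  qed (use x0 in auto)
  also have "\<dots> = x ^ card H * (\<Prod>y\<in>H. y)" by (simp add: prod.distrib)
  finally have "(\<Prod>y\<in>H. y) = x ^ card H * (\<Prod>y\<in>H. y)" .
  moreover have "(\<Prod>y\<in>H. y) \<noteq> 0" using chi_0 by (auto simp: H_def)
  ultimately show ?thesis by simp
qed

lemma chi_eq_imp_power_eq:
  assumes "chi x = chi y" "x \<noteq> 0" "y \<noteq> 0"
  shows "x ^ card H = y ^ card H"
proof -
  have "x / y \<in> H" using assms chi_inverse[of y] by (simp add: H_def divide_inverse chi_mult mult.commute)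
  then have "(x / y) ^ card H = 1" by (rule H_power)
  then show ?thesis using assms by (simp add: power_divide)
qed

text \<open>At the linear polynomial \<open>X + x\<close> this is the summand of Weil's sum, which
  therefore is the linear coefficient of the L-function of \<open>\<psi>\<close>.\<close>

definition \<psi> :: "'a mod_ring poly \<Rightarrow> complex" where
  "\<psi> g = (\<Prod>c\<in>S. chi (poly g c) ^ ec c)"

lemma psi_mult: "\<psi> (f * g) = \<psi> f * \<psi> g"
  by (simp add: \<psi>_def chi_mult power_mult_distrib prod.distrib)

lemma psi_1: "\<psi> 1 = 1" by (simp add: \<psi>_def chi_1)

text \<open>So the L-function is a polynomial. The polynomial \<open>l0\<close> vanishes on
  \<open>S\<close> except at \<open>c1\<close> and has degree below \<open>n\<close>. Adding
  multiples of it permutes the monic polynomials of degree \<open>n\<close>, affects only the factor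
  at \<open>c1\<close>, and lets the value there run through the field; as \<open>ec c1 = 1\<close>,
  a nontrivial character is averaged.\<close>

lemma coeff_sum_psi_eq_0: assumes n: "n \<ge> card S" shows "coeff_sum_L \<psi> n = 0"
proof -
  define l0 where "l0 = (\<Prod>c\<in>S-{c1}. [:- c, 1:])"
  have l0c1: "poly l0 c1 \<noteq> 0" by (auto simp: l0_def poly_prod)
  have l0c: "poly l0 c = 0" if "c \<in> S" "c \<noteq> c1" for c using that by (auto simp: l0_def poly_prod)
  have "degree l0 \<le> card (S - {c1})"
    unfolding l0_def using degree_prod_sum_le[of "S-{c1}" "\<lambda>c. [:- c, 1:]"] by simp
  also have "\<dots> < n" using c1 n by (metis card_Diff1_less fin less_le_trans)
  finally have dl: "degree l0 < n" .
  have "n > 0" using dl by simp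
  have shift: "(\<Sum>g\<in>monics n. \<psi> g) = (\<Sum>g\<in>monics n. \<psi> (g + smult y l0))" for y
  proof -
    have deg: "degree (smult y l0) < n" for y using dl degree_smult_le[of y l0] by simp
    have in_m: "g + smult y l0 \<in> monics n" if "g \<in> monics n" for g y
    proof -
      have d: "degree (g + smult y l0) = n"
        using that deg[of y] by (simp add: monics_def degree_add_eq_left)
      have "coeff g n = 1" using that by (auto simp: monics_def)
      then have "coeff (g + smult y l0) n = 1" using coeff_eq_0[OF dl] by simp
      then show ?thesis unfolding monics_def mem_Collect_eq d by simp
    qed
    show ?thesis
      by (rule sum.reindex_bij_witness[of _ "\<lambda>g. g + smult y l0" "\<lambda>g. g + smult (- y) l0"])
         (auto intro: in_m in_m[where y = "- y", simplified])
  qed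
  have "of_nat CARD('a) * (\<Sum>g\<in>monics n. \<psi> g) = (\<Sum>y\<in>UNIV. \<Sum>g\<in>monics n. \<psi> (g + smult y l0))"
    by (subst shift[symmetric]) simp
  also have "\<dots> = (\<Sum>g\<in>monics n. \<Sum>y\<in>UNIV. \<psi> (g + smult y l0))" by (rule sum.swap)
  also have "\<dots> = 0"
  proof (rule sum.neutral, rule ballI)
    fix g :: "'a mod_ring poly"
    have "\<psi> (g + smult y l0) = (\<Prod>c\<in>S-{c1}. chi (poly g c) ^ ec c) * chi (poly g c1 + y * poly l0 c1)" for y
    proof -
      have "\<psi> (g + smult y l0) = chi (poly (g + smult y l0) c1) ^ ec c1 * (\<Prod>c\<in>S-{c1}. chi (poly (g + smult y l0) c) ^ ec c)"
        unfolding \<psi>_def using c1 by (subst prod.remove[of _ c1]) auto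
      also have "(\<Prod>c\<in>S-{c1}. chi (poly (g + smult y l0) c) ^ ec c) = (\<Prod>c\<in>S-{c1}. chi (poly g c) ^ ec c)"
        by (intro prod.cong refl) (auto simp: l0c)
      finally show ?thesis using c1 by (simp add: mult.commute)
    qed
    then have "(\<Sum>y\<in>UNIV. \<psi> (g + smult y l0)) =
        (\<Prod>c\<in>S-{c1}. chi (poly g c) ^ ec c) * (\<Sum>y\<in>UNIV. chi (poly g c1 + y * poly l0 c1))"
      by (simp add: sum_distrib_left)
    also have "(\<Sum>y\<in>UNIV. chi (poly g c1 + y * poly l0 c1)) = (\<Sum>y\<in>UNIV. chi y)"
      by (rule sum.reindex_bij_witness[of _ "\<lambda>z. (z - poly g c1) / poly l0 c1" "\<lambda>y. poly g c1 + y * poly l0 c1"])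
         (use l0c1 in auto)
    also have "\<dots> = 0"
    proof -
      obtain y where y: "y \<noteq> 0" "chi y \<noteq> 1" using nontriv by auto
      have "(\<Sum>x\<in>UNIV. chi x) = (\<Sum>x\<in>UNIV. chi (y * x))"
        by (rule sum.reindex_bij_witness[of _ "\<lambda>x. y * x" "\<lambda>x. x / y"]) (use y in auto)
      also have "\<dots> = chi y * (\<Sum>x\<in>UNIV. chi x)" by (simp add: chi_mult sum_distrib_left)
      finally have "(1 - chi y) * (\<Sum>x\<in>UNIV. chi x) = 0" by (simp add: algebra_simps)
      then show ?thesis using y by simp
    qed
    finally show "(\<Sum>y\<in>UNIV. \<psi> (g + smult y l0)) = 0" by simp
  qed
  finally show ?thesis by (simp add: coeff_sum_L_def)
qed

end

section \<open>Stepanov's bound for the fibres of a character\<close>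

lemma dvd_diff_prod:
  fixes P :: "'a::comm_ring_1"
  assumes "\<And>c. c \<in> A \<Longrightarrow> P dvd a c - b c"
  shows "P dvd (\<Prod>c\<in>A. a c) - (\<Prod>c\<in>A. b c)"
  using assms
proof (induction A rule: infinite_finite_induct)
  case (insert x A)
  have "(\<Prod>c\<in>insert x A. a c) - (\<Prod>c\<in>insert x A. b c) =
      (a x - b x) * (\<Prod>c\<in>A. a c) + b x * ((\<Prod>c\<in>A. a c) - (\<Prod>c\<in>A. b c))"
    using insert by (simp add: algebra_simps)
  then show ?case using insert by simp
qed auto

lemma dvd_diff_power:
  fixes P :: "'a::comm_ring_1"
  assumes "P dvd a - b"
  shows "P dvd a ^ k - b ^ k"
  using dvd_diff_prod[of "{..<k}" P "\<lambda>_. a" "\<lambda>_. b"] assms by simp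

context mult_char
begin

text \<open>Each \<open>P\<close> accounts for its \<open>degree P\<close> roots. So
  \<open>mass a n\<close> below counts the points of the field with \<open>CARD('a) ^ n\<close>
  elements where the summand, lifted by the norm, takes one fixed value: \<open>a\<close> up to a
  factor depending only on \<open>n\<close>.\<close>

definition "primes_over a n = {P :: 'a mod_ring poly. P \<in> prime_monics \<and> degree P dvd n \<and> \<psi> P ^ (n div degree P) = a}"
definition "mass a n = (\<Sum>P\<in>primes_over a n. degree P)"

lemma finite_prime_monics_dvd: "n > 0 \<Longrightarrow> finite {P :: 'a mod_ring poly. P \<in> prime_monics \<and> degree P dvd n}"
  by (rule finite_subset[OF _ finite_prime_monics_degree[of n "\<lambda>_. True"]]) (auto dest: dvd_imp_le)

lemma primes_over_subset: "primes_over a n \<subseteq> {P. P \<in> prime_monics \<and> degree P dvd n}"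
  by (auto simp: primes_over_def)

lemma mass_le_total: assumes "n > 0" shows "mass a n \<le> CARD('a) ^ n"
proof -
  have "mass a n \<le> (\<Sum>P | P \<in> (prime_monics :: 'a mod_ring poly set) \<and> degree P dvd n. degree P)"
    unfolding mass_def by (intro sum_mono2 finite_prime_monics_dvd primes_over_subset assms) auto
  then show ?thesis using sum_degree_prime_monics[of n, where ?'a = "'a mod_ring"] assms by simp
qed

text \<open>By \<open>norm_linear\<close>, the norm of the product of the
  \<open>(\<xi> - c) ^ ec c\<close> for a root \<open>\<xi>\<close> of \<open>P\<close>.\<close>

definition "shift_val P n = (\<Prod>c\<in>S. ((- 1) ^ n * poly P c ^ (n div degree P)) ^ ec c)"

lemma chi_shift_val: "chi (shift_val P n) = (\<Prod>c\<in>S. chi ((- 1) ^ n) ^ ec c) * \<psi> P ^ (n div degree P)"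
  by (simp add: shift_val_def chi_prod chi_power chi_mult \<psi>_def power_mult_distrib prod.distrib prod_power_distrib
      flip: power_mult) (simp add: mult.commute)

text \<open>All \<open>P\<close> over the same \<open>a\<close> have their norms
  \<open>shift_val P n\<close> in one coset of the kernel \<open>H\<close>. The power
  \<open>card H\<close> makes them equal, so one constant serves all these \<open>P\<close> as the
  \<open>\<alpha>\<close> of Stepanov's method. The total exponent is
  \<open>(CARD('a) ^ n - 1) / card V\<close>.\<close>

lemma primes_over_dvd:
  assumes P: "P \<in> primes_over a n" and P0: "P0 \<in> primes_over a n" and a: "a \<in> V"
  shows "P dvd (\<Prod>c\<in>S. [:- c, 1:] ^ ec c) ^ ((\<Sum>i<n. CARD('a) ^ i) * card H) - [:shift_val P0 n ^ card H:]"
proof -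
  define k where "k = n div degree P"
  have n: "n = degree P * k" using P by (auto simp: primes_over_def k_def)
  have prime: "prime_elem P" "lead_coeff P = 1" using P by (auto simp: primes_over_def prime_monics_def)
  have "P dvd [:- c, 1:] ^ (\<Sum>i<n. CARD('a) ^ i) - [:(- 1) ^ n * poly P c ^ k:]" for c
    using prime_poly_norm(2)[OF prime, of c k] n by simp
  then have "P dvd (\<Prod>c\<in>S. ([:- c, 1:] ^ (\<Sum>i<n. CARD('a) ^ i)) ^ ec c) - (\<Prod>c\<in>S. [:(- 1) ^ n * poly P c ^ k:] ^ ec c)"
    by (intro dvd_diff_prod dvd_diff_power)
  also have "(\<Prod>c\<in>S. [:(- 1) ^ n * poly P c ^ k:] ^ ec c) = [:shift_val P n:]"
  proof -
    have "(\<Prod>c\<in>A. [:u c:]) = [:\<Prod>c\<in>A. u c:]" for A and u :: "'a mod_ring \<Rightarrow> 'a mod_ring"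
      by (induction A rule: infinite_finite_induct) (auto simp: one_pCons)
    then show ?thesis by (simp add: shift_val_def k_def poly_const_pow)
  qed
  also have "(\<Prod>c\<in>S. ([:- c, 1:] ^ (\<Sum>i<n. CARD('a) ^ i)) ^ ec c) = (\<Prod>c\<in>S. [:- c, 1:] ^ ec c) ^ (\<Sum>i<n. CARD('a) ^ i)"
    by (simp add: prod_power_distrib mult.commute flip: power_mult)
  finally have "P dvd ((\<Prod>c\<in>S. [:- c, 1:] ^ ec c) ^ (\<Sum>i<n. CARD('a) ^ i)) ^ card H - [:shift_val P n:] ^ card H"
    by (rule dvd_diff_power)
  moreover have "shift_val P n ^ card H = shift_val P0 n ^ card H"
  proof (rule chi_eq_imp_power_eq)
    have eq: "chi (shift_val Q n) = (\<Prod>c\<in>S. chi ((- 1) ^ n) ^ ec c) * a" if "Q \<in> primes_over a n" for Q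
      unfolding chi_shift_val using that by (auto simp: primes_over_def)
    show "chi (shift_val P n) = chi (shift_val P0 n)" using eq[OF P] eq[OF P0] by simp
    have "a \<noteq> 0" using a chi_nz by (auto simp: V_def)
    moreover have "(\<Prod>c\<in>S. chi ((- 1) ^ n) ^ ec c) \<noteq> 0" by (simp add: chi_nz)
    ultimately have "chi (shift_val Q n) \<noteq> 0" if "Q \<in> primes_over a n" for Q using eq[OF that] by simp
    then show "shift_val P n \<noteq> 0" "shift_val P0 n \<noteq> 0" using P P0 chi_0 by metis+
  qed
  ultimately show ?thesis by (simp add: power_mult poly_const_pow)
qed

text \<open>Stepanov's method is run with \<open>M = d * s\<close> and \<open>K = s + k0\<close>,
  where \<open>s\<close> is about the square root of \<open>q\<close>. The leading terms
  \<open>d * s * e\<close> on both sides cancel, and \<open>k0\<close> is such that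
  \<open>k0 * d * e\<close>, about \<open>k0 * q\<close>, exceeds the remaining
  \<open>d * s * (s + k0 + m * d * s)\<close>.\<close>

lemma stepanov_big_arith:
  fixes d m s q e k0 :: nat
  assumes d: "d \<ge> 1" and s: "s \<ge> 4 * d" and q: "s\<^sup>2 \<le> q" and de: "d * e = q - 1" and k0: "k0 = 2 * d * (m * d + 2)"
  shows "d * s * ((s + k0) + m * (d * s) + e) < (s + k0) * d * e"
proof -
  have q1: "q \<ge> 1" using q s d by (metis One_nat_def Suc_leI le_trans less_le_trans mult_pos_pos not_gr_zero not_less0 power2_eq_square zero_less_numeral zero_less_one)
  define D M Sr Q E K where "D = real d" and "M = real m" and "Sr = real s" and "Q = real q" and "E = real e" and "K = real k0"
  have D1: "D \<ge> 1" using d by (simp add: D_def)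
  have S4: "Sr \<ge> 4 * D" using s unfolding Sr_def D_def by linarith
  have Kd: "K = 2 * D * (M * D + 2)" unfolding K_def k0 by (simp add: D_def M_def algebra_simps)
  have M0: "M \<ge> 0" by (simp add: M_def)
  have K0: "K > 0" using D1 M0 unfolding Kd by (intro mult_pos_pos add_nonneg_pos mult_nonneg_nonneg) auto
  have QS: "Sr\<^sup>2 \<le> Q" using q unfolding Sr_def Q_def by (metis of_nat_le_iff of_nat_power)
  have DE: "D * E = Q - 1" using de q1 unfolding D_def E_def Q_def by (metis of_nat_1 of_nat_diff of_nat_mult)
  have 1: "4 * (D * Sr * K) \<le> K * Sr\<^sup>2"
  proof -
    have "(4 * D) * (Sr * K) \<le> Sr * (Sr * K)" using S4 K0 D1 by (intro mult_right_mono) auto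
    then show ?thesis by (simp add: power2_eq_square mult_ac)
  qed
  have 2: "2 * (D * Sr\<^sup>2 * (1 + M * D)) = K * Sr\<^sup>2 - 2 * (D * Sr\<^sup>2)" unfolding Kd by (simp add: algebra_simps)
  have 3: "4 * K \<le> K * Sr\<^sup>2"
  proof -
    have "4 \<le> Sr" using S4 D1 by linarith
    then have "2\<^sup>2 \<le> Sr\<^sup>2" by (intro power_mono) auto
    then show ?thesis using K0 by (simp add: mult.commute)
  qed
  have 4: "D * Sr\<^sup>2 > 0" using D1 S4 by (intro mult_pos_pos) auto
  have "D * Sr\<^sup>2 * (1 + M * D) + D * Sr * K < K * (Sr\<^sup>2 - 1)"
    using 1 2 3 4 by (simp add: algebra_simps)
  also have "\<dots> \<le> K * (Q - 1)" using QS K0 by (intro mult_left_mono) auto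
  finally have "D * Sr\<^sup>2 * (1 + M * D) + D * Sr * K < K * (D * E)" unfolding DE .
  then have "D * Sr * ((Sr + K) + M * (D * Sr) + E) < (Sr + K) * D * E"
    by (simp add: algebra_simps power2_eq_square)
  then have "real (d * s * ((s + k0) + m * (d * s) + e)) < real ((s + k0) * d * e)"
    by (simp add: D_def M_def Sr_def E_def K_def)
  then show ?thesis by (simp only: of_nat_less_iff)
qed

text \<open>The main term \<open>q * K / M\<close> of Stepanov's bound is
  \<open>q / d + q * k0 / (d * s)\<close>: the expected share and an error of the order of the
  square root of \<open>q\<close>. The constant may depend on everything except \<open>n\<close> and
  \<open>a\<close>.\<close>

lemma mass_bound: "\<exists>C\<ge>0. \<forall>n>0. \<forall>a\<in>V. real (mass a n) \<le> real (CARD('a) ^ n) / real (card V) + C * sqrt (real CARD('a)) ^ n"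
proof -
  define p d m B where "p = CARD('a)" and "d = card V" and "m = card S" and "B = (\<Sum>c\<in>S. ec c)"
  define k0 where "k0 = 2 * d * (m * d + 2)"
  define C where "C = real (p * (1 + B + k0) + m + 4 * d * p)"
  have p1: "p > 1" unfolding p_def using prime_card prime_gt_1_nat by blast
  have dh: "d * card H = p - 1" using V_H by (simp add: d_def p_def)
  then have d1: "d \<ge> 1" using p1 by (cases d) auto
  show ?thesis
  proof (intro exI[of _ C] conjI allI impI ballI)
    show "0 \<le> C" by (simp add: C_def)
    fix n :: nat and a assume n: "n > 0" and a: "a \<in> V"
    define q s e where "q = p ^ n" and "s = p ^ (n div 2)" and "e = (\<Sum>i<n. p ^ i) * card H"
    have sq: "s\<^sup>2 \<le> q" unfolding s_def q_def power_mult[symmetric] using p1 by (intro power_increasing) auto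
    have qs: "q \<le> p * s\<^sup>2"
    proof -
      have "p * s\<^sup>2 = p ^ Suc (n div 2 * 2)" by (simp add: s_def power_mult)
      moreover have "n \<le> Suc (n div 2 * 2)" by presburger
      ultimately show ?thesis unfolding q_def using p1 by (metis power_increasing less_imp_le)
    qed
    have s1: "s \<ge> 1" using p1 by (simp add: s_def)
    have ss: "real s \<le> sqrt (real p) ^ n"
    proof -
      have "real s = sqrt (real (s\<^sup>2))" by simp
      also have "\<dots> \<le> sqrt (real q)" using sq by (simp only: real_sqrt_le_iff of_nat_le_iff)
      also have "\<dots> = sqrt (real p) ^ n" by (simp add: q_def real_sqrt_power)
      finally show ?thesis .
    qed
    have de: "d * e = q - 1"
    proof -
      have "d * e = (p - 1) * (\<Sum>i<n. p ^ i)" unfolding e_def using dh by (metis mult.assoc mult.commute)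
      moreover have "int ((p - 1) * (\<Sum>i<n. p ^ i)) = int (q - 1)"
      proof -
        have "int ((p - 1) * (\<Sum>i<n. p ^ i)) = (int p - 1) * (\<Sum>i<n. int p ^ i)" using p1 by (simp add: of_nat_diff)
        also have "\<dots> = int p ^ n - 1" using power_diff_1_eq[of "int p" n] by simp
        also have "\<dots> = int (q - 1)" using p1 by (simp add: q_def of_nat_diff)
        finally show ?thesis .
      qed
      ultimately show ?thesis by (metis of_nat_eq_iff)
    qed
    have main: "real (mass a n) \<le> real q / real d + C * real s"
    proof (cases "s \<ge> 4 * d \<and> primes_over a n \<noteq> {}")
      case False
      show ?thesis
      proof (cases "primes_over a n = {}")
        case True
        then show ?thesis by (simp add: mass_def C_def)
      next
        case nonempty: False
        \<comment> \<open>For such small \<open>s\<close> the trivial bound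
          \<open>q \<le> p * s\<^sup>2\<close> is already at most a constant times
          \<open>s\<close>.\<close>
        then have "s \<le> 4 * d" using False by auto
        have "real (mass a n) \<le> real q" using mass_le_total[OF n, of a] by (simp add: q_def p_def)
        also have "\<dots> \<le> real (p * s\<^sup>2)" using qs by (simp only: of_nat_le_iff)
        also have "\<dots> \<le> real (4 * d * p) * real s"
        proof -
          have "p * s\<^sup>2 \<le> 4 * d * p * s" using \<open>s \<le> 4 * d\<close> by (simp add: power2_eq_square)
          then show ?thesis by (metis of_nat_le_iff of_nat_mult)
        qed
        also have "\<dots> \<le> C * real s" by (intro mult_right_mono) (auto simp: C_def)
        finally have "real (mass a n) \<le> C * real s" .
        moreover have "0 \<le> real q / real d" by simp
        ultimately show ?thesis by linarith
      qed
    next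
      case True
      then obtain P0 where P0: "P0 \<in> primes_over a n" and s4: "s \<ge> 4 * d" by auto
      have big: "d * s * ((s + k0) + m * (d * s) + e) < (s + k0) * d * e"
        using stepanov_big_arith[OF d1 s4 sq de k0_def] .
      interpret st: stepanov S ec c1 n d e q "d * s" "s + k0" "shift_val P0 n ^ card H"
      proof
        show "d * s \<le> q"
        proof -
          have "d * s \<le> s * s" using s4 by (intro mult_le_mono1) auto
          then show ?thesis using sq unfolding power2_eq_square by (rule le_trans)
        qed
      qed (use c1 de big in \<open>auto simp: q_def p_def m_def\<close>)
      have fe: "st.f ^ e = (\<Prod>c\<in>S. [:- c, 1:] ^ ec c) ^ ((\<Sum>i<n. CARD('a) ^ i) * card H)"
        by (simp add: st.f_def st.lin_def e_def p_def)
      have "d * s * (\<Sum>P\<in>primes_over a n. degree P) \<le> card S * (d * s) + (e + q * (\<Sum>c\<in>S. ec c) + q * (s + k0))"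
      proof (rule st.stepanov_degree_bound)
        show "finite (primes_over a n)" using finite_subset[OF primes_over_subset finite_prime_monics_dvd[OF n]] .
        fix P assume P: "P \<in> primes_over a n"
        then have P': "prime_elem P" "lead_coeff P = 1" "degree P * (n div degree P) = n"
          by (auto simp: primes_over_def prime_monics_def)
        have "P dvd monom 1 q - monom 1 1"
          using prime_poly_norm(1)[OF P'(1,2), of "n div degree P"] P'(3) by (simp add: q_def p_def)
        then show "prime_elem P \<and> lead_coeff P = 1 \<and> P dvd monom 1 q - monom 1 1 \<and>
            P dvd st.f ^ e - [:shift_val P0 n ^ card H:]"
          unfolding fe using P' primes_over_dvd[OF P P0 a] by blast
      qed
      then have "real (d * s * mass a n) \<le> real (m * (d * s) + (e + q * B + q * (s + k0)))"
        unfolding of_nat_le_iff mass_def m_def B_def .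
      then have "real d * real s * real (mass a n) \<le> real m * (real d * real s) + real e + real q * real B + real q * (real s + real k0)"
        by simp
      also have "real e \<le> real q"
      proof -
        have "e \<le> d * e" using d1 by simp
        then show ?thesis using de by simp
      qed
      finally have 1: "real d * real s * real (mass a n) \<le> real m * (real d * real s) + real q * (1 + real B + real k0) + real q * real s"
        by (simp add: algebra_simps)
      have ds: "real d * real s > 0" using d1 s1 by simp
      have "real (mass a n) = (real d * real s * real (mass a n)) / (real d * real s)"
        by (subst nonzero_mult_div_cancel_left) (use d1 s1 in auto)
      also have "\<dots> \<le> (real m * (real d * real s) + real q * (1 + real B + real k0) + real q * real s) / (real d * real s)"
        using 1 ds by (intro divide_right_mono) auto
      also have "\<dots> = real m + real q * (1 + real B + real k0) / (real d * real s) + real q / real d"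
        using d1 s1 by (simp add: field_simps)
      also have "real q * (1 + real B + real k0) / (real d * real s) \<le> (real p * real s) * (1 + real B + real k0)"
      proof -
        have "real q \<le> real p * (real s)\<^sup>2" using qs by (metis of_nat_le_iff of_nat_mult of_nat_power)
        then have "real q / (real d * real s) \<le> real p * (real s)\<^sup>2 / (1 * real s)"
          using d1 s1 by (intro frac_le mult_right_mono) auto
        also have "\<dots> = real p * real s" using s1 by (simp add: power2_eq_square)
        finally have "real q / (real d * real s) * (1 + real B + real k0) \<le> real p * real s * (1 + real B + real k0)"
          by (intro mult_right_mono) auto
        then show ?thesis by simp
      qed
      also have "real m \<le> real m * real s" using s1 by (simp add: mult_le_cancel_left1)
      finally have "real (mass a n) \<le> real q / real d + (real m + real p * (1 + real B + real k0)) * real s"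
        by (simp add: algebra_simps)
      also have "(real m + real p * (1 + real B + real k0)) * real s \<le> C * real s"
      proof (intro mult_right_mono)
        have "C = real m + real p * (1 + real B + real k0) + 4 * real d * real p"
          by (simp add: C_def algebra_simps)
        then show "real m + real p * (1 + real B + real k0) \<le> C" by simp
      qed auto
      finally show ?thesis by simp
    qed
    have "C * real s \<le> C * sqrt (real p) ^ n" using ss by (intro mult_left_mono) (auto simp: C_def)
    then show "real (mass a n) \<le> real (CARD('a) ^ n) / real (card V) + C * sqrt (real CARD('a)) ^ n"
      using main by (simp add: q_def p_def d_def)
  qed
qed

lemma psi_pow_in_V: "\<psi> P = 0 \<or> \<psi> P ^ k \<in> V"
proof (cases "\<psi> P = 0")
  case False
  define z where "z = (\<Prod>c\<in>S. poly P c ^ ec c) ^ k"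
  have "chi z = \<psi> P ^ k" by (simp add: z_def chi_power chi_prod \<psi>_def)
  moreover have "z \<noteq> 0" using False calculation chi_0 by (metis power_not_zero)
  ultimately show ?thesis unfolding V_def by (metis DiffI UNIV_I empty_iff image_eqI insert_iff)
qed simp

lemma finite_V [simp]: "finite V" by (simp add: V_def)

text \<open>Only the prime polynomials \<open>X - c\<close> with \<open>c\<close> in
  \<open>S\<close> have \<open>\<psi> = 0\<close>, and each has degree 1. All others lie over some
  \<open>a\<close> in \<open>V\<close>.\<close>

lemma sum_mass_ge: assumes n: "n > 0" shows "CARD('a) ^ n \<le> (\<Sum>a\<in>V. mass a n) + card S"
proof -
  define PM where "PM = {P :: 'a mod_ring poly. P \<in> prime_monics \<and> degree P dvd n}"
  define Z where "Z = {P \<in> PM. \<psi> P = 0}"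
  have fin: "finite PM" unfolding PM_def by (rule finite_prime_monics_dvd[OF n])
  have Zs: "Z \<subseteq> (\<lambda>c. [:- c, 1:]) ` S"
  proof
    fix P assume "P \<in> Z"
    then have P: "prime_elem P" "lead_coeff P = 1" "\<psi> P = 0" by (auto simp: Z_def PM_def prime_monics_def)
    then obtain c where c: "c \<in> S" "poly P c = 0" using chi_nz by (auto simp: \<psi>_def)
    then have "[:- c, 1:] dvd P" by (simp add: poly_eq_0_iff_dvd)
    moreover have "irreducible P" using P(1) by (rule prime_elem_imp_irreducible)
    moreover have "\<not> is_unit [:- c, 1:]" by (simp add: is_unit_pCons_iff)
    ultimately have "P dvd [:- c, 1:]" using irreducibleD' by blast
    then have "P = [:- c, 1:]" using \<open>[:- c, 1:] dvd P\<close> P(2) by (intro poly_dvd_antisym) auto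
    then show "P \<in> (\<lambda>c. [:- c, 1:]) ` S" using c by auto
  qed
  have "CARD('a) ^ n = (\<Sum>P\<in>PM. degree P)"
    using sum_degree_prime_monics[OF n, where ?'a = "'a mod_ring"] by (simp add: PM_def)
  also have "\<dots> = (\<Sum>P\<in>PM - Z. degree P) + (\<Sum>P\<in>Z. degree P)"
    using fin by (intro sum.subset_diff) (auto simp: Z_def)
  also have "(\<Sum>P\<in>Z. degree P) \<le> (\<Sum>P\<in>(\<lambda>c. [:- c, 1:]) ` S. degree P)"
    using Zs by (intro sum_mono2) auto
  also have "\<dots> \<le> card S"
  proof -
    have "(\<Sum>P\<in>(\<lambda>c. [:- c, 1:]) ` S. degree P) = (\<Sum>P\<in>(\<lambda>c. [:- c, 1:]) ` S. 1)"
      by (intro sum.cong) auto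
    then show ?thesis by (simp add: card_image_le)
  qed
  also have "(\<Sum>P\<in>PM - Z. degree P) = (\<Sum>a\<in>V. \<Sum>P\<in>{P \<in> PM - Z. \<psi> P ^ (n div degree P) = a}. degree P)"
    using fin psi_pow_in_V by (intro sum.group[symmetric]) (auto simp: Z_def)
  also have "\<dots> \<le> (\<Sum>a\<in>V. mass a n)"
    unfolding mass_def
    by (intro sum_mono sum_mono2 finite_subset[OF primes_over_subset finite_prime_monics_dvd[OF n]])
       (auto simp: primes_over_def PM_def)
  finally show ?thesis by simp
qed

lemma power_sum_eq_mass: assumes n: "n > 0" shows "power_sum_L \<psi> n = (\<Sum>a\<in>V. a * of_nat (mass a n))"
proof -
  define PM where "PM = {P :: 'a mod_ring poly. P \<in> prime_monics \<and> degree P dvd n}"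
  have fin: "finite PM" unfolding PM_def by (rule finite_prime_monics_dvd[OF n])
  have k0: "n div degree P > 0" if "P \<in> PM" for P
    using that n prime_monics_degree_pos[of P] by (auto simp: PM_def dvd_imp_le div_greater_zero_iff)
  have "power_sum_L \<psi> n = (\<Sum>P\<in>PM. of_nat (degree P) * \<psi> P ^ (n div degree P))"
    by (simp add: power_sum_L_def PM_def)
  also have "\<dots> = (\<Sum>P\<in>{P\<in>PM. \<psi> P \<noteq> 0}. of_nat (degree P) * \<psi> P ^ (n div degree P))"
  proof (intro sum.mono_neutral_right ballI)
    fix P assume P: "P \<in> PM - {P\<in>PM. \<psi> P \<noteq> 0}"
    then have "\<psi> P = 0" "n div degree P > 0" using k0[of P] by auto
    then show "of_nat (degree P) * \<psi> P ^ (n div degree P) = 0" by (simp only: zero_power mult_zero_right)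
  qed (use fin in auto)
  also have "\<dots> = (\<Sum>a\<in>V. \<Sum>P\<in>{P \<in> {P\<in>PM. \<psi> P \<noteq> 0}. \<psi> P ^ (n div degree P) = a}. of_nat (degree P) * \<psi> P ^ (n div degree P))"
    using fin psi_pow_in_V by (intro sum.group[symmetric]) auto
  also have "\<dots> = (\<Sum>a\<in>V. a * of_nat (mass a n))"
  proof (intro sum.cong refl)
    fix a assume a: "a \<in> V"
    then have "a \<noteq> 0" using chi_nz by (auto simp: V_def)
    have "{P \<in> {P\<in>PM. \<psi> P \<noteq> 0}. \<psi> P ^ (n div degree P) = a} = primes_over a n"
    proof (intro equalityI subsetI)
      fix P assume P: "P \<in> primes_over a n"
      then have PM: "P \<in> PM" by (auto simp: primes_over_def PM_def)
      have "\<psi> P \<noteq> 0"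
      proof
        assume "\<psi> P = 0"
        then have "\<psi> P ^ (n div degree P) = 0" using k0[OF PM] by (simp only: zero_power)
        then show False using P \<open>a \<noteq> 0\<close> by (auto simp: primes_over_def)
      qed
      then show "P \<in> {P \<in> {P\<in>PM. \<psi> P \<noteq> 0}. \<psi> P ^ (n div degree P) = a}"
        using P PM by (auto simp: primes_over_def)
    qed (auto simp: primes_over_def PM_def)
    then show "(\<Sum>P\<in>{P \<in> {P\<in>PM. \<psi> P \<noteq> 0}. \<psi> P ^ (n div degree P) = a}. of_nat (degree P) * \<psi> P ^ (n div degree P)) = a * of_nat (mass a n)"
      by (simp add: mass_def sum_distrib_left primes_over_def mult.commute)
  qed
  finally show ?thesis .
qed

text \<open>Stepanov's method gives upper bounds only. As the masses add up to almost
  \<open>CARD('a) ^ n\<close>, none can fall far below its share either, and the shares themselves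
  cancel by \<open>sum_V\<close>. So the \<open>n\<close>-th power sum is at most a constant times
  \<open>sqrt (real CARD('a)) ^ n\<close> for every \<open>n\<close>, and
  \<open>newton_power_sum_bound\<close> converts this into the clean factor
  \<open>card S\<close>.\<close>

theorem weil_bound: "cmod (\<Sum>x\<in>UNIV. \<Prod>c\<in>S. chi (x + c) ^ ec c) \<le> real (card S) * sqrt (real CARD('a))"
proof -
  obtain C where C: "C \<ge> 0" "\<And>n a. n > 0 \<Longrightarrow> a \<in> V \<Longrightarrow>
      real (mass a n) \<le> real (CARD('a) ^ n) / real (card V) + C * sqrt (real CARD('a)) ^ n"
    using mass_bound by blast
  have card1: "real CARD('a) \<ge> 1" using prime_card[where ?'a = 'a] by (simp add: prime_ge_1_nat)
  have d1: "card V > 0" using nontriv by (auto simp: card_gt_0_iff V_def)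
  have bound: "cmod (power_sum_L \<psi> n) \<le> (2 * real (card V) * C + real (card S)) * sqrt (real CARD('a)) ^ n"
    if n: "n > 0" for n
  proof -
    define E where "E = C * sqrt (real CARD('a)) ^ n"
    define x where "x a = real (mass a n) - real (CARD('a) ^ n) / real (card V)" for a
    have E0: "E \<ge> 0" using C by (simp add: E_def)
    have xE: "x a \<le> E" if "a \<in> V" for a using C(2)[OF n that] by (simp add: x_def E_def)
    have xs: "(\<Sum>a\<in>V. x a) \<ge> - real (card S)"
    proof -
      have "(\<Sum>a\<in>V. x a) = real (\<Sum>a\<in>V. mass a n) - real (CARD('a) ^ n)"
      proof -
        have "real (card V) * (real (CARD('a) ^ n) / real (card V)) = real (CARD('a) ^ n)"
        proof -
          have nz: "real (card V) \<noteq> 0" using d1 by (metis of_nat_eq_0_iff less_irrefl)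
          show ?thesis by (simp only: times_divide_eq_right nonzero_mult_div_cancel_left[OF nz])
        qed
        then show ?thesis by (simp only: x_def sum_subtractf sum_constant of_nat_sum)
      qed
      moreover have "real (CARD('a) ^ n) \<le> real ((\<Sum>a\<in>V. mass a n) + card S)"
        using sum_mass_ge[OF n] by (simp only: of_nat_le_iff)
      ultimately show ?thesis by simp
    qed
    have "power_sum_L \<psi> n = (\<Sum>a\<in>V. a * of_real (x a)) + of_real (real (CARD('a) ^ n) / real (card V)) * (\<Sum>a\<in>V. a)"
    proof -
      have "a * of_nat (mass a n) = a * of_real (x a) + of_real (real (CARD('a) ^ n) / real (card V)) * a" for a
        by (simp add: x_def algebra_simps)
      then show ?thesis by (simp only: power_sum_eq_mass[OF n] sum.distrib sum_distrib_left)
    qed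
    then have "cmod (power_sum_L \<psi> n) = cmod (\<Sum>a\<in>V. a * of_real (x a))" by (simp add: sum_V)
    also have "\<dots> \<le> (\<Sum>a\<in>V. \<bar>x a\<bar>)"
      by (rule order_trans[OF norm_sum]) (auto intro!: sum_mono simp: norm_mult V_norm)
    \<comment> \<open>\<open>x a \<le> E\<close> implies
      \<open>\<bar>x a\<bar> \<le> 2 * E - x a\<close>, so one lower bound for the total replaces
      lower bounds for each \<open>x a\<close>.\<close>
    also have "\<dots> \<le> (\<Sum>a\<in>V. 2 * E - x a)"
      using xE E0 by (intro sum_mono) (auto simp: abs_if)
    also have "\<dots> = 2 * real (card V) * E - (\<Sum>a\<in>V. x a)" by (simp add: sum_subtractf)
    also have "\<dots> \<le> 2 * real (card V) * E + real (card S) * 1" using xs by simp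
    also have "real (card S) * 1 \<le> real (card S) * sqrt (real CARD('a)) ^ n"
      using card1 by (intro mult_left_mono one_le_power) auto
    finally show ?thesis by (simp add: E_def algebra_simps)
  qed
  have "cmod (coeff_sum_L \<psi> 1) \<le> real (card S) * sqrt (real CARD('a))"
  proof (rule newton_power_sum_bound[where S = "power_sum_L \<psi>"])
    show "coeff_sum_L \<psi> 0 = 1" by (simp add: coeff_sum_L_def monics_0 psi_1)
    show "sqrt (real CARD('a)) > 0" using card1 by simp
  qed (use coeff_sum_psi_eq_0 newton_L[OF psi_mult psi_1] bound in auto)
  moreover have "coeff_sum_L \<psi> 1 = (\<Sum>x\<in>UNIV. \<Prod>c\<in>S. chi (x + c) ^ ec c)"
  proof -
    have "monics 1 = (\<lambda>x. [:x, 1 :: 'a mod_ring:]) ` UNIV"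
    proof (intro equalityI subsetI)
      fix g :: "'a mod_ring poly" assume g: "g \<in> monics 1"
      then have "coeff g 1 = 1" "degree g = 1" by (auto simp: monics_def)
      then have "g = [:coeff g 0, 1:]" by (auto simp: poly_eq_iff coeff_pCons coeff_eq_0 split: nat.splits)
      then show "g \<in> (\<lambda>x. [:x, 1:]) ` UNIV" by blast
    qed (auto simp: monics_def)
    moreover have "inj (\<lambda>x. [:x, 1 :: 'a mod_ring:])" by (auto simp: inj_def)
    ultimately show ?thesis by (simp add: coeff_sum_L_def sum.reindex \<psi>_def)
  qed
  ultimately show ?thesis by simp
qed

end

section \<open>Transfer to residues modulo an arbitrary prime\<close>

definition dirichlet_char :: "nat \<Rightarrow> (int \<Rightarrow> complex) \<Rightarrow> bool" where
  "dirichlet_char p \<phi> \<longleftrightarrow> (\<forall>a b. \<phi> (a * b) = \<phi> a * \<phi> b) \<and> \<phi> 1 = 1 \<and>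
     (\<forall>a. \<phi> (a mod int p) = \<phi> a) \<and> (\<forall>a. \<phi> a = 0 \<longleftrightarrow> int p dvd a)"

definition weil_holds :: "nat \<Rightarrow> bool" where
  "weil_holds p \<longleftrightarrow> (\<forall>\<phi> S ec. dirichlet_char p \<phi> \<and> (\<exists>a. \<phi> a \<noteq> 0 \<and> \<phi> a \<noteq> 1) \<and> S \<subseteq> {0..<int p} \<and>
     (\<exists>c\<in>S. ec c = (1::nat)) \<longrightarrow>
     cmod (\<Sum>x=0..<int p. \<Prod>c\<in>S. \<phi> (x + c) ^ ec c) \<le> real (card S) * sqrt (real p))"

text \<open>The type \<open>'a mod_ring\<close> cannot be instantiated at a variable prime. A single type whose cardinality is a
  counterexample, if there is one, suffices to transfer Weil's bound to all primes.\<close>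

definition critical_prime :: nat where
  "critical_prime = (SOME p. prime p \<and> ((\<exists>q. prime q \<and> \<not> weil_holds q) \<longrightarrow> \<not> weil_holds p))"

lemma critical_prime:
  "prime critical_prime" "prime q \<Longrightarrow> \<not> weil_holds q \<Longrightarrow> \<not> weil_holds critical_prime"
proof -
  have "\<exists>p. prime p \<and> ((\<exists>q. prime q \<and> \<not> weil_holds q) \<longrightarrow> \<not> weil_holds p)"
    using two_is_prime_nat by blast
  then have "prime critical_prime \<and> ((\<exists>q. prime q \<and> \<not> weil_holds q) \<longrightarrow> \<not> weil_holds critical_prime)"
    unfolding critical_prime_def by (rule someI_ex)
  then show "prime critical_prime" "prime q \<Longrightarrow> \<not> weil_holds q \<Longrightarrow> \<not> weil_holds critical_prime" by blast+
qed

typedef critical = "{..<critical_prime}"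
  using critical_prime(1) prime_gt_0_nat by blast

lemma CARD_critical: "CARD(critical) = critical_prime"
  using type_definition.card[OF type_definition_critical] by simp

instance critical :: prime_card
  by standard (simp add: CARD_critical critical_prime(1))

text \<open>The bijection between the residues and the elements of \<open>critical mod_ring\<close>
  carries Dirichlet characters to characters of the field and one sum to the other.\<close>

lemma weil_holds_critical_prime: "weil_holds critical_prime"
  unfolding weil_holds_def
proof (intro allI impI, elim conjE)
  fix \<phi> :: "int \<Rightarrow> complex" and S :: "int set" and ec :: "int \<Rightarrow> nat"
  assume \<phi>: "dirichlet_char critical_prime \<phi>" and nt: "\<exists>a. \<phi> a \<noteq> 0 \<and> \<phi> a \<noteq> 1"
    and S: "S \<subseteq> {0..<int critical_prime}" and ec: "\<exists>c\<in>S. ec c = 1"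
  let ?ti = "to_int_mod_ring :: critical mod_ring \<Rightarrow> int" and ?oi = "of_int_mod_ring :: int \<Rightarrow> critical mod_ring"
  have \<phi>m: "\<phi> (a * b) = \<phi> a * \<phi> b" "\<phi> 1 = 1" "\<phi> (a mod int critical_prime) = \<phi> a"
    "\<phi> a = 0 \<longleftrightarrow> int critical_prime dvd a" for a b
    using \<phi> by (auto simp: dirichlet_char_def)
  have toi: "?ti (?oi x) = x" if "x \<in> {0..<int critical_prime}" for x
    using that by (simp add: CARD_critical)
  have rng: "?ti x \<in> {0..<int critical_prime}" for x
    using range_to_int_mod_ring[where ?'a = critical] by (auto simp: CARD_critical)
  have bij: "bij_betw ?ti UNIV {0..<int critical_prime}"
    by (rule bij_betw_byWitness[where f' = ?oi]) (use rng toi in auto)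
  have injoi: "inj_on ?oi S" by (rule inj_on_inverseI[of _ ?ti]) (use S toi in auto)
  obtain c0 where c0: "c0 \<in> S" "ec c0 = 1" using ec by auto
  interpret mc: mult_char "\<lambda>x. \<phi> (?ti x)" "?oi ` S" "\<lambda>x. ec (?ti x)" "?oi c0"
  proof
    show "\<phi> (?ti (x * y)) = \<phi> (?ti x) * \<phi> (?ti y)" for x y
      by (simp add: to_int_mod_ring_mult CARD_critical \<phi>m)
    show "\<phi> (?ti 1) = 1" by (simp add: \<phi>m)
    show "\<phi> (?ti 0) = 0" by (simp add: \<phi>m)
    obtain a where a: "\<phi> a \<noteq> 0" "\<phi> a \<noteq> 1" using nt by auto
    have p0: "0 < int critical_prime" using critical_prime(1) prime_gt_0_nat by simp
    have ma: "\<phi> (?ti (?oi (a mod int critical_prime))) = \<phi> a"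
      using p0 by (subst toi) (auto simp: \<phi>m)
    show "\<exists>x. x \<noteq> 0 \<and> \<phi> (?ti x) \<noteq> 1"
    proof (intro exI conjI)
      show "\<phi> (?ti (?oi (a mod int critical_prime))) \<noteq> 1" using ma a by simp
      show "?oi (a mod int critical_prime) \<noteq> 0"
      proof
        assume "?oi (a mod int critical_prime) = 0"
        then have "\<phi> (?ti 0) = \<phi> a" using ma by simp
        moreover have "\<phi> 0 = 0" by (simp add: \<phi>m(4))
        ultimately show False using a by simp
      qed
    qed
    show "?oi c0 \<in> ?oi ` S" using c0 by simp
    show "ec (?ti (?oi c0)) = 1" using toi[of c0] c0 S by auto
  qed
  have "(\<Sum>x\<in>UNIV. \<Prod>c\<in>?oi ` S. \<phi> (?ti (x + c)) ^ ec (?ti c)) = (\<Sum>x=0..<int critical_prime. \<Prod>c\<in>S. \<phi> (x + c) ^ ec c)"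
  proof -
    have "(\<Prod>c\<in>?oi ` S. \<phi> (?ti (x + c)) ^ ec (?ti c)) = (\<Prod>c\<in>S. \<phi> (?ti x + c) ^ ec c)" for x
    proof -
      have "\<phi> (?ti (x + ?oi c)) ^ ec (?ti (?oi c)) = \<phi> (?ti x + c) ^ ec c" if "c \<in> S" for c
        using toi[of c] S that by (auto simp: to_int_mod_ring_add CARD_critical \<phi>m)
      then show ?thesis using injoi by (simp add: prod.reindex)
    qed
    then show ?thesis using sum.reindex_bij_betw[OF bij, of "\<lambda>x. \<Prod>c\<in>S. \<phi> (x + c) ^ ec c"] by simp
  qed
  moreover have "card (?oi ` S) = card S" using injoi by (rule card_image)
  ultimately show "cmod (\<Sum>x=0..<int critical_prime. \<Prod>c\<in>S. \<phi> (x + c) ^ ec c) \<le> real (card S) * sqrt (real critical_prime)"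
    using mc.weil_bound by (simp add: CARD_critical)
qed

text \<open>If any prime violated the bound, \<open>critical_prime\<close> would violate it
  too.\<close>

theorem weil_character_sum:
  assumes "prime p" "dirichlet_char p \<phi>" "\<phi> a \<noteq> 0" "\<phi> a \<noteq> 1" "S \<subseteq> {0..<int p}" "c \<in> S" "ec c = 1"
  shows "cmod (\<Sum>x=0..<int p. \<Prod>c\<in>S. \<phi> (x + c) ^ ec c) \<le> real (card S) * sqrt (real p)"
proof -
  have "weil_holds p" using critical_prime(2)[OF assms(1)] weil_holds_critical_prime by blast
  then show ?thesis using assms unfolding weil_holds_def by blast
qed

section \<open>Characters modulo a prime and Burgess' bound\<close>

lemma card_divisors_mult_le:
  fixes a b :: nat
  assumes "a > 0" "b > 0"
  shows "card {d. d dvd a * b} \<le> card {d. d dvd a} * card {d. d dvd b}"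
proof -
  have "{d. d dvd a * b} \<subseteq> (\<lambda>(x, y). x * y) ` ({d. d dvd a} \<times> {d. d dvd b})"
  proof
    fix d assume "d \<in> {d. d dvd a * b}"
    then have "d dvd a * b" by simp
    then obtain x y where "d = x * y" "x dvd a" "y dvd b" by (rule division_decomp[THEN exE]) blast
    then show "d \<in> (\<lambda>(x, y). x * y) ` ({d. d dvd a} \<times> {d. d dvd b})" by auto
  qed
  then have "card {d. d dvd a * b} \<le> card ({d. d dvd a} \<times> {d. d dvd b})"
    using assms by (intro surj_card_le) auto
  then show ?thesis by (simp add: card_cartesian_product)
qed

lemma card_divisors_prime_power: "prime q \<Longrightarrow> card {d. d dvd q ^ e} = e + 1" for q :: nat
proof -
  assume q: "prime q"
  have "{d. d dvd q ^ e} = (\<lambda>i. q ^ i) ` {..e}"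
    using q by (auto simp: divides_primepow_nat)
  moreover have "inj_on (\<lambda>i. q ^ i) {..e}"
    using q prime_gt_1_nat[OF q] by (auto simp: inj_on_def)
  ultimately show ?thesis by (simp add: card_image)
qed

text \<open>A factor \<open>q ^ e\<close> contributes \<open>e + 1\<close> divisors. If
  \<open>q powr \<kappa> \<ge> 2\<close>, this is at most \<open>2 ^ e\<close>, hence at most
  \<open>(q ^ e) powr \<kappa>\<close>; each of the finitely many smaller primes costs one factor
  \<open>c\<close>.\<close>

lemma divisor_bound:
  fixes \<kappa> :: real
  assumes \<kappa>: "\<kappa> > 0"
  shows "\<exists>C\<ge>1. \<forall>n::nat. n > 0 \<longrightarrow> real (card {d. d dvd n}) \<le> C * real n powr \<kappa>"
proof -
  define B where "B = nat \<lceil>2 powr (1 / \<kappa>)\<rceil>"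
  \<comment> \<open>Chosen so that \<open>e + 1 \<le> c * (1 + e * \<kappa> * ln 2)\<close>, where
    the bracket is at most \<open>2 powr (e * \<kappa>)\<close>.\<close>
  define c where "c = 1 + 1 / (\<kappa> * ln 2)"
  have c1: "c \<ge> 1" using \<kappa> by (simp add: c_def)
  have loc: "real (e + 1) \<le> (if q < B then c else 1) * real (q ^ e) powr \<kappa>" if q: "prime q" for q e :: nat
  proof -
    have q2: "real q \<ge> 2" using prime_ge_2_nat[OF q] by simp
    have pw: "real (q ^ e) powr \<kappa> = (real q powr \<kappa>) ^ e"
      using q2 by (simp add: powr_realpow[symmetric] powr_powr mult.commute)
    show ?thesis
    proof (cases "q < B")
      case True
      have "(2 powr \<kappa>) ^ e \<le> (real q powr \<kappa>) ^ e" using q2 \<kappa> by (intro power_mono powr_mono2) auto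
      moreover have "(2 powr \<kappa>) ^ e = exp (real e * \<kappa> * ln 2)"
        by (simp add: powr_def mult_ac flip: exp_of_nat_mult)
      moreover have "1 + real e * \<kappa> * ln 2 \<le> exp (real e * \<kappa> * ln 2)" by (rule exp_ge_add_one_self)
      ultimately have "1 + real e * \<kappa> * ln 2 \<le> (real q powr \<kappa>) ^ e" by linarith
      then have "c * (1 + real e * \<kappa> * ln 2) \<le> c * (real q powr \<kappa>) ^ e" using c1 by (intro mult_left_mono) auto
      moreover have "real (e + 1) \<le> c * (1 + real e * \<kappa> * ln 2)"
      proof -
        have "c * (1 + real e * \<kappa> * ln 2) = c + real e + real e * (\<kappa> * ln 2)"
          using \<kappa> by (simp add: c_def field_simps)
        moreover have "0 \<le> real e * (\<kappa> * ln 2)" using \<kappa> by simp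
        ultimately show ?thesis using c1 by simp
      qed
      ultimately show ?thesis using True pw by simp
    next
      case False
      have "2 powr (1 / \<kappa>) \<le> real B" unfolding B_def by linarith
      also have "\<dots> \<le> real q" using False by simp
      finally have "(2 powr (1 / \<kappa>)) powr \<kappa> \<le> real q powr \<kappa>" using \<kappa> by (intro powr_mono2) auto
      then have "2 \<le> real q powr \<kappa>" using \<kappa> by (simp add: powr_powr)
      then have "2 ^ e \<le> (real q powr \<kappa>) ^ e" by (intro power_mono) auto
      moreover have "real (e + 1) \<le> 2 ^ e"
      proof -
        have "e + 1 \<le> 2 ^ e" by (induction e) auto
        then show ?thesis by (metis of_nat_le_iff of_nat_numeral of_nat_power)
      qed
      ultimately show ?thesis using False pw by simp
    qed
  qed
  define PP where "PP n = {q. prime q \<and> q dvd n \<and> q < B}" for n :: nat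
  have finPP: "finite (PP n)" for n by (rule finite_subset[of _ "{..<B}"]) (auto simp: PP_def)
  have main: "real (card {d. d dvd n}) \<le> c ^ card (PP n) * real n powr \<kappa>" if "n > 0" for n :: nat
    using that
  proof (induction n rule: less_induct)
    case (less n)
    show ?case
    proof (cases "n = 1")
      case True
      have "PP 1 = {}" by (auto simp: PP_def)
      then show ?thesis using True by simp
    next
      case False
      then obtain q where q: "prime q" "q dvd n" using prime_factor_nat by blast
      define e where "e = multiplicity q n"
      obtain m where m: "n = q ^ e * m" "\<not> q dvd m"
        using multiplicity_decompose'[of n q] less.prems q unfolding e_def
        by (metis not_prime_unit not_gr_zero)
      have m0: "m > 0" using m less.prems by (cases m) auto
      have e0: "e > 0" using q m by (cases e) auto
      have "q ^ e > 1" using q e0 prime_gt_1_nat one_less_power by blast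
      then have mn: "m < n" using m m0 by simp
      have PPn: "PP n = PP m \<union> (if q < B then {q} else {})"
      proof -
        have "x dvd n \<longleftrightarrow> x dvd m \<or> x = q" if "prime x" for x
        proof -
          have "x dvd n \<longleftrightarrow> x dvd q ^ e \<or> x dvd m" unfolding m(1) using that by (rule prime_dvd_mult_iff)
          also have "x dvd q ^ e \<longleftrightarrow> x = q"
            using prime_dvd_power_iff[of x e q] primes_dvd_imp_eq[of x q] that q(1) e0 by auto
          finally show ?thesis by blast
        qed
        then show ?thesis using q by (auto simp: PP_def)
      qed
      have "q \<notin> PP m" using m by (simp add: PP_def)
      then have cPP: "card (PP n) = card (PP m) + (if q < B then 1 else 0)"
        unfolding PPn using finPP[of m] by (auto simp: card_insert_if)
      have "real (card {d. d dvd n}) \<le> real (card {d. d dvd q ^ e} * card {d. d dvd m})"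
        unfolding m(1) of_nat_le_iff using q m0 prime_gt_0_nat by (intro card_divisors_mult_le) auto
      also have "\<dots> = real (e + 1) * real (card {d. d dvd m})"
        by (simp only: card_divisors_prime_power[OF q(1)] of_nat_mult)
      also have "\<dots> \<le> ((if q < B then c else 1) * real (q ^ e) powr \<kappa>) * (c ^ card (PP m) * real m powr \<kappa>)"
        using loc[OF q(1), of e] less.IH[OF mn m0] by (intro mult_mono) auto
      also have "\<dots> = c ^ card (PP n) * (real (q ^ e) powr \<kappa> * real m powr \<kappa>)"
        by (simp add: cPP)
      also have "real (q ^ e) powr \<kappa> * real m powr \<kappa> = real n powr \<kappa>"
        unfolding m(1) of_nat_mult by (rule powr_mult[symmetric])
      finally show ?thesis .
    qed
  qed
  show ?thesis
  proof (intro exI[of _ "c ^ B"] conjI allI impI)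
    show "c ^ B \<ge> 1" using c1 by simp
    fix n :: nat assume n: "n > 0"
    have "card (PP n) \<le> card {..<B}" by (intro card_mono) (auto simp: PP_def)
    then have "c ^ card (PP n) \<le> c ^ B" using c1 by (intro power_increasing) auto
    then have "c ^ card (PP n) * real n powr \<kappa> \<le> c ^ B * real n powr \<kappa>" by (intro mult_right_mono) auto
    then show "real (card {d. d dvd n}) \<le> c ^ B * real n powr \<kappa>" using main[OF n] by linarith
  qed
qed

section \<open>Characters modulo a prime by discrete logarithms\<close>

lemma cis_2pi_eq_1:
  assumes "cis (2 * pi * t) = 1"
  obtains x :: int where "t = of_int x"
proof -
  have "cos (2 * pi * t) = 1" using assms by (metis cis.sel(1) one_complex.sel(1))
  then obtain x :: int where "2 * pi * t = of_int x * 2 * pi" by (auto simp: cos_one_2pi_int)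
  then have "2 * pi * t = 2 * pi * of_int x" by simp
  then have "t = of_int x" by simp
  then show ?thesis by (rule that)
qed

definition prim_root :: "nat \<Rightarrow> nat" where
  "prim_root p = (SOME g. residue_primroot p g)"

definition dlog :: "nat \<Rightarrow> int \<Rightarrow> nat" where
  "dlog p n = (SOME i. i < p - 1 \<and> [int (prim_root p) ^ i = n] (mod int p))"

text \<open>The characters modulo \<open>p\<close>, numbered by \<open>k < p - 1\<close> through the
  discrete logarithm. The principal one is \<open>k = 0\<close>, and orthogonality becomes a finite
  geometric sum.\<close>

definition dchar :: "nat \<Rightarrow> nat \<Rightarrow> int \<Rightarrow> complex" where
  "dchar p k n = (if int p dvd n then 0 else cis (2 * pi * real (k * dlog p n) / real (p - 1)))"

locale prime_mod =
  fixes p :: nat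
  assumes p: "prime p"
begin

lemma p2: "p \<ge> 2" using p prime_ge_2_nat by blast

lemma prim_root: "residue_primroot p (prim_root p)"
  unfolding prim_root_def using prime_primitive_root_exists[OF prime_gt_1_nat[OF p] p] by (rule someI_ex)

lemma primroot_bij: "bij_betw (\<lambda>i. prim_root p ^ i mod p) {..<p - 1} (totatives p)"
  using residue_primroot_is_generator[OF _ prim_root] p2 p by (simp add: totient_prime)

lemma dlog_ex: assumes "\<not> int p dvd n" shows "\<exists>i. i < p - 1 \<and> [int (prim_root p) ^ i = n] (mod int p)"
proof -
  define m where "m = nat (n mod int p)"
  have p0: "int p > 0" using p2 by simp
  have m: "int m = n mod int p" using p0 by (simp add: m_def)
  have "0 < m" using assms m by (metis dvd_eq_mod_eq_0 gr0I of_nat_0)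
  moreover have "m < p" using m p0 by (metis of_nat_less_iff pos_mod_bound)
  ultimately have "m \<in> totatives p" using p by (simp add: totatives_prime)
  then have "m \<in> (\<lambda>i. prim_root p ^ i mod p) ` {..<p - 1}"
    using primroot_bij by (simp only: bij_betw_def)
  then obtain i where i: "i < p - 1" "prim_root p ^ i mod p = m" by blast
  then have "int (prim_root p) ^ i mod int p = n mod int p" using m by (metis of_nat_mod of_nat_power)
  then show ?thesis using i by (auto simp: unique_euclidean_semiring_class.cong_def)
qed

lemma dlog: assumes "\<not> int p dvd n" shows "dlog p n < p - 1" "[int (prim_root p) ^ dlog p n = n] (mod int p)"
  using someI_ex[OF dlog_ex[OF assms]] by (auto simp: dlog_def)

lemma primroot_inj: assumes "i < p - 1" "j < p - 1" "[int (prim_root p) ^ i = int (prim_root p) ^ j] (mod int p)" shows "i = j"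
proof -
  have "prim_root p ^ i mod p = prim_root p ^ j mod p"
    using assms(3) unfolding unique_euclidean_semiring_class.cong_def by (metis of_nat_eq_iff of_nat_mod of_nat_power)
  then show ?thesis using primroot_bij assms by (auto simp: bij_betw_def inj_on_def)
qed

lemma primroot_coprime: "coprime (prim_root p) p"
  using prim_root by (auto simp: residue_primroot_def coprime_commute)

lemma primroot_power: "[int (prim_root p) ^ (p - 1) = 1] (mod int p)"
proof -
  have "[prim_root p ^ (p - 1) = 1] (mod p)"
    using euler_theorem[OF primroot_coprime] p by (simp add: totient_prime)
  then show ?thesis by (metis cong_int_iff of_nat_1 of_nat_power)
qed

lemma dlog_unique: assumes "[int (prim_root p) ^ i = n] (mod int p)" "\<not> int p dvd n" shows "i mod (p - 1) = dlog p n"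
proof (rule primroot_inj)
  show "i mod (p - 1) < p - 1" using p2 by simp
  show "dlog p n < p - 1" using dlog assms by blast
  have "int (prim_root p) ^ i = (int (prim_root p) ^ (p - 1)) ^ (i div (p - 1)) * int (prim_root p) ^ (i mod (p - 1))"
    by (simp flip: power_mult power_add)
  then have "[int (prim_root p) ^ i = 1 ^ (i div (p - 1)) * int (prim_root p) ^ (i mod (p - 1))] (mod int p)"
    using primroot_power by (metis cong_mult cong_pow cong_refl)
  then show "[int (prim_root p) ^ (i mod (p - 1)) = int (prim_root p) ^ dlog p n] (mod int p)"
    using dlog(2)[OF assms(2)] assms(1) by (simp add: unique_euclidean_semiring_class.cong_def)
qed

lemma dlog_cong: assumes "[m = n] (mod int p)" "\<not> int p dvd n" shows "dlog p m = dlog p n"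
proof -
  have "\<not> int p dvd m" using assms by (simp add: cong_dvd_iff)
  then have "dlog p m mod (p - 1) = dlog p n"
    using dlog_unique[of "dlog p m" n] dlog(2)[of m] assms cong_trans by blast
  then show ?thesis using dlog(1)[OF \<open>\<not> int p dvd m\<close>] by simp
qed

lemma prime_int: "prime (int p)" using p by simp

lemma dlog_mult: assumes "\<not> int p dvd a" "\<not> int p dvd b" shows "dlog p (a * b) = (dlog p a + dlog p b) mod (p - 1)"
proof -
  have "\<not> int p dvd a * b" using assms prime_int by (simp add: prime_dvd_mult_iff)
  moreover have "[int (prim_root p) ^ (dlog p a + dlog p b) = a * b] (mod int p)"
    using cong_mult[OF dlog(2)[OF assms(1)] dlog(2)[OF assms(2)]] by (simp add: power_add)
  ultimately show ?thesis using dlog_unique by metis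
qed

lemma cis_mod: "cis (2 * pi * real (k * (i mod (p - 1))) / real (p - 1)) = cis (2 * pi * real (k * i) / real (p - 1))"
proof -
  have p1: "real (p - 1) > 0" using p2 by simp
  have "i = (p - 1) * (i div (p - 1)) + i mod (p - 1)" by simp
  then have "real (k * i) = real (p - 1) * real (k * (i div (p - 1))) + real (k * (i mod (p - 1)))"
    by (metis distrib_left mult.left_commute of_nat_add of_nat_mult)
  moreover have "2 * pi * (x * a + b) / x = 2 * pi * a + 2 * pi * b / x" if "x > 0" for x a b :: real
    using that by (simp add: field_simps)
  ultimately have "2 * pi * real (k * i) / real (p - 1) =
      2 * pi * real (k * (i div (p - 1))) + 2 * pi * real (k * (i mod (p - 1))) / real (p - 1)"
    using p1 by metis
  moreover have "cis (2 * pi * real (k * (i div (p - 1)))) = 1"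
    by (rule cis_multiple_2pi) auto
  ultimately show ?thesis by (simp flip: cis_mult)
qed

lemma dchar_mult: "dchar p k (a * b) = dchar p k a * dchar p k b"
proof (cases "int p dvd a \<or> int p dvd b")
  case True
  then show ?thesis by (auto simp: dchar_def)
next
  case False
  then have "\<not> int p dvd a * b" using prime_int by (simp add: prime_dvd_mult_iff)
  then show ?thesis
    using False cis_mod[of k "dlog p a + dlog p b"]
    by (simp add: dchar_def dlog_mult cis_mult ring_distribs add_divide_distrib)
qed

lemma dchar_cong: "[m = n] (mod int p) \<Longrightarrow> dchar p k m = dchar p k n"
  using dlog_cong by (auto simp: dchar_def cong_dvd_iff)

lemma dchar_1: "dchar p k 1 = 1"
proof -
  have "\<not> int p dvd 1" using p2 by simp
  moreover have "dlog p 1 = 0" using dlog_unique[of 0 1] calculation by simp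
  ultimately show ?thesis by (simp add: dchar_def)
qed

lemma dchar_eq_0_iff: "dchar p k n = 0 \<longleftrightarrow> int p dvd n"
  by (simp add: dchar_def)

lemma norm_dchar_le: "cmod (dchar p k n) \<le> 1"
  by (simp add: dchar_def)

lemma dirichlet_char_dchar: "dirichlet_char p (dchar p k)"
  unfolding dirichlet_char_def using dchar_mult dchar_1 dchar_eq_0_iff dchar_cong by (auto intro!: dchar_cong)

lemma dchar_principal: "dchar p 0 n = (if int p dvd n then 0 else 1)"
  by (simp add: dchar_def)

lemma dchar_nontrivial: assumes "0 < k" "k < p - 1" shows "\<exists>a. dchar p k a \<noteq> 0 \<and> dchar p k a \<noteq> 1"
proof -
  define g where "g = int (prim_root p)"
  have pg: "\<not> int p dvd g"
  proof
    assume "int p dvd g"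
    then have "p dvd prim_root p" by (simp add: g_def)
    then show False using primroot_coprime p2 by (metis coprime_absorb_right not_prime_unit p)
  qed
  have "dlog p g = 1 mod (p - 1)" using dlog_unique[of 1 g] pg by (simp add: g_def)
  then have d1: "dlog p g = 1" using assms by simp
  have "dchar p k g \<noteq> 1"
  proof
    assume "dchar p k g = 1"
    then have "cis (2 * pi * (real k / real (p - 1))) = 1" using pg d1 by (simp add: dchar_def)
    then obtain x :: int where "real k / real (p - 1) = of_int x" by (rule cis_2pi_eq_1)
    moreover have "0 < real k / real (p - 1)" "real k / real (p - 1) < 1" using assms by auto
    ultimately have "(0::real) < of_int x" "(of_int x :: real) < 1" by simp_all
    then have "0 < x" "x < 1" by simp_all
    then show False by linarith
  qed
  then show ?thesis using pg dchar_eq_0_iff by blast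
qed

lemma dchar_orthogonal:
  assumes "\<not> int p dvd a" "\<not> int p dvd b"
  shows "(\<Sum>k<p - 1. dchar p k a * cnj (dchar p k b)) = (if [a = b] (mod int p) then of_nat (p - 1) else 0)"
proof -
  define z where "z = cis (2 * pi * ((real (dlog p a) - real (dlog p b)) / real (p - 1)))"
  have p1: "real (p - 1) > 0" using p2 by simp
  have tm: "dchar p k a * cnj (dchar p k b) = z ^ k" for k
  proof -
    have "z ^ k = cis (real k * (2 * pi * ((real (dlog p a) - real (dlog p b)) / real (p - 1))))"
      unfolding z_def by (rule Complex.DeMoivre)
    also have "real k * (2 * pi * ((real (dlog p a) - real (dlog p b)) / real (p - 1))) =
        2 * pi * real (k * dlog p a) / real (p - 1) - 2 * pi * real (k * dlog p b) / real (p - 1)"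
      by (simp add: diff_divide_distrib algebra_simps)
    finally show ?thesis using assms by (simp add: dchar_def cis_cnj cis_mult)
  qed
  have zp: "z ^ (p - 1) = 1"
  proof -
    have "z ^ (p - 1) = cis (real (p - 1) * (2 * pi * ((real (dlog p a) - real (dlog p b)) / real (p - 1))))"
      unfolding z_def by (rule Complex.DeMoivre)
    also have "real (p - 1) * (2 * pi * ((real (dlog p a) - real (dlog p b)) / real (p - 1))) =
        2 * pi * of_int (int (dlog p a) - int (dlog p b))"
      using p1 by (simp del: of_nat_diff)
    finally show ?thesis by (simp only: cis_multiple_2pi Ints_of_int)
  qed
  show ?thesis
  proof (cases "[a = b] (mod int p)")
    case True
    then have "z = 1" using dlog_cong[OF True assms(2)] by (simp add: z_def)
    then show ?thesis using True by (simp add: tm)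
  next
    case False
    have ne: "dlog p a \<noteq> dlog p b"
    proof
      assume "dlog p a = dlog p b"
      then have "[a = b] (mod int p)" using dlog(2)[OF assms(1)] dlog(2)[OF assms(2)] by (metis cong_sym cong_trans)
      then show False using False by simp
    qed
    have "z \<noteq> 1"
    proof
      assume "z = 1"
      then obtain x :: int where x: "(real (dlog p a) - real (dlog p b)) / real (p - 1) = of_int x"
        unfolding z_def by (rule cis_2pi_eq_1)
      have "\<bar>(real (dlog p a) - real (dlog p b)) / real (p - 1)\<bar> < 1"
        using dlog(1)[OF assms(1)] dlog(1)[OF assms(2)] by (auto simp: abs_if field_simps)
      then have "\<bar>of_int x :: real\<bar> < 1" unfolding x .
      then have "x = 0" by linarith
      then have "(real (dlog p a) - real (dlog p b)) / real (p - 1) = 0" using x by simp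
      then show False using p1 ne by simp
    qed
    then show ?thesis using False zp by (simp add: tm geometric_sum)
  qed
qed

text \<open>Orthogonality counts solutions of congruences. One family taken twice gives energies;
  two families serve for pairs of different boxes, and for a box against a set of residues.\<close>

lemma bilinear_orthogonality:
  assumes fin: "finite A" "finite B"
    and A: "\<And>x. x \<in> A \<Longrightarrow> \<not> int p dvd f x" and B: "\<And>x. x \<in> B \<Longrightarrow> \<not> int p dvd g x"
  shows "(\<Sum>k<p - 1. (\<Sum>x\<in>A. dchar p k (f x)) * cnj (\<Sum>y\<in>B. dchar p k (g y))) =
    of_nat ((p - 1) * card {(x, y) \<in> A \<times> B. [f x = g y] (mod int p)})"
proof -
  have "(\<Sum>k<p - 1. (\<Sum>x\<in>A. dchar p k (f x)) * cnj (\<Sum>y\<in>B. dchar p k (g y))) =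
      (\<Sum>k<p - 1. \<Sum>(x, y)\<in>A \<times> B. dchar p k (f x) * cnj (dchar p k (g y)))"
    by (simp add: cnj_sum sum_product sum.cartesian_product)
  also have "\<dots> = (\<Sum>(x, y)\<in>A \<times> B. \<Sum>k<p - 1. dchar p k (f x) * cnj (dchar p k (g y)))"
    by (subst sum.swap) (simp add: split_def)
  also have "\<dots> = (\<Sum>z\<in>A \<times> B. if [f (fst z) = g (snd z)] (mod int p) then of_nat (p - 1) else 0)"
  proof (intro sum.cong refl)
    fix z assume "z \<in> A \<times> B"
    then have "\<not> int p dvd f (fst z)" "\<not> int p dvd g (snd z)" using A B by auto
    then show "(case z of (x, y) \<Rightarrow> \<Sum>k<p - 1. dchar p k (f x) * cnj (dchar p k (g y))) =
        (if [f (fst z) = g (snd z)] (mod int p) then of_nat (p - 1) else 0)"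
      unfolding split_def by (rule dchar_orthogonal)
  qed
  also have "\<dots> = (\<Sum>z\<in>{z \<in> A \<times> B. [f (fst z) = g (snd z)] (mod int p)}. of_nat (p - 1))"
    using fin by (subst sum.inter_filter) auto
  also have "{z \<in> A \<times> B. [f (fst z) = g (snd z)] (mod int p)} = {(x, y) \<in> A \<times> B. [f x = g y] (mod int p)}"
    by auto
  finally show ?thesis by (simp add: mult.commute)
qed

lemma energy_identity:
  assumes "finite A" "\<And>x. x \<in> A \<Longrightarrow> \<not> int p dvd f x"
  shows "(\<Sum>k<p - 1. (cmod (\<Sum>x\<in>A. dchar p k (f x)))\<^sup>2) =
    real ((p - 1) * card {(x, y) \<in> A \<times> A. [f x = f y] (mod int p)})"
proof -
  have "complex_of_real (\<Sum>k<p - 1. (cmod (\<Sum>x\<in>A. dchar p k (f x)))\<^sup>2) =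
      (\<Sum>k<p - 1. (\<Sum>x\<in>A. dchar p k (f x)) * cnj (\<Sum>y\<in>A. dchar p k (f y)))"
    by (simp only: of_real_sum complex_norm_square)
  also have "\<dots> = of_nat ((p - 1) * card {(x, y) \<in> A \<times> A. [f x = f y] (mod int p)})"
    using assms(1,1,2,2) by (rule bilinear_orthogonality)
  finally have "complex_of_real (\<Sum>k<p - 1. (cmod (\<Sum>x\<in>A. dchar p k (f x)))\<^sup>2) =
      complex_of_real (real ((p - 1) * card {(x, y) \<in> A \<times> A. [f x = f y] (mod int p)}))"
    unfolding of_real_of_nat_eq .
  then show ?thesis unfolding of_real_eq_iff .
qed

end

section \<open>Moments of short character sums\<close>

lemma dirichlet_char_power:
  assumes p: "prime p" and \<phi>: "dirichlet_char p \<phi>" "\<phi> y \<noteq> 0"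
  shows "\<phi> y ^ (p - 1) = 1"
proof -
  have mult: "\<phi> (a * b) = \<phi> a * \<phi> b" "\<phi> 1 = 1" "\<phi> (a mod int p) = \<phi> a" for a b
    using \<phi> by (auto simp: dirichlet_char_def)
  have pow: "\<phi> (y ^ n) = \<phi> y ^ n" for y n by (induction n) (simp_all add: mult)
  have "\<not> int p dvd y" using \<phi> by (simp add: dirichlet_char_def)
  define m where "m = nat (y mod int p)"
  have m: "int m = y mod int p" using prime_gt_0_nat[OF p] by (simp add: m_def)
  have "\<not> p dvd m" using \<open>\<not> int p dvd y\<close> m by (metis dvd_mod_iff dvd_refl of_nat_dvd_iff)
  then have "[m ^ (p - 1) = 1] (mod p)" using fermat_theorem[OF p] by blast
  then have "[int m ^ (p - 1) = 1] (mod int p)" by (metis cong_int_iff of_nat_1 of_nat_power)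
  then have "int m ^ (p - 1) mod int p = 1 mod int p" by (simp add: unique_euclidean_semiring_class.cong_def)
  then have "\<phi> (int m) ^ (p - 1) = 1" by (metis mult(2,3) pow)
  then show ?thesis by (simp add: m mult)
qed

lemma dirichlet_char_norm:
  assumes p: "prime p" and \<phi>: "dirichlet_char p \<phi>" "\<phi> y \<noteq> 0"
  shows "cmod (\<phi> y) = 1"
proof -
  have "cmod (\<phi> y) ^ (p - 1) = 1 ^ (p - 1)" using dirichlet_char_power[OF p \<phi>] by (metis norm_one norm_power power_one)
  then show ?thesis using prime_gt_1_nat[OF p] by (intro power_eq_imp_eq_base[of "cmod (\<phi> y)" "p - 1" 1]) auto
qed

text \<open>Conjugation becomes the exponent \<open>p - 2\<close>, so the products occurring in an
  even moment fit the shape of Weil's sum, which contains only powers of the character.\<close>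

lemma cnj_dirichlet_char:
  assumes p: "prime p" "p > 2" and \<phi>: "dirichlet_char p \<phi>"
  shows "cnj (\<phi> y) = \<phi> y ^ (p - 2)"
proof (cases "\<phi> y = 0")
  case True
  then show ?thesis using p by (simp add: power_0_left)
next
  case False
  have "\<phi> y * cnj (\<phi> y) = 1" using dirichlet_char_norm[OF p(1) \<phi> False] by (simp flip: complex_norm_square)
  moreover have "Suc (p - 2) = p - 1" using p by simp
  then have "\<phi> y * \<phi> y ^ (p - 2) = 1" using dirichlet_char_power[OF p(1) \<phi> False] by (metis power_Suc)
  ultimately show ?thesis using False by (metis mult_left_cancel)
qed

lemma dirichlet_char_prime_gt_2:
  assumes p: "prime p" and \<phi>: "dirichlet_char p \<phi>" "\<phi> a \<noteq> 0" "\<phi> a \<noteq> 1"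
  shows "p > 2"
proof (rule ccontr)
  assume "\<not> p > 2"
  then have p2: "p = 2" using prime_ge_2_nat[OF p] by simp
  have "\<phi> (a mod 2) = \<phi> a" "\<phi> 1 = 1" "\<phi> 0 = 0" using \<phi>(1) p2 by (auto simp: dirichlet_char_def)
  moreover have "a mod 2 = 0 \<or> a mod 2 = 1" by presburger
  ultimately show False using \<phi> by auto
qed

text \<open>Equal shifts are collected into one point, and their exponents add up. The index
  \<open>i0\<close>, whose shift occurs only once, provides the point of exponent 1 that Weil's
  bound asks for; if its factor is conjugated, the whole sum is conjugated first.\<close>

lemma weil_tuple_sum:
  assumes p: "prime p" and \<phi>: "dirichlet_char p \<phi>" "\<phi> a \<noteq> 0" "\<phi> a \<noteq> 1"
    and I: "finite I" "F ` I \<subseteq> {0..<int p}" and i0: "i0 \<in> I" "\<And>i. i \<in> I \<Longrightarrow> F i = F i0 \<Longrightarrow> i = i0"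
  shows "cmod (\<Sum>x=0..<int p. \<Prod>i\<in>I. if \<sigma> i then \<phi> (x + F i) else cnj (\<phi> (x + F i))) \<le> real (card I) * sqrt (real p)"
proof -
  have p2: "p > 2" using dirichlet_char_prime_gt_2[OF p \<phi>] .
  note cn = cnj_dirichlet_char[OF p p2 \<phi>(1)]
  define u where "u \<sigma> i = (if \<sigma> i then 1 else p - 2)" for \<sigma> :: "'a \<Rightarrow> bool" and i
  have key: "cmod (\<Sum>x=0..<int p. \<Prod>i\<in>I. if \<sigma> i then \<phi> (x + F i) else cnj (\<phi> (x + F i))) \<le> real (card I) * sqrt (real p)"
    if \<sigma>: "\<sigma> i0" for \<sigma>
  proof -
    define ec where "ec c = (\<Sum>i\<in>{i\<in>I. F i = c}. u \<sigma> i)" for c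
    have "(\<Prod>i\<in>I. if \<sigma> i then \<phi> (x + F i) else cnj (\<phi> (x + F i))) = (\<Prod>c\<in>F ` I. \<phi> (x + c) ^ ec c)" for x
    proof -
      have "(\<Prod>i\<in>I. if \<sigma> i then \<phi> (x + F i) else cnj (\<phi> (x + F i))) = (\<Prod>i\<in>I. \<phi> (x + F i) ^ u \<sigma> i)"
        by (intro prod.cong refl) (auto simp: u_def cn)
      also have "\<dots> = (\<Prod>c\<in>F ` I. \<Prod>i\<in>{i\<in>I. F i = c}. \<phi> (x + F i) ^ u \<sigma> i)"
        using I by (intro prod.group[symmetric]) auto
      also have "\<dots> = (\<Prod>c\<in>F ` I. \<phi> (x + c) ^ ec c)"
        by (intro prod.cong refl) (simp add: ec_def power_sum)
      finally show ?thesis .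
    qed
    moreover have "{i\<in>I. F i = F i0} = {i0}" using i0 by auto
    then have "ec (F i0) = 1" using \<sigma> by (simp add: ec_def u_def)
    then have "cmod (\<Sum>x=0..<int p. \<Prod>c\<in>F ` I. \<phi> (x + c) ^ ec c) \<le> real (card (F ` I)) * sqrt (real p)"
      using i0 I by (intro weil_character_sum[OF p \<phi>, of _ "F i0"]) auto
    moreover have "real (card (F ` I)) * sqrt (real p) \<le> real (card I) * sqrt (real p)"
      using card_image_le[OF I(1), of F] by (intro mult_right_mono) auto
    ultimately show ?thesis by simp
  qed
  show ?thesis
  proof (cases "\<sigma> i0")
    case False
    have "cnj (\<Sum>x=0..<int p. \<Prod>i\<in>I. if \<sigma> i then \<phi> (x + F i) else cnj (\<phi> (x + F i))) =
        (\<Sum>x=0..<int p. \<Prod>i\<in>I. if \<not> \<sigma> i then \<phi> (x + F i) else cnj (\<phi> (x + F i)))"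
      unfolding cnj_sum cnj_prod by (intro sum.cong prod.cong refl) auto
    then show ?thesis using key[of "\<lambda>i. \<not> \<sigma> i"] False by (metis complex_mod_cnj)
  qed (use key in auto)
qed

text \<open>If every value is taken at least twice, there are at most \<open>r\<close> values. The
  tuple is recovered from a list of \<open>r\<close> elements of \<open>B\<close> and a map from the
  \<open>2 * r\<close> positions into this list.\<close>

lemma card_no_singleton_le:
  assumes B: "finite B" "B \<noteq> {}"
  shows "card {F \<in> PiE {..<2 * r} (\<lambda>_. B). \<forall>i<2 * r. \<exists>j<2 * r. j \<noteq> i \<and> F j = F i} \<le> r ^ (2 * r) * card B ^ r"
proof -
  define NS where "NS = {F \<in> PiE {..<2 * r} (\<lambda>_. B). \<forall>i<2 * r. \<exists>j<2 * r. j \<noteq> i \<and> F j = F i}"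
  define mk where "mk = (\<lambda>(\<pi> :: nat \<Rightarrow> nat, G :: nat \<Rightarrow> 'a). \<lambda>i\<in>{..<2 * r}. G (\<pi> i))"
  define DD where "DD = PiE {..<2 * r} (\<lambda>_. {..<r}) \<times> PiE {..<r} (\<lambda>_. B)"
  have "NS \<subseteq> mk ` DD"
  proof
    fix F assume F: "F \<in> NS"
    define J where "J = F ` {..<2 * r}"
    have finJ: "finite J" by (simp add: J_def)
    have JB: "J \<subseteq> B" using F by (auto simp: NS_def J_def PiE_iff)
    have "2 * card J = (\<Sum>c\<in>J. 2)" by simp
    also have "\<dots> \<le> (\<Sum>c\<in>J. card {i\<in>{..<2 * r}. F i = c})"
    proof (rule sum_mono)
      fix c assume "c \<in> J"
      then obtain i where i: "i < 2 * r" "F i = c" by (auto simp: J_def)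
      then obtain j where j: "j < 2 * r" "j \<noteq> i" "F j = F i" using F by (auto simp: NS_def)
      then have "{i, j} \<subseteq> {i\<in>{..<2 * r}. F i = c}" using i by auto
      then have "card {i, j} \<le> card {i\<in>{..<2 * r}. F i = c}" by (intro card_mono) auto
      then show "2 \<le> card {i\<in>{..<2 * r}. F i = c}" using j by simp
    qed
    also have "\<dots> = 2 * r"
      using sum.group[of "{..<2 * r}" J F "\<lambda>_. 1 :: nat"] finJ by (simp add: J_def)
    finally have "card J \<le> card {..<r}" by simp
    then obtain \<iota> where \<iota>: "\<iota> ` J \<subseteq> {..<r}" "inj_on \<iota> J" using card_le_inj[OF finJ, of "{..<r}"] by auto
    obtain b0 where b0: "b0 \<in> B" using B by auto
    define \<pi> where "\<pi> = (\<lambda>i\<in>{..<2 * r}. \<iota> (F i))"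
    \<comment> \<open>\<open>b0\<close> fills the places of the list to which no value has been
      assigned.\<close>
    define G where "G = (\<lambda>k\<in>{..<r}. if k \<in> \<iota> ` J then inv_into J \<iota> k else b0)"
    have "(\<pi>, G) \<in> DD"
    proof -
      have "\<pi> \<in> PiE {..<2 * r} (\<lambda>_. {..<r})" using \<iota> by (auto simp: \<pi>_def J_def)
      moreover have "G \<in> PiE {..<r} (\<lambda>_. B)"
        using JB b0 inv_into_into[of _ \<iota> J] by (auto simp: G_def) blast
      ultimately show ?thesis by (simp add: DD_def)
    qed
    moreover have "mk (\<pi>, G) = F"
    proof
      fix i
      show "mk (\<pi>, G) i = F i"
      proof (cases "i < 2 * r")
        case True
        then have "F i \<in> J" by (auto simp: J_def)
        then have "\<iota> (F i) < r" "\<iota> (F i) \<in> \<iota> ` J" using \<iota> by auto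
        then show ?thesis using True \<iota>(2) \<open>F i \<in> J\<close> by (simp add: mk_def \<pi>_def G_def)
      next
        case False
        then show ?thesis using F by (auto simp: mk_def NS_def PiE_iff extensional_def)
      qed
    qed
    ultimately show "F \<in> mk ` DD" by (metis image_eqI)
  qed
  moreover have "finite DD" using B by (auto simp: DD_def intro!: finite_PiE)
  ultimately have "card NS \<le> card DD" by (rule surj_card_le[rotated])
  also have "card DD = r ^ (2 * r) * card B ^ r" by (simp add: DD_def card_cartesian_product card_PiE)
  finally show ?thesis by (simp add: NS_def)
qed

text \<open>The \<open>2 * r\<close>-th power expands into a sum over tuples of shifts. Tuples with
  an isolated shift enjoy square-root cancellation by Weil's bound; the others are so few that the
  trivial bound \<open>p\<close> will do.\<close>

lemma short_sum_moment:
  assumes p: "prime p" and \<phi>: "dirichlet_char p \<phi>" "\<phi> a \<noteq> 0" "\<phi> a \<noteq> 1" and h: "0 < h" "h < p" and r: "r > 0"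
  shows "(\<Sum>x=0..<int p. cmod (\<Sum>b=1..int h. \<phi> (x + b)) ^ (2 * r)) \<le>
    real (r ^ (2 * r)) * real h ^ r * real p + real h ^ (2 * r) * (2 * real r * sqrt (real p))"
proof -
  have p2: "p > 2" using dirichlet_char_prime_gt_2[OF p \<phi>] .
  have norm1: "cmod (\<phi> y) \<le> 1" for y
    using dirichlet_char_norm[OF p \<phi>(1), of y] by (cases "\<phi> y = 0") auto
  define W where "W x = (\<Sum>b=1..int h. \<phi> (x + b))" for x
  define u where "u i y = (if i < r then \<phi> y else cnj (\<phi> y))" for i y
  define FF where "FF = PiE {..<2 * r} (\<lambda>_. {1..int h})"
  define NS where "NS = {F \<in> FF. \<forall>i<2 * r. \<exists>j<2 * r. j \<noteq> i \<and> F j = F i}"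
  have finFF: "finite FF" by (simp add: FF_def finite_PiE)
  have ex: "complex_of_real (cmod (W x) ^ (2 * r)) = (\<Sum>F\<in>FF. \<Prod>i<2 * r. u i (x + F i))" for x
  proof -
    have "complex_of_real (cmod (W x) ^ (2 * r)) = (W x * cnj (W x)) ^ r"
      by (simp add: power_mult flip: complex_norm_square)
    also have "\<dots> = W x ^ r * cnj (W x) ^ r" by (simp add: power_mult_distrib)
    also have "\<dots> = (\<Prod>i<2 * r. \<Sum>b=1..int h. u i (x + b))"
    proof -
      have "(\<Prod>i<r + n. \<Sum>b=1..int h. u i (x + b)) = W x ^ r * cnj (W x) ^ n" for n
      proof (induction n)
        case 0
        have "(\<Prod>i<r. \<Sum>b=1..int h. u i (x + b)) = (\<Prod>i<r. W x)"
          by (intro prod.cong refl) (simp add: u_def W_def)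
        then show ?case by simp
      next
        case (Suc n)
        then show ?case by (simp add: u_def W_def)
      qed
      from this[of r] show ?thesis by (simp add: mult_2)
    qed
    also have "\<dots> = (\<Sum>F\<in>FF. \<Prod>i<2 * r. u i (x + F i))"
      unfolding FF_def by (rule prod_sum_PiE) auto
    finally show ?thesis .
  qed
  have "complex_of_real (\<Sum>x=0..<int p. cmod (W x) ^ (2 * r)) = (\<Sum>F\<in>FF. \<Sum>x=0..<int p. \<Prod>i<2 * r. u i (x + F i))"
    unfolding of_real_sum ex by (rule sum.swap)
  then have "(\<Sum>x=0..<int p. cmod (W x) ^ (2 * r)) = cmod (\<Sum>F\<in>FF. \<Sum>x=0..<int p. \<Prod>i<2 * r. u i (x + F i))"
    by (metis (no_types, lifting) norm_of_real abs_of_nonneg sum_nonneg zero_le_power norm_ge_zero)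
  also have "\<dots> \<le> (\<Sum>F\<in>FF. cmod (\<Sum>x=0..<int p. \<Prod>i<2 * r. u i (x + F i)))" by (rule norm_sum)
  also have "\<dots> \<le> (\<Sum>F\<in>FF. (if F \<in> NS then real p else 0) + 2 * real r * sqrt (real p))"
  proof (rule sum_mono)
    fix F assume F: "F \<in> FF"
    show "cmod (\<Sum>x=0..<int p. \<Prod>i<2 * r. u i (x + F i)) \<le> (if F \<in> NS then real p else 0) + 2 * real r * sqrt (real p)"
    proof (cases "F \<in> NS")
      case True
      have "cmod (\<Sum>x=0..<int p. \<Prod>i<2 * r. u i (x + F i)) \<le> (\<Sum>x=0..<int p. 1)"
      proof (rule sum_norm_le)
        fix x
        have "cmod (\<Prod>i<2 * r. u i (x + F i)) = (\<Prod>i<2 * r. cmod (u i (x + F i)))" by (simp add: prod_norm)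
        also have "\<dots> \<le> 1" by (intro prod_le_1) (auto simp: u_def norm1)
        finally show "cmod (\<Prod>i<2 * r. u i (x + F i)) \<le> 1" .
      qed
      then show ?thesis using True by (simp add: add_increasing2)
    next
      case False
      then obtain i0 where i0: "i0 < 2 * r" "\<And>j. j < 2 * r \<Longrightarrow> F j = F i0 \<Longrightarrow> j = i0" using F by (auto simp: NS_def)
      have "cmod (\<Sum>x=0..<int p. \<Prod>i\<in>{..<2 * r}. if i < r then \<phi> (x + F i) else cnj (\<phi> (x + F i)))
          \<le> real (card {..<2 * r}) * sqrt (real p)"
      proof (rule weil_tuple_sum[OF p \<phi>])
        show "F ` {..<2 * r} \<subseteq> {0..<int p}" using F h by (force simp: FF_def PiE_iff)
        show "i0 \<in> {..<2 * r}" using i0 by simp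
      qed (use i0 in auto)
      then show ?thesis using False by (simp add: u_def)
    qed
  qed
  also have "\<dots> = real (card NS) * real p + real (card FF) * (2 * real r * sqrt (real p))"
  proof -
    have "(\<Sum>F\<in>FF. if F \<in> NS then real p else 0) = (\<Sum>F\<in>NS. real p)"
      using finFF by (intro sum.mono_neutral_cong_right) (auto simp: NS_def)
    then show ?thesis by (simp add: sum.distrib)
  qed
  also have "real (card FF) = real h ^ (2 * r)" by (simp add: FF_def card_PiE)
  also have "real (card NS) * real p \<le> real (r ^ (2 * r)) * real h ^ r * real p"
  proof (intro mult_right_mono)
    have "card NS \<le> r ^ (2 * r) * card {1..int h} ^ r"
      unfolding NS_def FF_def using h by (intro card_no_singleton_le) auto
    then have "real (card NS) \<le> real (r ^ (2 * r) * h ^ r)" by (simp only: of_nat_le_iff) simp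
    then show "real (card NS) \<le> real (r ^ (2 * r)) * real h ^ r" by simp
  qed auto
  finally show ?thesis by (simp add: W_def)
qed

lemma convex_on_power: "convex_on {0::real..} (\<lambda>x. x ^ n)"
  by (cases "even n") (auto intro: convex_on_subset[OF convex_power_even] convex_power_odd)

text \<open>Hoelder's inequality in two steps: Jensen with weights \<open>\<nu>\<close> and exponent
  \<open>r\<close>, then Cauchy-Schwarz.\<close>

lemma weighted_power_sum_le:
  fixes \<nu> w :: "'a \<Rightarrow> real"
  assumes fin: "finite Xs" and nn: "\<And>x. x \<in> Xs \<Longrightarrow> \<nu> x \<ge> 0" "\<And>x. x \<in> Xs \<Longrightarrow> w x \<ge> 0" and r: "r > 0"
  shows "(\<Sum>x\<in>Xs. \<nu> x * w x) ^ (2 * r) \<le>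
    (\<Sum>x\<in>Xs. \<nu> x) ^ (2 * r - 2) * (\<Sum>x\<in>Xs. (\<nu> x)\<^sup>2) * (\<Sum>x\<in>Xs. w x ^ (2 * r))"
proof (cases "(\<Sum>x\<in>Xs. \<nu> x) = 0")
  case True
  then have "\<forall>x\<in>Xs. \<nu> x = 0" using fin nn by (simp add: sum_nonneg_eq_0_iff)
  then have "(\<Sum>x\<in>Xs. \<nu> x * w x) = 0" by simp
  then have z: "(\<Sum>x\<in>Xs. \<nu> x * w x) ^ (2 * r) = 0" using r by (simp only: zero_power mult_pos_pos zero_less_numeral)
  show ?thesis unfolding z using nn by (intro mult_nonneg_nonneg sum_nonneg zero_le_power) auto
next
  case False
  define s where "s = (\<Sum>x\<in>Xs. \<nu> x)"
  have s0: "s > 0" using False nn by (simp add: s_def less_le sum_nonneg)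
  have ne: "Xs \<noteq> {}" using False by auto
  have "(\<Sum>x\<in>Xs. (\<nu> x / s) *\<^sub>R w x) ^ r \<le> (\<Sum>x\<in>Xs. (\<nu> x / s) * w x ^ r)"
  proof (rule convex_on_sum[OF fin ne convex_on_power])
    show "(\<Sum>x\<in>Xs. \<nu> x / s) = 1" using s0 by (simp add: s_def flip: sum_divide_distrib)
  qed (use nn s0 in auto)
  then have J: "((\<Sum>x\<in>Xs. \<nu> x * w x) / s) ^ r \<le> (\<Sum>x\<in>Xs. \<nu> x * w x ^ r) / s"
    by (simp add: sum_divide_distrib)
  have nonneg: "0 \<le> (\<Sum>x\<in>Xs. \<nu> x * w x)" "0 \<le> (\<Sum>x\<in>Xs. \<nu> x * w x ^ r)" using nn by (auto intro!: sum_nonneg)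
  have "(((\<Sum>x\<in>Xs. \<nu> x * w x) / s) ^ r)\<^sup>2 \<le> ((\<Sum>x\<in>Xs. \<nu> x * w x ^ r) / s)\<^sup>2"
    using J nonneg s0 by (intro power_mono) auto
  also have "\<dots> = (\<Sum>x\<in>Xs. \<nu> x * w x ^ r)\<^sup>2 / s\<^sup>2" by (simp add: power_divide)
  also have "(\<Sum>x\<in>Xs. \<nu> x * w x ^ r)\<^sup>2 \<le> (\<Sum>x\<in>Xs. (\<nu> x)\<^sup>2) * (\<Sum>x\<in>Xs. (w x ^ r)\<^sup>2)"
    by (rule Cauchy_Schwarz_ineq_sum)
  also have "(((\<Sum>x\<in>Xs. \<nu> x * w x) / s) ^ r)\<^sup>2 = (\<Sum>x\<in>Xs. \<nu> x * w x) ^ (2 * r) / s ^ (2 * r)"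
    by (simp add: power_divide mult.commute flip: power_mult)
  finally have "(\<Sum>x\<in>Xs. \<nu> x * w x) ^ (2 * r) / s ^ (2 * r) \<le> (\<Sum>x\<in>Xs. (\<nu> x)\<^sup>2) * (\<Sum>x\<in>Xs. (w x ^ r)\<^sup>2) / s\<^sup>2"
    using s0 by (simp add: divide_right_mono)
  then have "(\<Sum>x\<in>Xs. \<nu> x * w x) ^ (2 * r) \<le> (\<Sum>x\<in>Xs. (\<nu> x)\<^sup>2) * (\<Sum>x\<in>Xs. (w x ^ r)\<^sup>2) / s\<^sup>2 * s ^ (2 * r)"
    using s0 by (simp add: pos_divide_le_eq)
  also have "s ^ (2 * r) = s ^ (2 * r - 2) * s\<^sup>2" 
  proof -
    have "2 * r = (2 * r - 2) + 2" using r by simp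
    then show ?thesis by (metis power_add)
  qed
  finally show ?thesis using s0 by (simp add: s_def mult_ac flip: power_mult)
qed

section \<open>Burgess' bound\<close>

definition interval_sum :: "nat \<Rightarrow> nat \<Rightarrow> nat \<Rightarrow> complex" where
  "interval_sum p k A = (\<Sum>a=1..A. dchar p k (int a))"

context prime_mod
begin

lemma norm_interval_sum_le: "cmod (interval_sum p k A) \<le> real A"
  unfolding interval_sum_def
  using sum_norm_le[of "{1..A}" "\<lambda>a. dchar p k (int a)" "\<lambda>_. 1"] norm_dchar_le by simp

lemma interval_sum_shift: "cmod (interval_sum p k A - (\<Sum>a=1..A. dchar p k (int a + int t))) \<le> 2 * real t"
proof -
  let ?f = "\<lambda>a. dchar p k (int a)"
  have "(\<Sum>a=1..A. dchar p k (int a + int t)) = (\<Sum>a=1+t..A+t. ?f a)"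
    by (subst sum.shift_bounds_cl_nat_ivl) simp
  moreover have "(\<Sum>a=1..A+t. ?f a) = (\<Sum>a=1..A. ?f a) + (\<Sum>a=A+1..A+t. ?f a)"
    by (rule sum.ub_add_nat) simp
  moreover have "(\<Sum>a=1..t+A. ?f a) = (\<Sum>a=1..t. ?f a) + (\<Sum>a=t+1..t+A. ?f a)"
    by (rule sum.ub_add_nat) simp
  ultimately have "interval_sum p k A - (\<Sum>a=1..A. dchar p k (int a + int t)) =
      (\<Sum>a=1..t. ?f a) - (\<Sum>a=A+1..A+t. ?f a)"
    by (simp add: interval_sum_def add.commute algebra_simps)
  also have "cmod \<dots> \<le> cmod (\<Sum>a=1..t. ?f a) + cmod (\<Sum>a=A+1..A+t. ?f a)" by (rule norm_triangle_ineq4)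
  also have "cmod (\<Sum>a=1..t. ?f a) \<le> real t"
    using sum_norm_le[of "{1..t}" ?f "\<lambda>_. 1"] norm_dchar_le by simp
  also have "cmod (\<Sum>a=A+1..A+t. ?f a) \<le> real t"
    using sum_norm_le[of "{A+1..A+t}" ?f "\<lambda>_. 1"] norm_dchar_le by simp
  finally show ?thesis by simp
qed

text \<open>The interval is shifted by products \<open>u * b\<close>, and
  \<open>\<phi> (a + u * b) = \<phi> u * \<phi> (a / u + b)\<close> turns the average over the
  shifts into short sums \<open>W\<close> at the points \<open>a / u\<close>. The point
  \<open>x\<close> is hit \<open>\<nu> x\<close> times, and \<open>weighted_power_sum_le\<close>
  separates \<open>\<nu>\<close> from the moment of \<open>W\<close>.\<close>

lemma burgess_raw:
  assumes k: "0 < k" "k < p - 1" and V: "0 < V" and A: "0 < A" "A * V < p" and h: "0 < h" "h < p" and r: "r > 0"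
    and D: "\<And>m. 0 < m \<Longrightarrow> m \<le> A * V \<Longrightarrow> real (card {d. d dvd m}) \<le> D"
  shows "\<exists>Z\<ge>0. real V * real h * cmod (interval_sum p k A) \<le> Z + 2 * (real V * real h)\<^sup>2 \<and>
    Z ^ (2 * r) \<le> real (A * V) ^ (2 * r - 1) * D *
      (real (r ^ (2 * r)) * real h ^ r * real p + real h ^ (2 * r) * (2 * real r * sqrt (real p)))"
proof -
  define \<phi> where "\<phi> = dchar p k"
  obtain a0 where a0: "\<phi> a0 \<noteq> 0" "\<phi> a0 \<noteq> 1" using dchar_nontrivial[OF k] by (auto simp: \<phi>_def)
  have dc: "dirichlet_char p \<phi>" unfolding \<phi>_def by (rule dirichlet_char_dchar)
  have Vp: "V < p" using A by (metis le_less_trans mult_le_mono1 mult_1 Suc_leI One_nat_def)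
  have npd: "\<not> int p dvd int u" if "u \<in> {1..V}" for u using that Vp by (auto dest: dvd_imp_le)
  have "\<exists>v. [int u * v = 1] (mod int p)" if "u \<in> {1..V}" for u
    using npd[OF that] prime_int by (intro cong_solve_coprime_int) (simp add: coprime_commute prime_imp_coprime)
  then obtain iv where iv: "\<And>u. u \<in> {1..V} \<Longrightarrow> [int u * iv u = 1] (mod int p)" by metis
  define xo where "xo = (\<lambda>(a, u). int a * iv u mod int p)"
  define Om where "Om = {1..A} \<times> {1..V}"
  define W where "W x = (\<Sum>b=1..int h. \<phi> (x + b))" for x
  define \<nu> where "\<nu> x = real (card {w \<in> Om. xo w = x})" for x
  define Z where "Z = (\<Sum>x=0..<int p. \<nu> x * cmod (W x))"
  have p0: "int p > 0" using p2 by simp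
  have xo_in: "xo ` Om \<subseteq> {0..<int p}" using p0 by (auto simp: xo_def)
  have finOm: "finite Om" by (simp add: Om_def)
  have Zeq: "Z = (\<Sum>w\<in>Om. cmod (W (xo w)))"
  proof -
    have "(\<Sum>w\<in>Om. cmod (W (xo w))) = (\<Sum>x=0..<int p. \<Sum>w\<in>{w \<in> Om. xo w = x}. cmod (W (xo w)))"
      using finOm xo_in by (intro sum.group[symmetric]) auto
    also have "\<dots> = Z" by (simp add: Z_def \<nu>_def)
    finally show ?thesis by simp
  qed
  have Z0: "Z \<ge> 0" unfolding Zeq by (intro sum_nonneg) auto
  have inner: "cmod (\<Sum>b=1..h. \<phi> (int a + int (u * b))) \<le> cmod (W (xo (a, u)))" if u: "u \<in> {1..V}" for a u
  proof -
    have "\<phi> (int a + int (u * b)) = \<phi> (int u) * \<phi> (xo (a, u) + int b)" for b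
    proof -
      have "[int u * (xo (a, u) + int b) = int u * (int a * iv u + int b)] (mod int p)"
        unfolding xo_def by (intro cong_mult cong_add cong_refl) (simp add: unique_euclidean_semiring_class.cong_def)
      also have "int u * (int a * iv u + int b) = int a * (int u * iv u) + int u * int b" by (simp add: algebra_simps)
      also have "[int a * (int u * iv u) + int u * int b = int a * 1 + int u * int b] (mod int p)"
        by (intro cong_mult cong_add cong_refl iv u)
      finally have "\<phi> (int u * (xo (a, u) + int b)) = \<phi> (int a * 1 + int u * int b)"
        unfolding \<phi>_def by (rule dchar_cong)
      then show ?thesis by (simp add: \<phi>_def dchar_mult)
    qed
    then have "(\<Sum>b=1..h. \<phi> (int a + int (u * b))) = \<phi> (int u) * (\<Sum>b=1..h. \<phi> (xo (a, u) + int b))"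
      by (simp only: sum_distrib_left)
    also have "(\<Sum>b=1..h. \<phi> (xo (a, u) + int b)) = W (xo (a, u))"
      unfolding W_def by (rule sum.reindex_bij_witness[of _ nat int]) auto
    finally show ?thesis using norm_dchar_le[of k "int u"]
      by (simp add: norm_mult \<phi>_def mult_left_le_one_le)
  qed
  have "real V * real h * cmod (interval_sum p k A) =
      cmod (\<Sum>u=1..V. \<Sum>b=1..h. interval_sum p k A)" by (simp add: norm_mult)
  also have "\<dots> \<le> cmod (\<Sum>u=1..V. \<Sum>b=1..h. \<Sum>a=1..A. \<phi> (int a + int (u * b))) +
      cmod (\<Sum>u=1..V. \<Sum>b=1..h. interval_sum p k A - (\<Sum>a=1..A. \<phi> (int a + int (u * b))))"
    using norm_triangle_ineq[of "\<Sum>u=1..V. \<Sum>b=1..h. \<Sum>a=1..A. \<phi> (int a + int (u * b))"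
      "\<Sum>u=1..V. \<Sum>b=1..h. interval_sum p k A - (\<Sum>a=1..A. \<phi> (int a + int (u * b)))"]
    by (simp only: sum_subtractf add_diff_eq add_diff_cancel_left')
  also have "cmod (\<Sum>u=1..V. \<Sum>b=1..h. interval_sum p k A - (\<Sum>a=1..A. \<phi> (int a + int (u * b)))) \<le> (\<Sum>u=1..V. \<Sum>b=1..h. 2 * real (V * h))"
  proof (intro sum_norm_le)
    fix u b assume ub: "u \<in> {1..V}" "b \<in> {1..h}"
    have "cmod (interval_sum p k A - (\<Sum>a=1..A. \<phi> (int a + int (u * b)))) \<le> 2 * real (u * b)"
      unfolding \<phi>_def by (rule interval_sum_shift)
    also have "u * b \<le> V * h" using ub by (intro mult_le_mono) auto
    then have "2 * real (u * b) \<le> 2 * real (V * h)" by (simp only: of_nat_le_iff mult_le_cancel_left_pos zero_less_numeral)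
    finally show "cmod (interval_sum p k A - (\<Sum>a=1..A. \<phi> (int a + int (u * b)))) \<le> 2 * real (V * h)" .
  qed
  also have "(\<Sum>u=1..V. \<Sum>b=1..h. 2 * real (V * h)) = 2 * (real V * real h)\<^sup>2" by (simp add: power2_eq_square)
  also have "cmod (\<Sum>u=1..V. \<Sum>b=1..h. \<Sum>a=1..A. \<phi> (int a + int (u * b))) \<le> Z"
  proof -
    have "(\<Sum>u=1..V. \<Sum>b=1..h. \<Sum>a=1..A. \<phi> (int a + int (u * b))) = (\<Sum>u=1..V. \<Sum>a=1..A. \<Sum>b=1..h. \<phi> (int a + int (u * b)))"
      by (intro sum.cong refl sum.swap)
    also have "cmod \<dots> \<le> (\<Sum>u=1..V. \<Sum>a=1..A. cmod (W (xo (a, u))))"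
      by (intro sum_norm_le inner)
    also have "\<dots> = Z" unfolding Zeq Om_def by (subst sum.swap) (simp add: sum.cartesian_product)
    finally show ?thesis .
  qed
  finally have 1: "real V * real h * cmod (interval_sum p k A) \<le> Z + 2 * (real V * real h)\<^sup>2" by simp
  have s1: "(\<Sum>x=0..<int p. \<nu> x) = real (A * V)"
  proof -
    have "(\<Sum>x=0..<int p. \<nu> x) = real (\<Sum>x=0..<int p. \<Sum>w\<in>{w \<in> Om. xo w = x}. 1)" by (simp add: \<nu>_def)
    also have "(\<Sum>x=0..<int p. \<Sum>w\<in>{w \<in> Om. xo w = x}. 1::nat) = card Om"
      using sum.group[of Om "{0..<int p}" xo "\<lambda>_. 1::nat"] finOm xo_in by simp
    finally show ?thesis by (simp add: Om_def)
  qed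
  have s2: "(\<Sum>x=0..<int p. (\<nu> x)\<^sup>2) \<le> real (A * V) * D"
  proof -
    have "(\<Sum>x=0..<int p. (\<nu> x)\<^sup>2) = (\<Sum>x=0..<int p. \<Sum>w\<in>{w \<in> Om. xo w = x}. \<nu> x)"
      by (simp add: \<nu>_def power2_eq_square)
    also have "\<dots> = (\<Sum>x=0..<int p. \<Sum>w\<in>{w \<in> Om. xo w = x}. \<nu> (xo w))" by (intro sum.cong refl) auto
    also have "\<dots> = (\<Sum>w\<in>Om. \<nu> (xo w))" using finOm xo_in by (intro sum.group) auto
    also have "\<dots> = real (card (Sigma Om (\<lambda>w. {w' \<in> Om. xo w' = xo w})))"
      using finOm by (subst card_SigmaI) (auto simp: \<nu>_def)
    \<comment> \<open>As \<open>A * V < p\<close>, the congruence \<open>a / u = a' / u'\<close> is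
      the equation \<open>a * u' = a' * u\<close> of integers. So \<open>a'\<close> divides
      \<open>a * u'\<close>, and \<open>a\<close>, \<open>u'\<close>, \<open>a'\<close> determine
      \<open>u\<close>.\<close>
    also have "card (Sigma Om (\<lambda>w. {w' \<in> Om. xo w' = xo w})) \<le>
        card (Sigma Om (\<lambda>w. {d. d dvd fst w * snd w}))"
    proof (rule card_inj_on_le[where f = "\<lambda>((a, u), (a', u')). ((a, u'), a')"])
      have eq: "a * u' = a' * u" if "(a, u) \<in> Om" "(a', u') \<in> Om" "xo (a', u') = xo (a, u)" for a u a' u'
      proof -
        have uu: "u \<in> {1..V}" "u' \<in> {1..V}" using that by (auto simp: Om_def)
        have c: "[int a * iv u = int a' * iv u'] (mod int p)" using that(3) by (simp add: xo_def unique_euclidean_semiring_class.cong_def)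
        have "[int (a * u') = (int a * int u') * (int u * iv u)] (mod int p)"
          using cong_mult[OF cong_refl iv[OF uu(1)], of "int a * int u'"] by (simp add: cong_sym)
        also have "(int a * int u') * (int u * iv u) = (int a * iv u) * (int u * int u')" by simp
        also have "[\<dots> = (int a' * iv u') * (int u * int u')] (mod int p)" by (intro cong_mult c cong_refl)
        also have "(int a' * iv u') * (int u * int u') = (int a' * int u) * (int u' * iv u')" by simp
        also have "[\<dots> = (int a' * int u) * 1] (mod int p)" by (intro cong_mult cong_refl iv uu)
        finally have "[a * u' = a' * u] (mod p)" by (metis cong_int_iff mult.right_neutral of_nat_mult)
        moreover have "a * u' \<le> A * V" "a' * u \<le> A * V" using that by (auto simp: Om_def intro!: mult_le_mono)
        ultimately show ?thesis using A by (metis cong_less_modulus_unique_nat le_less_trans)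
      qed
      show "inj_on (\<lambda>((a, u), (a', u')). ((a, u'), a')) (Sigma Om (\<lambda>w. {w' \<in> Om. xo w' = xo w}))"
      proof (rule inj_onI)
        fix z1 z2
        assume z: "z1 \<in> Sigma Om (\<lambda>w. {w' \<in> Om. xo w' = xo w})" "z2 \<in> Sigma Om (\<lambda>w. {w' \<in> Om. xo w' = xo w})"
          "(\<lambda>((a, u), (a', u')). ((a, u'), a')) z1 = (\<lambda>((a, u), (a', u')). ((a, u'), a')) z2"
        obtain a u a' u' where z1: "z1 = ((a, u), (a', u'))" by (metis prod.exhaust)
        obtain b v b' v' where z2: "z2 = ((b, v), (b', v'))" by (metis prod.exhaust)
        have bb: "b = a" "b' = a'" "v' = u'" using z(3) by (auto simp: z1 z2)
        have "a * u' = a' * u" using z(1) by (intro eq) (auto simp: z1)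
        moreover have "a * u' = a' * v" using z(2) by (intro eq) (auto simp: z2 bb)
        moreover have "a' > 0" using z(1) by (auto simp: z1 Om_def)
        ultimately show "z1 = z2" by (simp add: z1 z2 bb)
      qed
      show "(\<lambda>((a, u), (a', u')). ((a, u'), a')) ` Sigma Om (\<lambda>w. {w' \<in> Om. xo w' = xo w}) \<subseteq> Sigma Om (\<lambda>w. {d. d dvd fst w * snd w})"
      proof
        fix y assume "y \<in> (\<lambda>((a, u), (a', u')). ((a, u'), a')) ` Sigma Om (\<lambda>w. {w' \<in> Om. xo w' = xo w})"
        then obtain a u a' u' where y: "y = ((a, u'), a')" and w: "(a, u) \<in> Om" "(a', u') \<in> Om" "xo (a', u') = xo (a, u)"
          by auto
        show "y \<in> Sigma Om (\<lambda>w. {d. d dvd fst w * snd w})" using eq[OF w] w unfolding y by (auto simp: Om_def)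
      qed
      show "finite (Sigma Om (\<lambda>w. {d. d dvd fst w * snd w}))"
        using finOm by (intro finite_SigmaI) (auto simp: Om_def)
    qed
    also have "real (card (Sigma Om (\<lambda>w. {d. d dvd fst w * snd w}))) = (\<Sum>w\<in>Om. real (card {d. d dvd fst w * snd w}))"
      using finOm by (subst card_SigmaI) (auto simp: Om_def)
    also have "\<dots> \<le> (\<Sum>w\<in>Om. D)"
      by (intro sum_mono D) (auto simp: Om_def intro!: mult_le_mono)
    also have "\<dots> = real (A * V) * D" by (simp add: Om_def)
    finally show ?thesis by simp
  qed
  have D0: "0 \<le> D" using D[of 1] A V by (simp add: Suc_leI)
  have "Z ^ (2 * r) \<le> (\<Sum>x=0..<int p. \<nu> x) ^ (2 * r - 2) * (\<Sum>x=0..<int p. (\<nu> x)\<^sup>2) * (\<Sum>x=0..<int p. cmod (W x) ^ (2 * r))"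
    unfolding Z_def by (rule weighted_power_sum_le) (auto simp: \<nu>_def r)
  also have "\<dots> \<le> real (A * V) ^ (2 * r - 2) * (real (A * V) * D) *
      (real (r ^ (2 * r)) * real h ^ r * real p + real h ^ (2 * r) * (2 * real r * sqrt (real p)))"
    unfolding s1 W_def
    by (intro mult_mono mult_left_mono s2 short_sum_moment[OF p dc a0 h r] mult_nonneg_nonneg sum_nonneg)
       (auto simp: D0)
  also have "real (A * V) ^ (2 * r - 2) * (real (A * V) * D) = real (A * V) ^ (2 * r - 1) * D"
  proof -
    have "2 * r - 1 = Suc (2 * r - 2)" using r by simp
    then show ?thesis by simp
  qed
  finally show ?thesis using Z0 1 by blast
qed

end

lemma nat_floor_ge_half: "1 \<le> x \<Longrightarrow> x / 2 \<le> real (nat \<lfloor>x\<rfloor>)" for x :: real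
proof -
  assume "1 \<le> x"
  then have "1 \<le> \<lfloor>x\<rfloor>" by simp
  then have "(1::real) \<le> of_int \<lfloor>x\<rfloor>" "real (nat \<lfloor>x\<rfloor>) = of_int \<lfloor>x\<rfloor>" by simp_all
  moreover have "x < of_int \<lfloor>x\<rfloor> + 1" by linarith
  ultimately show ?thesis by linarith
qed

lemma nat_ceiling_le_double: "1 \<le> x \<Longrightarrow> real (nat \<lceil>x\<rceil>) \<le> 2 * x" for x :: real
  by linarith

text \<open>The two terms of the moment balance at \<open>h ^ r = sqrt p\<close>, hence
  \<open>h\<close> is about \<open>p powr \<theta>\<close>. \<open>V\<close> is taken such that the
  total shift \<open>V * h\<close> stays below \<open>A\<close> by a factor of about
  \<open>p powr \<theta>\<close>, and the upper bound on \<open>A\<close> keeps \<open>A * V\<close>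
  below \<open>p\<close>.\<close>

theorem burgess_bound:
  fixes \<epsilon> :: real
  assumes \<epsilon>: "0 < \<epsilon>" "\<epsilon> \<le> 1 / 8"
  shows "\<exists>\<delta>>0. \<exists>C>0. \<forall>p k A. prime p \<longrightarrow> 0 < k \<longrightarrow> k < p - 1 \<longrightarrow> real p powr (1 / 4 + \<epsilon>) \<le> real A \<longrightarrow>
    real A \<le> 2 * real p powr (1 / 4 + \<epsilon>) \<longrightarrow> cmod (interval_sum p k A) \<le> C * real A * real p powr (- \<delta>)"
proof -
  \<comment> \<open>Large enough for \<open>\<theta> \<le> \<epsilon> / 8\<close>: the loss
    \<open>2 * \<theta>\<close> in \<open>V\<close> and the \<open>\<epsilon> / 2\<close> of the
    divisor bound then leave a saving of \<open>p powr (- \<epsilon>)\<close> in the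
    \<open>2 * r\<close>-th power.\<close>
  define r where "r = nat \<lceil>4 / \<epsilon>\<rceil>"
  have r_ge: "real r \<ge> 4 / \<epsilon>" unfolding r_def by linarith
  have rpos: "real r > 0" using r_ge \<epsilon> by (metis divide_pos_pos less_le_trans zero_less_numeral)
  then have r0: "r > 0" by simp
  define \<theta> where "\<theta> = 1 / (2 * real r)"
  have th0: "\<theta> > 0" using rpos by (simp add: \<theta>_def)
  have th8: "\<theta> \<le> \<epsilon> / 8"
  proof -
    have "4 \<le> \<epsilon> * real r" using r_ge \<epsilon> by (simp add: field_simps)
    then show ?thesis using rpos unfolding \<theta>_def by (simp add: field_simps)
  qed
  obtain Cd where Cd: "Cd \<ge> 1" "\<And>n::nat. n > 0 \<Longrightarrow> real (card {d. d dvd n}) \<le> Cd * real n powr (\<epsilon> / 2)"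
    using divisor_bound[of "\<epsilon> / 2"] \<epsilon> by auto
  define cr where "cr = real (r ^ (2 * r)) + 2 * real r"
  have cr1: "cr \<ge> 1" using r0 unfolding cr_def by (simp add: add_increasing)
  define c' where "c' = 2 * Cd * cr"
  have c'1: "c' \<ge> 1" using Cd(1) cr1 unfolding c'_def
    by (metis mult_mono one_le_numeral zero_le_one mult_1 order_trans zero_le_numeral mult_le_one mult_ge1_I)
  \<comment> \<open>The \<open>2 * r\<close>-th root of \<open>p powr (- \<epsilon>)\<close> is
    \<open>p powr (- \<epsilon> * \<theta>)\<close>.\<close>
  define \<delta> where "\<delta> = \<epsilon> * \<theta>"
  have d0: "\<delta> > 0" using \<epsilon> th0 by (simp add: \<delta>_def)
  have dth: "\<delta> \<le> \<theta>" using \<epsilon> th0 by (simp add: \<delta>_def)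
  show ?thesis
  proof (rule exI[of _ \<delta>], rule conjI, rule d0, rule exI[of _ "c' + 16"], intro conjI allI impI)
    show "c' + 16 > 0" using c'1 by simp
    fix p k A :: nat
    assume p: "prime p" and k: "0 < k" "k < p - 1" and A: "real p powr (1 / 4 + \<epsilon>) \<le> real A" "real A \<le> 2 * real p powr (1 / 4 + \<epsilon>)"
    interpret prime_mod p by unfold_locales (rule p)
    define P where "P = real p"
    have P1: "P \<ge> 1" using p2 by (simp add: P_def)
    have P0: "P > 0" using P1 by simp
    have pw1: "1 \<le> P powr a" if "a \<ge> 0" for a using P1 that by (simp add: ge_one_powr_ge_zero)
    have A0: "real A \<ge> 1" using A(1) pw1[of "1 / 4 + \<epsilon>"] \<epsilon> by (simp add: P_def)
    \<comment> \<open>For \<open>p \<le> 16\<close> the trivial bound is enough, because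
      \<open>p powr \<delta> \<le> 16\<close>. Beyond that, \<open>2 * p powr (3 / 4) < p\<close>
      guarantees \<open>A * V < p\<close> and \<open>h < p\<close>.\<close>
    show "cmod (interval_sum p k A) \<le> (c' + 16) * real A * real p powr (- \<delta>)"
    proof (cases "p \<le> 16")
      case True
      have "1 \<le> 16 * P powr (- \<delta>)"
      proof -
        have "P powr \<delta> \<le> P powr 1" using P1 dth th8 \<epsilon> by (intro powr_mono) auto
        also have "\<dots> \<le> 16" using True P0 by (simp add: P_def)
        finally show ?thesis using P0 by (simp add: powr_minus field_simps)
      qed
      also have "\<dots> \<le> (c' + 16) * P powr (- \<delta>)" using c'1 by (intro mult_right_mono) auto
      finally have "real A * 1 \<le> real A * ((c' + 16) * P powr (- \<delta>))" by (intro mult_left_mono) auto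
      then show ?thesis using norm_interval_sum_le[of k A] by (simp add: P_def mult_ac)
    next
      case False
      then have P16: "P > 16" by (simp add: P_def)
      define V where "V = nat \<lfloor>P powr (1 / 4 + \<epsilon> - 2 * \<theta>)\<rfloor>"
      define h where "h = nat \<lceil>P powr \<theta>\<rceil>"
      have eV: "1 / 4 + \<epsilon> - 2 * \<theta> \<ge> 0" using th8 \<epsilon> by simp
      have V_le: "real V \<le> P powr (1 / 4 + \<epsilon> - 2 * \<theta>)" unfolding V_def using P0 by simp
      have V_ge: "P powr (1 / 4 + \<epsilon> - 2 * \<theta>) / 2 \<le> real V" unfolding V_def by (intro nat_floor_ge_half pw1 eV)
      have V0: "V > 0" using V_ge pw1[OF eV] by (cases V) auto
      have h_ge: "P powr \<theta> \<le> real h" unfolding h_def by linarith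
      have h_le: "real h \<le> 2 * P powr \<theta>" unfolding h_def using pw1[of \<theta>] th0 by (intro nat_ceiling_le_double) auto
      have h1: "real h \<ge> 1" using h_ge pw1[of \<theta>] th0 by simp
      have Pq: "2 * P powr (3 / 4) < P"
      proof -
        have "(16::real) powr (1 / 4) < P powr (1 / 4)" using P16 by (intro powr_less_mono2) auto
        moreover have "(16::real) powr (1 / 4) = 2"
        proof -
          have "(16::real) = 2 powr 4" by simp
          then have "(16::real) powr (1 / 4) = 2 powr (4 * (1 / 4))" by (simp only: powr_powr)
          then show ?thesis by simp
        qed
        ultimately have "2 * P powr (3 / 4) < P powr (1 / 4) * P powr (3 / 4)" using P0 by simp
        also have "\<dots> = P" using P0 by (simp flip: powr_add)
        finally show ?thesis .
      qed
      have AV: "real A * real V \<le> 2 * P powr (1 / 4 + \<epsilon>) * P powr (1 / 4 + \<epsilon> - 2 * \<theta>)"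
        using A(2) V_le by (intro mult_mono) (auto simp: P_def)
      also have "\<dots> = 2 * P powr (1 / 2 + 2 * \<epsilon> - 2 * \<theta>)" by (simp add: algebra_simps flip: powr_add)
      also have "\<dots> \<le> 2 * P powr (3 / 4)" using P1 \<epsilon> th0 by (intro mult_left_mono powr_mono) auto
      finally have "real (A * V) < P" using Pq by simp
      then have AVp: "A * V < p" unfolding P_def of_nat_less_iff .
      have hp: "h < p"
      proof -
        have "2 * P powr \<theta> \<le> 2 * P powr (3 / 4)" using P1 th8 \<epsilon> by (intro mult_left_mono powr_mono) auto
        then have "real h < real p" using h_le Pq by (simp add: P_def)
        then show ?thesis by simp
      qed
      define D where "D = Cd * P powr (\<epsilon> / 2)"
      have D: "real (card {d. d dvd m}) \<le> D" if "0 < m" "m \<le> A * V" for m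
      proof -
        have "real m powr (\<epsilon> / 2) \<le> P powr (\<epsilon> / 2)" using that AVp \<epsilon> by (intro powr_mono2) (auto simp: P_def)
        then have "Cd * real m powr (\<epsilon> / 2) \<le> D" using Cd(1) unfolding D_def by (intro mult_left_mono) auto
        then show ?thesis using Cd(2)[OF that(1)] by linarith
      qed
      obtain Z where Z: "Z \<ge> 0" "real V * real h * cmod (interval_sum p k A) \<le> Z + 2 * (real V * real h)\<^sup>2"
        "Z ^ (2 * r) \<le> real (A * V) ^ (2 * r - 1) * D *
          (real (r ^ (2 * r)) * real h ^ r * real p + real h ^ (2 * r) * (2 * real r * sqrt (real p)))"
        using burgess_raw[OF k V0 _ AVp _ hp r0 D] A0 h1 by auto
      define Q where "Q = real (A * V)"
      have Q0: "Q > 0" using A0 V0 by (simp add: Q_def)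
      have mom: "real (r ^ (2 * r)) * real h ^ r * real p + real h ^ (2 * r) * (2 * real r * sqrt (real p)) \<le> cr * (real h ^ (2 * r) * sqrt P)"
      proof -
        have "sqrt P \<le> real h ^ r"
        proof -
          have "(P powr \<theta>) powr real r \<le> real h powr real r" using h_ge by (intro powr_mono2) auto
          moreover have "(P powr \<theta>) powr real r = sqrt P" using rpos P0 by (simp add: powr_powr \<theta>_def powr_half_sqrt)
          moreover have "real h powr real r = real h ^ r" using h1 by (simp add: powr_realpow)
          ultimately show ?thesis by simp
        qed
        then have "real h ^ r * (sqrt P * sqrt P) \<le> real h ^ r * (real h ^ r * sqrt P)"
          using P0 by (intro mult_left_mono mult_right_mono) auto
        then have "real h ^ r * real p \<le> real h ^ (2 * r) * sqrt P"
          using P0 by (simp add: P_def mult_2 power_add)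
        then have "real (r ^ (2 * r)) * (real h ^ r * real p) \<le> real (r ^ (2 * r)) * (real h ^ (2 * r) * sqrt P)"
          by (intro mult_left_mono) auto
        then show ?thesis by (simp add: cr_def P_def algebra_simps)
      qed
      have Q_ge: "P powr (1 / 2 + 2 * \<epsilon> - 2 * \<theta>) / 2 \<le> Q"
      proof -
        have "P powr (1 / 4 + \<epsilon>) * (P powr (1 / 4 + \<epsilon> - 2 * \<theta>) / 2) \<le> real A * real V"
          using A(1) V_ge by (intro mult_mono) (auto simp: P_def)
        moreover have "P powr (1 / 4 + \<epsilon>) * (P powr (1 / 4 + \<epsilon> - 2 * \<theta>) / 2) = P powr (1 / 2 + 2 * \<epsilon> - 2 * \<theta>) / 2"
          by (simp add: algebra_simps flip: powr_add)
        ultimately show ?thesis by (simp add: Q_def)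
      qed
      have "D * cr * sqrt P \<le> Q * (c' * P powr (- \<epsilon>))"
      proof -
        have "D * cr * sqrt P = c' * (P powr (1 / 2 + \<epsilon> / 2) / 2)"
          by (simp add: D_def c'_def powr_half_sqrt[symmetric] P0 powr_add less_imp_le)
        also have "P powr (1 / 2 + \<epsilon> / 2) \<le> P powr (1 / 2 + \<epsilon> - 2 * \<theta>)" using P1 th8 \<epsilon> by (intro powr_mono) auto
        also have "P powr (1 / 2 + \<epsilon> - 2 * \<theta>) = P powr (1 / 2 + 2 * \<epsilon> - 2 * \<theta>) * P powr (- \<epsilon>)"
        proof -
          have "1 / 2 + \<epsilon> - 2 * \<theta> = (1 / 2 + 2 * \<epsilon> - 2 * \<theta>) + (- \<epsilon>)" by simp
          then show ?thesis by (simp only: powr_add)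
        qed
        finally have "D * cr * sqrt P \<le> c' * (P powr (1 / 2 + 2 * \<epsilon> - 2 * \<theta>) * P powr (- \<epsilon>) / 2)"
          using c'1 by simp
        also have "\<dots> = (P powr (1 / 2 + 2 * \<epsilon> - 2 * \<theta>) / 2) * (c' * P powr (- \<epsilon>))" by simp
        also have "\<dots> \<le> Q * (c' * P powr (- \<epsilon>))" using Q_ge c'1 by (intro mult_right_mono) auto
        finally show ?thesis .
      qed
      then have main: "Q ^ (2 * r - 1) * real h ^ (2 * r) * (D * cr * sqrt P) \<le> Q ^ (2 * r - 1) * real h ^ (2 * r) * (Q * (c' * P powr (- \<epsilon>)))"
        using Q0 by (intro mult_left_mono) auto
      have "Z ^ (2 * r) \<le> Q ^ (2 * r - 1) * D * (cr * (real h ^ (2 * r) * sqrt P))"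
      proof -
        have "0 \<le> Q ^ (2 * r - 1) * D" using Q0 Cd(1) by (simp add: D_def)
        then show ?thesis using order_trans[OF Z(3)[folded Q_def] mult_left_mono[OF mom]] by blast
      qed
      also have "\<dots> = Q ^ (2 * r - 1) * real h ^ (2 * r) * (D * cr * sqrt P)" by simp
      also note main
      also have "Q ^ (2 * r - 1) * real h ^ (2 * r) * (Q * (c' * P powr (- \<epsilon>))) = (Q * real h) ^ (2 * r) * (c' * P powr (- \<epsilon>))"
      proof -
        have "2 * r = Suc (2 * r - 1)" using r0 by simp
        then have "Q ^ (2 * r) = Q * Q ^ (2 * r - 1)" by (metis power_Suc)
        then show ?thesis by (simp add: power_mult_distrib)
      qed
      also have "\<dots> \<le> (Q * real h) ^ (2 * r) * (c' * P powr (- \<delta>)) ^ (2 * r)"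
      proof (intro mult_left_mono)
        have "(P powr (- \<delta>)) ^ (2 * r) = P powr (- \<delta> * real (2 * r))" using P0 by (simp add: powr_powr flip: powr_realpow)
        also have "- \<delta> * real (2 * r) = - \<epsilon>" using rpos by (simp add: \<delta>_def \<theta>_def)
        finally have "(c' * P powr (- \<delta>)) ^ (2 * r) = c' ^ (2 * r) * P powr (- \<epsilon>)" by (simp add: power_mult_distrib)
        moreover have "c' ^ 1 \<le> c' ^ (2 * r)" using c'1 r0 by (intro power_increasing) auto
        ultimately show "c' * P powr (- \<epsilon>) \<le> (c' * P powr (- \<delta>)) ^ (2 * r)" by (simp add: mult_right_mono)
      qed (use Q0 in auto)
      also have "\<dots> = (Q * real h * (c' * P powr (- \<delta>))) ^ (2 * r)" by (simp add: power_mult_distrib)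
      finally have "Z \<le> Q * real h * (c' * P powr (- \<delta>))"
        using r0 Q0 c'1 by (intro power_le_imp_le_base[of Z "2 * r - 1"]) (auto simp: Suc_diff_Suc)
      then have "real V * real h * cmod (interval_sum p k A) \<le> real V * real h * (real A * (c' * P powr (- \<delta>)) + 2 * (real V * real h))"
        using Z(2) by (simp add: Q_def power2_eq_square algebra_simps)
      then have "cmod (interval_sum p k A) \<le> real A * (c' * P powr (- \<delta>)) + 2 * (real V * real h)"
        using V0 h1 by (simp add: mult_le_cancel_left_pos)
      also have "real V * real h \<le> 2 * (real A * P powr (- \<delta>))"
      proof -
        have "real V * real h \<le> P powr (1 / 4 + \<epsilon> - 2 * \<theta>) * (2 * P powr \<theta>)" using V_le h_le by (intro mult_mono) auto
        also have "\<dots> = 2 * (P powr (1 / 4 + \<epsilon>) * P powr (- \<theta>))" by (simp flip: powr_add)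
        also have "\<dots> \<le> 2 * (real A * P powr (- \<delta>))"
          using A(1) P1 dth by (intro mult_left_mono mult_mono powr_mono) (auto simp: P_def)
        finally show ?thesis .
      qed
      finally have "cmod (interval_sum p k A) \<le> (c' + 4) * real A * P powr (- \<delta>)" by (simp add: algebra_simps)
      also have "\<dots> \<le> (c' + 16) * real A * P powr (- \<delta>)" by (intro mult_right_mono) auto
      finally show ?thesis by (simp add: P_def)
    qed
  qed
qed

section \<open>Multiplicative energy of boxes\<close>

definition tuples :: "nat list \<Rightarrow> nat list set" where
  "tuples v = {d. list_all2 (\<lambda>x D. x \<in> {1..D}) d v}"

definition rep_count :: "nat list \<Rightarrow> nat \<Rightarrow> nat" where
  "rep_count v x = card {d \<in> tuples v. prod_list d = x}"

lemma tuples_Nil [simp]: "tuples [] = {[]}"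
  by (auto simp: tuples_def)

lemma tuples_Cons: "tuples (D # v) = (\<lambda>(x, d). x # d) ` ({1..D} \<times> tuples v)"
  by (auto simp: tuples_def list_all2_Cons2 image_iff)

lemma finite_tuples [simp]: "finite (tuples v)"
  by (induction v) (auto simp: tuples_Cons)

lemma tuples_length: "d \<in> tuples v \<Longrightarrow> length d = length v"
  by (auto simp: tuples_def dest: list_all2_lengthD)

lemma tuples_prod: "d \<in> tuples v \<Longrightarrow> 0 < prod_list d \<and> prod_list d \<le> prod_list v"
proof (induction v arbitrary: d)
  case (Cons D v)
  then obtain x e where d: "d = x # e" "x \<in> {1..D}" "e \<in> tuples v" by (auto simp: tuples_Cons)
  then show ?case using Cons.IH[of e] by (auto intro!: mult_le_mono)
qed auto

lemma sum_tuples_Cons: "(\<Sum>d\<in>tuples (D # v). f d) = (\<Sum>x=1..D. \<Sum>d\<in>tuples v. f (x # d))"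
proof -
  have "inj_on (\<lambda>(x, d). x # d) ({1..D} \<times> tuples v)" by (auto simp: inj_on_def)
  then show ?thesis by (simp add: tuples_Cons sum.reindex sum.cartesian_product split_def)
qed

lemma mem_dvd_prod_list: "x \<in> set d \<Longrightarrow> x dvd prod_list d" for x :: nat
  by (induction d) auto

lemma rep_count_le_divisors:
  assumes "x > 0"
  shows "rep_count v x \<le> card {d. d dvd x} ^ length v"
proof -
  have "{d \<in> tuples v. prod_list d = x} \<subseteq> {d. set d \<subseteq> {d. d dvd x} \<and> length d = length v}"
    using tuples_length mem_dvd_prod_list by auto
  then have "rep_count v x \<le> card {d. set d \<subseteq> {d. d dvd x} \<and> length d = length v}"
    unfolding rep_count_def using assms by (intro card_mono finite_lists_length_eq) auto
  also have "\<dots> = card {d. d dvd x} ^ length v" using assms by (intro card_lists_length_eq) auto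
  finally show ?thesis .
qed

text \<open>The coordinates of a short lattice vector divide products of box entries; this splits
  them again into factors along the box.\<close>

lemma dvd_prod_list_factor:
  "x dvd prod_list d \<Longrightarrow> \<exists>f. list_all2 (dvd) f d \<and> prod_list f = x" for x :: nat
proof (induction d arbitrary: x)
  case Nil
  then show ?case by (intro exI[of _ "[]"]) auto
next
  case (Cons y d)
  then have "x dvd y * prod_list d" by simp
  then obtain a b where ab: "x = a * b" "a dvd y" "b dvd prod_list d" by (rule division_decomp[THEN exE]) blast
  obtain f where "list_all2 (dvd) f d" "prod_list f = b" using Cons.IH[OF ab(3)] by auto
  then show ?case using ab by (intro exI[of _ "a # f"]) auto
qed

context prime_mod
begin

section \<open>The lattice of solutions of \<open>g * x = g' * y\<close>\<close>

definition solutions :: "nat \<Rightarrow> int \<Rightarrow> int \<Rightarrow> (nat \<times> nat) set" where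
  "solutions K g g' = {(x, y) \<in> {1..K} \<times> {1..K}. [g * int x = g' * int y] (mod int p)}"

lemma finite_solutions [simp]: "finite (solutions K g g')"
  by (rule finite_subset[of _ "{1..K} \<times> {1..K}"]) (auto simp: solutions_def)

text \<open>\<open>M\<close> is the least maximum norm of a nonzero vector \<open>(x0, y0)\<close>
  of the lattice \<open>L\<close>. For a solution \<open>(x, y)\<close> the determinant
  \<open>x * y0 - y * x0\<close> is a multiple of \<open>p\<close> of size at most
  \<open>2 * K * M\<close>. If this is below \<open>p\<close>, every solution is a multiple of the
  short vector. Otherwise \<open>O(K * M / p)\<close> lines parallel to it carry
  \<open>O(K / M)\<close> solutions each.\<close>

lemma lattice_count:
  assumes g: "\<not> int p dvd g" "\<not> int p dvd g'"
  shows "\<exists>M>0. (card (solutions K g g') * M \<le> K \<and>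
      (solutions K g g' \<noteq> {} \<longrightarrow> (\<exists>x0 y0. 0 < x0 \<and> 0 < y0 \<and> max x0 y0 = M \<and> [g * int x0 = g' * int y0] (mod int p) \<and>
        (\<forall>(x, y)\<in>solutions K g g'. x0 dvd x \<and> y0 dvd y)))) \<or>
    card (solutions K g g') * p \<le> 18 * K\<^sup>2"
proof -
  define L where "L = {(x, y). int p dvd g * x - g' * y}"
  have Ldiff: "(x - x', y - y') \<in> L" if "(x, y) \<in> L" "(x', y') \<in> L" for x y x' y'
  proof -
    have "int p dvd (g * x - g' * y) - (g * x' - g' * y')" using that unfolding L_def by (intro dvd_diff[of "int p" "g * x - g' * y" "g * x' - g' * y'"]) simp_all
    also have "(g * x - g' * y) - (g * x' - g' * y') = g * (x - x') - g' * (y - y')" by (simp add: algebra_simps)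
    finally show ?thesis by (simp add: L_def)
  qed
  define ok where "ok m \<longleftrightarrow> m > 0 \<and> (\<exists>x y. (x, y) \<in> L \<and> max \<bar>x\<bar> \<bar>y\<bar> = int m)" for m
  \<comment> \<open>The vector \<open>(p, p)\<close> lies in the lattice, so the minimum
    exists.\<close>
  have "ok p" unfolding ok_def using p2 by (auto intro!: exI[of _ "int p"] simp: L_def)
  define M where "M = (LEAST m. ok m)"
  have okM: "ok M" unfolding M_def using \<open>ok p\<close> by (rule LeastI)
  then obtain x0 y0 where xy0: "(x0, y0) \<in> L" "max \<bar>x0\<bar> \<bar>y0\<bar> = int M" and M0: "M > 0" by (auto simp: ok_def)
  have minM: "int M \<le> max \<bar>x\<bar> \<bar>y\<bar>" if "(x, y) \<in> L" "x \<noteq> 0 \<or> y \<noteq> 0" for x y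
  proof -
    define m where "m = nat (max \<bar>x\<bar> \<bar>y\<bar>)"
    have "0 < m" "max \<bar>x\<bar> \<bar>y\<bar> = int m" using that(2) by (auto simp: m_def)
    then have "ok m" unfolding ok_def using that(1) by blast
    then have "M \<le> m" unfolding M_def by (rule Least_le)
    then show ?thesis by (simp add: m_def)
  qed
  \<comment> \<open>Two points of an \<open>M\<close> by \<open>M\<close> square with the same
    residue would differ by a lattice vector of norm below \<open>M\<close>.\<close>
  have MM: "M\<^sup>2 \<le> p"
  proof (rule ccontr)
    assume "\<not> M\<^sup>2 \<le> p"
    define B where "B = {0..<int M} \<times> {0..<int M}"
    define f where "f = (\<lambda>(x, y). (g * x - g' * y) mod int p)"
    have "f ` B \<subseteq> {0..<int p}" using p2 by (auto simp: f_def)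
    then have "card (f ` B) \<le> p" using card_mono[of "{0..<int p}" "f ` B"] by simp
    also have "\<dots> < card B" using \<open>\<not> M\<^sup>2 \<le> p\<close> by (simp add: B_def power2_eq_square)
    finally have "\<not> inj_on f B" using card_image[of f B] by auto
    then obtain u w where uw: "u \<in> B" "w \<in> B" "f u = f w" "u \<noteq> w" by (auto simp: inj_on_def)
    obtain x y x' y' where xy: "u = (x, y)" "w = (x', y')" by (cases u, cases w)
    have "int p dvd (g * x - g' * y) - (g * x' - g' * y')" using uw(3) by (simp add: xy f_def mod_eq_dvd_iff)
    also have "(g * x - g' * y) - (g * x' - g' * y') = g * (x - x') - g' * (y - y')" by (simp add: algebra_simps)
    finally have "(x - x', y - y') \<in> L" by (simp add: L_def)
    then have "int M \<le> max \<bar>x - x'\<bar> \<bar>y - y'\<bar>" using uw(4) xy by (intro minM) auto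
    then show False using uw(1,2) xy by (auto simp: B_def)
  qed
  have Mp: "M < p"
  proof -
    have "M < p" if "M \<ge> 2"
    proof -
      have "2 * M \<le> M * M" using that by simp
      then show ?thesis using MM M0 unfolding power2_eq_square by linarith
    qed
    then show ?thesis using p2 by (cases "M \<ge> 2") auto
  qed
  have x0: "x0 \<noteq> 0"
  proof
    assume "x0 = 0"
    then have "int p dvd g' * y0" using xy0(1) by (simp add: L_def)
    then have "int p dvd y0" using g prime_int by (simp add: prime_dvd_mult_iff)
    moreover have "y0 \<noteq> 0" using \<open>x0 = 0\<close> xy0(2) M0 by auto
    ultimately have "int p \<le> \<bar>y0\<bar>" by (metis dvd_abs_iff zdvd_imp_le zero_less_abs_iff)
    then show False using xy0(2) Mp by simp
  qed
  have y0: "y0 \<noteq> 0"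
  proof
    assume "y0 = 0"
    then have "int p dvd g * x0" using xy0(1) by (simp add: L_def)
    then have "int p dvd x0" using g prime_int by (simp add: prime_dvd_mult_iff)
    then have "int p \<le> \<bar>x0\<bar>" using x0 by (metis dvd_abs_iff zdvd_imp_le zero_less_abs_iff)
    then show False using xy0(2) Mp by simp
  qed
  \<comment> \<open>Otherwise division by the gcd, which is not divisible by \<open>p\<close>, would
    give a shorter lattice vector.\<close>
  have cop: "coprime x0 y0"
  proof (rule ccontr)
    assume "\<not> coprime x0 y0"
    define c where "c = gcd x0 y0"
    have c1: "c > 1" using \<open>\<not> coprime x0 y0\<close> x0 unfolding c_def
      by (metis coprime_iff_gcd_eq_1 gcd_ge_0_int gcd_eq_0_iff less_le zless_add1_eq add_0 int_one_le_iff_zero_less le_less order_le_less)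
    obtain x1 y1 where xy1: "x0 = c * x1" "y0 = c * y1" unfolding c_def by (metis dvdE gcd_dvd1 gcd_dvd2)
    have "\<not> int p dvd c"
    proof
      assume "int p dvd c"
      then have "int p dvd x0" by (simp add: xy1)
      then have "int p \<le> \<bar>x0\<bar>" using x0 by (metis dvd_abs_iff zdvd_imp_le zero_less_abs_iff)
      then show False using xy0(2) Mp by simp
    qed
    have "g * x0 - g' * y0 = c * (g * x1 - g' * y1)" by (simp add: xy1 algebra_simps)
    then have "int p dvd c * (g * x1 - g' * y1)" using xy0(1) by (simp add: L_def)
    then have "(x1, y1) \<in> L" using \<open>\<not> int p dvd c\<close> prime_int by (simp add: prime_dvd_mult_iff L_def)
    moreover have "x1 \<noteq> 0" using x0 xy1 by auto
    ultimately have "int M \<le> max \<bar>x1\<bar> \<bar>y1\<bar>" by (intro minM) auto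
    moreover have "max \<bar>x0\<bar> \<bar>y0\<bar> = c * max \<bar>x1\<bar> \<bar>y1\<bar>" using c1 by (simp add: xy1 abs_mult max_mult_distrib_left)
    ultimately have "c * int M \<le> int M" using xy0(2) c1 by (metis mult_left_mono less_imp_le zero_less_one less_trans)
    then show False using c1 M0 by (simp add: mult_le_cancel_right1)
  qed
  have det: "int p dvd x * y0 - y * x0" if "(x, y) \<in> L" for x y
  proof -
    have "g * (x * y0 - y * x0) = y0 * (g * x - g' * y) - y * (g * x0 - g' * y0)" by (simp add: algebra_simps)
    moreover have "int p dvd y0 * (g * x - g' * y) - y * (g * x0 - g' * y0)"
      using that xy0(1) unfolding L_def by (intro dvd_diff[of "int p" "y0 * (g * x - g' * y)" "y * (g * x0 - g' * y0)"] dvd_mult) simp_all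
    ultimately have "int p dvd g * (x * y0 - y * x0)" by simp
    then show ?thesis using g prime_int by (simp add: prime_dvd_mult_iff)
  qed
  have solL: "(int x, int y) \<in> L" if "(x, y) \<in> solutions K g g'" for x y
    using that by (auto simp: solutions_def L_def cong_iff_dvd_diff)
  have detb: "\<bar>int x * y0 - int y * x0\<bar> \<le> 2 * int K * int M" if "(x, y) \<in> solutions K g g'" for x y
  proof -
    have "\<bar>int x * y0 - int y * x0\<bar> \<le> \<bar>int x\<bar> * \<bar>y0\<bar> + \<bar>int y\<bar> * \<bar>x0\<bar>" by (metis abs_mult abs_triangle_ineq4)
    also have "\<dots> \<le> int K * int M + int K * int M"
      using that xy0(2) by (intro add_mono mult_mono) (auto simp: solutions_def)
    finally show ?thesis by simp
  qed
  show ?thesis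
  proof (cases "2 * K * M < p")
    case True
    have zero: "int x * y0 = int y * x0" if "(x, y) \<in> solutions K g g'" for x y
    proof (rule ccontr)
      assume "int x * y0 \<noteq> int y * x0"
      then have "int p \<le> \<bar>int x * y0 - int y * x0\<bar>" using det[OF solL[OF that]]
        by (metis dvd_abs_iff eq_iff_diff_eq_0 zdvd_imp_le zero_less_abs_iff)
      moreover have "2 * int K * int M < int p" using True by (metis of_nat_less_iff of_nat_mult of_nat_numeral)
      ultimately show False using detb[OF that] by linarith
    qed
    define a b where "a = nat \<bar>x0\<bar>" and "b = nat \<bar>y0\<bar>"
    have ab: "a > 0" "b > 0" "max a b = M" using x0 y0 xy0(2) by (auto simp: a_def b_def)
    have copab: "coprime a b" using cop by (simp add: a_def b_def coprime_int_iff[symmetric])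
    have mult: "\<exists>t. x = t * a \<and> y = t * b" if "(x, y) \<in> solutions K g g'" for x y
    proof -
      have "int x * \<bar>y0\<bar> = int y * \<bar>x0\<bar>" using zero[OF that] by (metis abs_mult abs_of_nat)
      then have eq: "x * b = y * a" by (simp add: a_def b_def flip: of_nat_eq_iff[where ?'a = int])
      then have "a dvd x * b" by simp
      then have "a dvd x" using copab by (simp add: coprime_dvd_mult_left_iff)
      then obtain t where "x = t * a" by (metis dvdE mult.commute)
      then show ?thesis using eq ab by (intro exI[of _ t]) auto
    qed
    have "card (solutions K g g') \<le> card {1..K div M}"
    proof (rule card_inj_on_le[where f = "\<lambda>(x, y). x div a"])
      show "inj_on (\<lambda>(x, y). x div a) (solutions K g g')"
      proof (rule inj_onI)
        fix u w assume uw: "u \<in> solutions K g g'" "w \<in> solutions K g g'" "(\<lambda>(x, y). x div a) u = (\<lambda>(x, y). x div a) w"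
        obtain t where t: "u = (t * a, t * b)" using mult uw(1) by (cases u) auto
        obtain s where s: "w = (s * a, s * b)" using mult uw(2) by (cases w) auto
        show "u = w" using uw(3) ab by (simp add: t s)
      qed
      show "(\<lambda>(x, y). x div a) ` solutions K g g' \<subseteq> {1..K div M}"
      proof
        fix s assume "s \<in> (\<lambda>(x, y). x div a) ` solutions K g g'"
        then obtain x y where xy: "(x, y) \<in> solutions K g g'" "s = x div a" by auto
        then obtain t where t: "x = t * a" "y = t * b" using mult by blast
        have "t > 0" "t * a \<le> K" "t * b \<le> K" using xy(1) t by (auto simp: solutions_def)
        then have "t * M \<le> K" using ab(3) by (metis max_def)
        then have "t \<le> K div M" using M0 by (simp add: less_eq_div_iff_mult_less_eq)
        then show "s \<in> {1..K div M}" using \<open>t > 0\<close> ab by (simp add: xy(2) t)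
      qed
    qed auto
    then have "card (solutions K g g') * M \<le> K div M * M" by simp
    also have "\<dots> \<le> K" by (rule div_times_less_eq_dividend)
    finally have c1: "card (solutions K g g') * M \<le> K" .
    have c2: "\<exists>x0 y0. 0 < x0 \<and> 0 < y0 \<and> max x0 y0 = M \<and> [g * int x0 = g' * int y0] (mod int p) \<and>
        (\<forall>(x, y)\<in>solutions K g g'. x0 dvd x \<and> y0 dvd y)" if ne: "solutions K g g' \<noteq> {}"
    proof (rule exI[of _ a], rule exI[of _ b], intro conjI)
      obtain x y where xy: "(x, y) \<in> solutions K g g'" using ne by auto
      then have pos: "x > 0" "y > 0" by (auto simp: solutions_def)
      have "int x * y0 = int y * x0" using zero[OF xy] .
      \<comment> \<open>A positive solution is proportional to the short vector, so the coordinates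
        of the latter agree in sign and may be replaced by their absolute values.\<close>
      then have sgn: "(x0 > 0 \<and> y0 > 0) \<or> (x0 < 0 \<and> y0 < 0)"
        using pos x0 y0 by (metis linorder_neqE_linordered_idom mult_pos_pos mult_pos_neg of_nat_0_less_iff less_asym)
      have "int p dvd g * int a - g' * int b"
      proof (cases "x0 > 0")
        case True
        then show ?thesis using sgn xy0(1) by (simp add: a_def b_def L_def)
      next
        case False
        then have "g * int a - g' * int b = - (g * x0 - g' * y0)" using sgn by (simp add: a_def b_def)
        moreover have "int p dvd g * x0 - g' * y0" using xy0(1) by (simp add: L_def)
        ultimately show ?thesis by (metis dvd_minus_iff)
      qed
      then show "[g * int a = g' * int b] (mod int p)" by (simp add: cong_iff_dvd_diff)
      show "\<forall>(x, y)\<in>solutions K g g'. a dvd x \<and> b dvd y" using mult by fastforce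
    qed (use ab in auto)
    show ?thesis using M0 c1 c2 by blast
  next
    case False
    define Lb where "Lb = 2 * int K * int M div int p"
    \<comment> \<open>A coordinate in which the short vector has absolute value \<open>M\<close>.
      Solutions on one line differ by multiples of that vector, so blocks of length \<open>M\<close>
      in this coordinate separate them.\<close>
    define co where "co = (\<lambda>(x::nat, y::nat). if \<bar>x0\<bar> = int M then x else y)"
    define f where "f = (\<lambda>(x, y). ((int x * y0 - int y * x0) div int p, co (x, y) div M))"
    have p0: "int p > 0" using p2 by simp
    have "card (solutions K g g') \<le> card ({- Lb..Lb} \<times> {0..K div M})"
    proof (rule card_inj_on_le[where f = f])
      show "inj_on f (solutions K g g')"
      proof (rule inj_onI)
        fix u w assume uw: "u \<in> solutions K g g'" "w \<in> solutions K g g'" "f u = f w"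
        obtain x y x' y' where xy: "u = (x, y)" "w = (x', y')" by (cases u, cases w)
        have "(int x * y0 - int y * x0) div int p = (int x' * y0 - int y' * x0) div int p" using uw(3) by (simp add: xy f_def)
        then have "int x * y0 - int y * x0 = int x' * y0 - int y' * x0"
          using det[OF solL] uw(1,2) xy by (metis dvd_div_eq_iff)
        then have e: "(int x - int x') * y0 = (int y - int y') * x0" by (simp add: algebra_simps)
        then have "x0 dvd (int x - int x') * y0" by simp
        then have "x0 dvd int x - int x'" using cop by (simp add: coprime_dvd_mult_left_iff)
        then obtain t where t: "int x - int x' = t * x0" by (metis dvdE mult.commute)
        then have "t * y0 * x0 = (int y - int y') * x0" using e by (simp add: mult_ac)
        then have t': "int y - int y' = t * y0" using x0 by simp
        have dv: "co (x, y) div M = co (x', y') div M" using uw(3) by (simp add: xy f_def)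
        have small: "\<bar>int c - int c'\<bar> < int M" if "c div M = c' div M" for c c' :: nat
        proof -
          have "int c = int M * int (c div M) + int (c mod M)" "int c' = int M * int (c' div M) + int (c' mod M)"
            by (metis mult_div_mod_eq of_nat_add of_nat_mult)+
          moreover have "int (c mod M) < int M" "int (c' mod M) < int M" using M0 by simp_all
          ultimately show ?thesis unfolding that by linarith
        qed
        have "\<bar>t\<bar> * int M < int M"
        proof (cases "\<bar>x0\<bar> = int M")
          case True
          then have "\<bar>int x - int x'\<bar> < int M" using small dv by (simp add: co_def)
          then show ?thesis using t True by (simp add: abs_mult)
        next
          case False
          then have yM: "\<bar>y0\<bar> = int M" using xy0(2) by (simp add: max_def split: if_splits)
          have "\<bar>int y - int y'\<bar> < int M" using small dv False by (simp add: co_def)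
          then show ?thesis using t' yM by (simp add: abs_mult)
        qed
        then have "t = 0" using M0 by (simp add: mult_less_cancel_right1)
        then show "u = w" using t t' xy by simp
      qed
      show "f ` solutions K g g' \<subseteq> {- Lb..Lb} \<times> {0..K div M}"
      proof
        fix z assume "z \<in> f ` solutions K g g'"
        then obtain x y where xy: "(x, y) \<in> solutions K g g'" "z = f (x, y)" by auto
        define q where "q = (int x * y0 - int y * x0) div int p"
        have "int p * q = int x * y0 - int y * x0" unfolding q_def using det[OF solL[OF xy(1)]] by simp
        then have "\<bar>int p * q\<bar> \<le> 2 * int K * int M" using detb[OF xy(1)] by simp
        then have "\<bar>q\<bar> * int p \<le> 2 * int K * int M" using p0 by (simp add: abs_mult mult.commute)
        then have "\<bar>q\<bar> \<le> Lb" unfolding Lb_def using zdiv_mono1[of "\<bar>q\<bar> * int p" _ "int p"] p0 by simp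
        moreover have "co (x, y) div M \<le> K div M" using xy(1) by (auto simp: co_def solutions_def intro!: div_le_mono)
        ultimately show "z \<in> {- Lb..Lb} \<times> {0..K div M}" using xy(2) by (auto simp: f_def q_def)
      qed
    qed auto
    also have "\<dots> = nat (2 * Lb + 1) * (K div M + 1)"
    proof -
      have "Lb \<ge> 0" unfolding Lb_def using p0 by (simp add: pos_imp_zdiv_nonneg_iff)
      then show ?thesis by (simp add: card_cartesian_product)
    qed
    finally have n0: "real (card (solutions K g g')) \<le> real (nat (2 * Lb + 1)) * real (K div M + 1)"
      by (metis of_nat_le_iff of_nat_mult)
    \<comment> \<open>The rounding terms are absorbed by \<open>p \<le> 2 * K * M\<close> here and
      by \<open>M \<le> 2 * K\<close>, a consequence of \<open>M\<^sup>2 \<le> p\<close>, in the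
      other factor. This gives 6 times 3.\<close>
    have n1: "real (nat (2 * Lb + 1)) \<le> 6 * real K * real M / real p"
    proof -
      have "Lb \<ge> 0" unfolding Lb_def using p0 by (simp add: pos_imp_zdiv_nonneg_iff)
      have "Lb * int p \<le> 2 * int K * int M" unfolding Lb_def using p0
        by (metis mult.commute pos_mod_sign add_increasing2 mult_div_mod_eq le_add_same_cancel1)
      then have "real_of_int (Lb * int p) \<le> real_of_int (2 * int K * int M)" by (simp only: of_int_le_iff)
      then have "real_of_int Lb * real p \<le> 2 * real K * real M" by simp
      moreover have "real p \<le> 2 * real K * real M" using False by (metis linorder_not_less of_nat_le_iff of_nat_mult of_nat_numeral)
      ultimately have "(2 * real_of_int Lb + 1) * real p \<le> 6 * real K * real M" by (simp add: algebra_simps)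
      then have "2 * real_of_int Lb + 1 \<le> 6 * real K * real M / real p" using p0 by (simp add: pos_le_divide_eq)
      then show ?thesis using \<open>Lb \<ge> 0\<close> by simp
    qed
    have n2: "real (K div M + 1) \<le> 3 * real K / real M"
    proof -
      have "M * M \<le> 2 * K * M" using False MM unfolding power2_eq_square by linarith
      then have "M \<le> 2 * K" using M0 by (metis mult_le_cancel2)
      then have "real M \<le> 2 * real K" by linarith
      then have "1 \<le> 2 * real K / real M" using M0 by simp
      moreover have "real (K div M) \<le> real K / real M" by (rule of_nat_div_le_of_nat)
      ultimately show ?thesis by simp
    qed
    have "real (card (solutions K g g')) \<le> 6 * real K * real M / real p * (3 * real K / real M)"
      by (rule order_trans[OF n0 mult_mono[OF n1 n2]]) simp_all
    also have "\<dots> = 18 * (real K)\<^sup>2 / real p" using M0 by (simp add: power2_eq_square)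
    finally have "real (card (solutions K g g')) * real p \<le> 18 * (real K)\<^sup>2" using p0 by (simp add: pos_le_divide_eq)
    then have "real (card (solutions K g g') * p) \<le> real (18 * K\<^sup>2)" by simp
    then have "card (solutions K g g') * p \<le> 18 * K\<^sup>2" by (simp only: of_nat_le_iff)
    then show ?thesis using M0 by blast
  qed
qed

section \<open>Character sums over boxes and their energy\<close>

definition box_sum :: "int set \<Rightarrow> nat list \<Rightarrow> nat \<Rightarrow> complex" where
  "box_sum G v k = (\<Sum>g\<in>G. dchar p k g) * prod_list (map (interval_sum p k) v)"

text \<open>By \<open>energy_eq\<close> this is the number of coincidences when all sides are below
  \<open>p\<close>. The form as an average over all characters, the principal one included, makes
  Cauchy-Schwarz and log-convexity available.\<close>

definition energy :: "int set \<Rightarrow> nat list \<Rightarrow> real" where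
  "energy G v = (\<Sum>k<p - 1. (cmod (box_sum G v k))\<^sup>2) / real (p - 1)"

lemma prod_interval_sum: "prod_list (map (interval_sum p k) v) = (\<Sum>d\<in>tuples v. dchar p k (int (prod_list d)))"
proof (induction v)
  case Nil
  then show ?case by (simp add: dchar_1)
next
  case (Cons a v)
  then show ?case
    by (simp add: sum_tuples_Cons interval_sum_def sum_product dchar_mult)
qed

lemma box_sum_eq: "box_sum G v k = (\<Sum>z\<in>G \<times> tuples v. dchar p k (fst z * int (prod_list (snd z))))"
  by (simp add: box_sum_def prod_interval_sum sum_product sum.cartesian_product dchar_mult split_def)

lemma box_sum_mset: "mset v = mset w \<Longrightarrow> box_sum G v k = box_sum G w k"
proof -
  assume "mset v = mset w"
  then have "mset (map (interval_sum p k) v) = mset (map (interval_sum p k) w)" by simp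
  then show ?thesis unfolding box_sum_def by (simp only: flip: prod_mset_prod_list)
qed

lemma energy_mset: "mset v = mset w \<Longrightarrow> energy G v = energy G w"
  unfolding energy_def by (simp only: box_sum_mset[of v w])

lemma energy_nonneg: "energy G v \<ge> 0"
  unfolding energy_def by (intro divide_nonneg_nonneg sum_nonneg) auto

lemma tuples_not_dvd:
  assumes "d \<in> tuples v" "\<forall>a\<in>set v. a < p"
  shows "\<not> p dvd prod_list d"
  using assms
proof (induction v arbitrary: d)
  case Nil
  then show ?case using p2 by auto
next
  case (Cons a v)
  then obtain x e where d: "d = x # e" "x \<in> {1..a}" "e \<in> tuples v" by (auto simp: tuples_Cons)
  have "x < p" "0 < x" using d Cons.prems by auto
  then have "\<not> p dvd x" by (auto dest: dvd_imp_le)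
  moreover have "\<not> p dvd prod_list e" using Cons.IH[OF d(3)] Cons.prems by simp
  ultimately show ?case using p by (simp add: d prime_dvd_mult_iff)
qed

lemma box_elem_not_dvd:
  assumes "G \<subseteq> {1..<int p}" "\<forall>a\<in>set v. a < p" "z \<in> G \<times> tuples v"
  shows "\<not> int p dvd fst z * int (prod_list (snd z))"
proof -
  have "\<not> int p dvd fst z" using assms by (auto dest!: zdvd_imp_le)
  moreover have "\<not> int p dvd int (prod_list (snd z))" using tuples_not_dvd[of "snd z" v] assms(2,3) by (simp only: int_dvd_int_iff) auto
  ultimately show ?thesis using prime_int by (simp add: prime_dvd_mult_iff)
qed

definition box_pairs :: "int set \<Rightarrow> nat list \<Rightarrow> nat list \<Rightarrow> ((int \<times> nat list) \<times> (int \<times> nat list)) set" where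
  "box_pairs G v w = {(z, z') \<in> (G \<times> tuples v) \<times> (G \<times> tuples w).
     [fst z * int (prod_list (snd z)) = fst z' * int (prod_list (snd z'))] (mod int p)}"

context
  fixes G :: "int set"
  assumes G: "G \<subseteq> {1..<int p}"
begin

lemma finG: "finite G" using G finite_subset by blast

lemma finite_box_pairs: "finite (box_pairs G v w)"
  by (rule finite_subset[of _ "(G \<times> tuples v) \<times> (G \<times> tuples w)"]) (auto simp: box_pairs_def finG)

lemma energy_eq:
  assumes "\<forall>a\<in>set v. a < p"
  shows "energy G v = real (card (box_pairs G v v))"
proof -
  have "(\<Sum>k<p - 1. (cmod (box_sum G v k))\<^sup>2) = real ((p - 1) * card (box_pairs G v v))"
    unfolding box_sum_eq box_pairs_def using finG box_elem_not_dvd[OF G assms]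
    by (intro energy_identity) auto
  then show ?thesis using p2 by (simp add: energy_def)
qed

text \<open>Cauchy-Schwarz over the characters. Pairs of different boxes arise because the two
  coordinates of a short lattice vector may have different sizes.\<close>

lemma card_box_pairs_le:
  assumes "\<forall>a\<in>set v. a < p" "\<forall>a\<in>set w. a < p"
  shows "real (card (box_pairs G v w)) \<le> sqrt (energy G v * energy G w)"
proof -
  define f where "f k = cmod (box_sum G v k)" for k
  define h where "h k = cmod (box_sum G w k)" for k
  have "of_nat ((p - 1) * card (box_pairs G v w)) = (\<Sum>k<p - 1. box_sum G v k * cnj (box_sum G w k))"
    unfolding box_sum_eq box_pairs_def using finG box_elem_not_dvd[OF G assms(1)] box_elem_not_dvd[OF G assms(2)]
    by (intro bilinear_orthogonality[symmetric]) auto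
  then have "real ((p - 1) * card (box_pairs G v w)) = cmod (\<Sum>k<p - 1. box_sum G v k * cnj (box_sum G w k))"
    by (simp only: norm_of_nat flip: \<open>of_nat _ = _\<close>)
  also have "\<dots> \<le> (\<Sum>k<p - 1. f k * h k)"
    using norm_sum[of "\<lambda>k. box_sum G v k * cnj (box_sum G w k)" "{..<p-1}"] by (simp add: f_def h_def norm_mult)
  also have "\<dots> \<le> L2_set f {..<p - 1} * L2_set h {..<p - 1}"
    using L2_set_mult_ineq[of f h "{..<p - 1}"] by (simp add: f_def h_def)
  also have "\<dots> = sqrt ((real (p - 1) * energy G v) * (real (p - 1) * energy G w))"
    using p2 by (simp add: L2_set_def energy_def f_def h_def real_sqrt_mult)
  also have "\<dots> = real (p - 1) * sqrt (energy G v * energy G w)"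
    by (simp add: real_sqrt_mult)
  finally show ?thesis using p2 by simp
qed

lemma energy_ones: "energy G (replicate n 1) = real (card G)"
proof -
  define r where "r = replicate n (1::nat)"
  have t: "tuples r = {r}" unfolding r_def by (induction n) (auto simp: tuples_Cons)
  have pr: "prod_list r = 1" by (simp add: r_def)
  have eqg: "g = g'" if "g \<in> G" "g' \<in> G" "[g = g'] (mod int p)" for g g'
    using that G by (intro cong_less_imp_eq_int[of g "int p" g']) auto
  have "box_pairs G r r = (\<lambda>g. ((g, r), (g, r))) ` G"
    unfolding box_pairs_def t by (auto simp: pr image_iff dest: eqg)
  moreover have "inj_on (\<lambda>g. ((g, r), (g, r))) G" by (auto simp: inj_on_def)
  ultimately have "card (box_pairs G r r) = card G" by (simp add: card_image)
  moreover have "\<forall>a\<in>set r. a < p" using p2 by (auto simp: r_def)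
  ultimately show ?thesis using energy_eq[of r] by (simp add: r_def)
qed

text \<open>A side 1 contributes the factor 1. So the three energies are the moments of order 2, 4
  and 0 of \<open>cmod (interval_sum p k a)\<close> with respect to one nonnegative weight, and
  Cauchy-Schwarz relates them.\<close>

lemma energy_log_convex: "(energy G (a # 1 # v))\<^sup>2 \<le> energy G (a # a # v) * energy G (1 # 1 # v)"
proof -
  define t where "t k = cmod (box_sum G (1 # 1 # v) k)" for k
  define s where "s k = cmod (interval_sum p k a)" for k
  have i1: "interval_sum p k (Suc 0) = 1" for k by (simp add: interval_sum_def dchar_1)
  have e1: "(cmod (box_sum G (a # 1 # v) k))\<^sup>2 = (s k)\<^sup>2 * t k * t k" for k
    by (simp add: box_sum_def t_def s_def norm_mult i1 power2_eq_square)
  have e2: "(cmod (box_sum G (a # a # v) k))\<^sup>2 = ((s k)\<^sup>2 * t k)\<^sup>2" for k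
    by (simp add: box_sum_def t_def s_def norm_mult i1 power2_eq_square)
  have "(\<Sum>k<p - 1. (s k)\<^sup>2 * t k * t k) \<le> L2_set (\<lambda>k. (s k)\<^sup>2 * t k) {..<p - 1} * L2_set t {..<p - 1}"
    using L2_set_mult_ineq[of "\<lambda>k. (s k)\<^sup>2 * t k" t "{..<p - 1}"] by (simp add: t_def s_def abs_mult)
  then have "(\<Sum>k<p - 1. (s k)\<^sup>2 * t k * t k)\<^sup>2 \<le> (L2_set (\<lambda>k. (s k)\<^sup>2 * t k) {..<p - 1} * L2_set t {..<p - 1})\<^sup>2"
    by (intro power_mono sum_nonneg) (auto simp: t_def)
  also have "\<dots> = (L2_set (\<lambda>k. (s k)\<^sup>2 * t k) {..<p - 1})\<^sup>2 * (L2_set t {..<p - 1})\<^sup>2" by (rule power_mult_distrib)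
  also have "(L2_set (\<lambda>k. (s k)\<^sup>2 * t k) {..<p - 1})\<^sup>2 = (\<Sum>k<p - 1. ((s k)\<^sup>2 * t k)\<^sup>2)"
    unfolding L2_set_def by (rule real_sqrt_pow2) (rule sum_nonneg, simp)
  also have "(L2_set t {..<p - 1})\<^sup>2 = (\<Sum>k<p - 1. (t k)\<^sup>2)"
    unfolding L2_set_def by (rule real_sqrt_pow2) (rule sum_nonneg, simp)
  finally have ineq: "(\<Sum>k<p - 1. (s k)\<^sup>2 * t k * t k)\<^sup>2 \<le> (\<Sum>k<p - 1. ((s k)\<^sup>2 * t k)\<^sup>2) * (\<Sum>k<p - 1. (t k)\<^sup>2)" .
  have scale: "(S / q)\<^sup>2 \<le> (y / q) * (z / q)" if "S\<^sup>2 \<le> y * z" for S y z q :: real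
    using divide_right_mono[OF that, of "q\<^sup>2"] by (simp add: power_divide power2_eq_square)
  show ?thesis unfolding energy_def e1 e2 t_def[symmetric] by (rule scale[OF ineq])
qed

end

end

section \<open>The energy inequality and its self-improvement\<close>

lemma card_le_fibers:
  assumes "finite T" "f ` S \<subseteq> T" "\<And>t. t \<in> T \<Longrightarrow> card {s \<in> S. f s = t} \<le> c"
  shows "card S \<le> c * card T"
proof -
  have "S = (\<Union>t\<in>T. {s \<in> S. f s = t})" using assms(2) by auto
  then have "card S \<le> (\<Sum>t\<in>T. card {s \<in> S. f s = t})" using card_UN_le[OF assms(1)] by metis
  also have "\<dots> \<le> c * card T" using sum_bounded_above[of T "\<lambda>t. card {s \<in> S. f s = t}" c] assms(3) by (simp add: mult.commute)
  finally show ?thesis .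
qed

lemma dyadic_cover:
  assumes "1 \<le> x" "x \<le> A" "A \<le> 2 ^ L"
  shows "\<exists>F\<in>(\<lambda>a. min (2 ^ a) A) ` {..L}. x \<le> F \<and> F \<le> 2 * (x::nat)"
proof -
  define a where "a = (LEAST a. x \<le> 2 ^ a)"
  have xL: "x \<le> 2 ^ L" using assms by linarith
  have a1: "x \<le> 2 ^ a" unfolding a_def using xL by (rule LeastI)
  have a2: "a \<le> L" unfolding a_def using xL by (rule Least_le)
  have a3: "2 ^ a \<le> 2 * x"
  proof (cases a)
    case (Suc b)
    then have "\<not> x \<le> 2 ^ b" using not_less_Least[of b "\<lambda>a. x \<le> 2 ^ a"] by (simp add: a_def)
    then show ?thesis using Suc by simp
  qed (use assms in simp)
  show ?thesis using a1 a2 a3 assms by (intro bexI[of _ "min (2 ^ a) A"]) auto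
qed

text \<open>Boxes with sides from a list of \<open>L + 1\<close> values suffice, at the cost of a
  factor 2 per side in the volume. The cap \<open>min (2 ^ a) A\<close> keeps the sides within the
  range in which energies are compared.\<close>

lemma dyadic_box:
  assumes "A \<le> 2 ^ L" "set f \<subseteq> {1..A}"
  shows "\<exists>F. length F = length f \<and> set F \<subseteq> (\<lambda>a. min (2 ^ a) A) ` {..L} \<and> f \<in> tuples F \<and>
    prod_list F \<le> 2 ^ length f * prod_list f"
  using assms(2)
proof (induction f)
  case Nil
  then show ?case by (intro exI[of _ "[]"]) auto
next
  case (Cons x f)
  then obtain F where F: "length F = length f" "set F \<subseteq> (\<lambda>a. min (2 ^ a) A) ` {..L}" "f \<in> tuples F"
    "prod_list F \<le> 2 ^ length f * prod_list f" by auto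
  obtain b where b: "b \<in> (\<lambda>a. min (2 ^ a) A) ` {..L}" "x \<le> b" "b \<le> 2 * x"
    using dyadic_cover[of x A L, OF _ _ assms(1)] Cons.prems by (metis atLeastAtMost_iff list.set_intros(1) subsetD)
  have "b * prod_list F \<le> (2 * x) * (2 ^ length f * prod_list f)" using b F by (intro mult_le_mono) auto
  then have "prod_list (b # F) \<le> 2 ^ length (x # f) * prod_list (x # f)" by (simp add: mult_ac)
  moreover have "x # f \<in> tuples (b # F)" using F(3) b Cons.prems by (auto simp: tuples_Cons)
  ultimately show ?case using F b by (intro exI[of _ "b # F"]) auto
qed

lemma finite_lists_prod: "finite {F. length F = l \<and> set F \<subseteq> {1..A} \<and> P F}" for A :: nat
  by (rule finite_subset[OF _ finite_lists_length_eq[of "{1..A}" l]]) auto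

context prime_mod
begin

context
  fixes G :: "int set" and D :: nat
  assumes G: "G \<subseteq> {1..<int p}"
    and D: "\<And>n. 0 < n \<Longrightarrow> n < p \<Longrightarrow> card {d. d dvd n} \<le> D"
begin

text \<open>A number below \<open>p\<close> has at most \<open>D\<close> factorizations into two, so
  multiplying the two entries is at most \<open>D\<^sup>2\<close> to one on pairs. It frees a side
  1, which log-convexity requires.\<close>

lemma energy_merge:
  assumes ab: "a * b < p" "0 < a" "0 < b" and w: "\<forall>c\<in>set w. c < p"
  shows "energy G (a # b # w) \<le> real (D\<^sup>2) * energy G ((a * b) # 1 # w)"
proof -
  define h where "h = (\<lambda>(g::int, d::nat list). (g, (hd d * hd (tl d)) # 1 # tl (tl d)))"
  define hh where "hh = (\<lambda>(z, z'). (h z, h z'))"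
  have mem: "\<exists>g x y d. z = (g, x # y # d) \<and> g \<in> G \<and> x \<in> {1..a} \<and> y \<in> {1..b} \<and> d \<in> tuples w"
    if "z \<in> G \<times> tuples (a # b # w)" for z using that by (cases z) (auto simp: tuples_Cons)
  have hG: "h z \<in> G \<times> tuples ((a * b) # 1 # w)" if zG: "z \<in> G \<times> tuples (a # b # w)" for z
  proof -
    obtain g x y d where z: "z = (g, x # y # d)" "g \<in> G" "x \<in> {1..a}" "y \<in> {1..b}" "d \<in> tuples w" using mem[OF zG] by blast
    then have "x * y \<le> a * b" by (intro mult_le_mono) auto
    then show ?thesis using z by (auto simp: h_def tuples_Cons)
  qed
  have hp: "fst (h z) = fst z" "prod_list (snd (h z)) = prod_list (snd z)" if "z \<in> G \<times> tuples (a # b # w)" for z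
    using mem[OF that] by (auto simp: h_def)
  have img: "hh ` box_pairs G (a # b # w) (a # b # w) \<subseteq> box_pairs G ((a * b) # 1 # w) ((a * b) # 1 # w)"
  proof
    fix t assume "t \<in> hh ` box_pairs G (a # b # w) (a # b # w)"
    then obtain z z' where "t = (h z, h z')" "z \<in> G \<times> tuples (a # b # w)" "z' \<in> G \<times> tuples (a # b # w)"
      "[fst z * int (prod_list (snd z)) = fst z' * int (prod_list (snd z'))] (mod int p)"
      by (auto simp: hh_def box_pairs_def)
    then show "t \<in> box_pairs G ((a * b) # 1 # w) ((a * b) # 1 # w)"
      using hG[of z] hG[of z'] hp[of z] hp[of z'] unfolding box_pairs_def by simp
  qed
  have "card (box_pairs G (a # b # w) (a # b # w)) \<le> D\<^sup>2 * card (box_pairs G ((a * b) # 1 # w) ((a * b) # 1 # w))"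
  proof (rule card_le_fibers[OF finite_box_pairs[OF G] img])
    fix t assume "t \<in> box_pairs G ((a * b) # 1 # w) ((a * b) # 1 # w)"
    then obtain g n d g' n' d' where t: "t = ((g, n # 1 # d), (g', n' # 1 # d'))" "n \<in> {1..a*b}" "n' \<in> {1..a*b}"
      by (auto simp: box_pairs_def tuples_Cons)
    have n: "0 < n" "n < p" "0 < n'" "n' < p" using t ab by auto
    have "card {s \<in> box_pairs G (a # b # w) (a # b # w). hh s = t} \<le> card ({e. e dvd n} \<times> {e. e dvd n'})"
    proof (rule card_inj_on_le[where f = "\<lambda>(z, z'). (hd (snd z), hd (snd z'))"])
      have key: "\<exists>x y. z = (g, x # y # d) \<and> x * y = n \<and> x > 0" if "z \<in> G \<times> tuples (a # b # w)" "h z = (g, n # 1 # d)" for z g n d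
        using mem[OF that(1)] that(2) by (auto simp: h_def)
      have key2: "\<exists>x y x' y'. s = ((g, x # y # d), (g', x' # y' # d')) \<and> x * y = n \<and> x' * y' = n' \<and> x > 0 \<and> x' > 0"
        if "s \<in> {s \<in> box_pairs G (a # b # w) (a # b # w). hh s = t}" for s
      proof -
        obtain z z' where s: "s = (z, z')" by (cases s)
        have "z \<in> G \<times> tuples (a # b # w)" "h z = (g, n # 1 # d)" "z' \<in> G \<times> tuples (a # b # w)" "h z' = (g', n' # 1 # d')"
          using that t(1) by (auto simp: s box_pairs_def hh_def)
        then show ?thesis using key[of z g n d] key[of z' g' n' d'] s by auto
      qed
      show "inj_on (\<lambda>(z, z'). (hd (snd z), hd (snd z'))) {s \<in> box_pairs G (a # b # w) (a # b # w). hh s = t}"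
      proof (rule inj_onI)
        fix s s' assume s: "s \<in> {s \<in> box_pairs G (a # b # w) (a # b # w). hh s = t}" "s' \<in> {s \<in> box_pairs G (a # b # w) (a # b # w). hh s = t}"
          "(\<lambda>(z, z'). (hd (snd z), hd (snd z'))) s = (\<lambda>(z, z'). (hd (snd z), hd (snd z'))) s'"
        obtain x y x' y' where 1: "s = ((g, x # y # d), (g', x' # y' # d'))" "x * y = n" "x' * y' = n'" "x > 0" "x' > 0" using key2[OF s(1)] by auto
        obtain u v u' v' where 2: "s' = ((g, u # v # d), (g', u' # v' # d'))" "u * v = n" "u' * v' = n'" using key2[OF s(2)] by auto
        have "u = x" "u' = x'" using s(3) 1 2 by auto
        then have "v = y" "v' = y'" using 1 2 by auto
        then show "s = s'" using 1 2 \<open>u = x\<close> \<open>u' = x'\<close> by simp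
      qed
      show "(\<lambda>(z, z'). (hd (snd z), hd (snd z'))) ` {s \<in> box_pairs G (a # b # w) (a # b # w). hh s = t} \<subseteq> {e. e dvd n} \<times> {e. e dvd n'}"
      proof
        fix e assume "e \<in> (\<lambda>(z, z'). (hd (snd z), hd (snd z'))) ` {s \<in> box_pairs G (a # b # w) (a # b # w). hh s = t}"
        then obtain s where s: "s \<in> {s \<in> box_pairs G (a # b # w) (a # b # w). hh s = t}" "e = (\<lambda>(z, z'). (hd (snd z), hd (snd z'))) s" by (elim imageE)
        then obtain x y x' y' where "s = ((g, x # y # d), (g', x' # y' # d'))" "x * y = n" "x' * y' = n'" using key2[OF s(1)] by auto
        then show "e \<in> {e. e dvd n} \<times> {e. e dvd n'}" using s(2) by auto
      qed
    qed (use n in auto)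
    also have "\<dots> \<le> D * D" unfolding card_cartesian_product using n by (intro mult_le_mono D)
    finally show "card {s \<in> box_pairs G (a # b # w) (a # b # w). hh s = t} \<le> D\<^sup>2" by (simp add: power2_eq_square)
  qed
  then have "real (card (box_pairs G (a # b # w) (a # b # w))) \<le> real (D\<^sup>2) * real (card (box_pairs G ((a * b) # 1 # w) ((a * b) # 1 # w)))"
    by (metis of_nat_le_iff of_nat_mult)
  moreover have "a < p" "b < p" using ab by (metis le_less_trans mult_le_mono1 mult_le_mono2 mult_1 mult_1_right Suc_leI One_nat_def)+
  ultimately show ?thesis using ab w p2 energy_eq[OF G, of "a # b # w"] energy_eq[OF G, of "(a * b) # 1 # w"] by auto
qed

text \<open>For every pair \<open>(g, g')\<close> the lattice dichotomy bounds the solutions by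
  \<open>18 * K\<^sup>2 / p\<close>, by \<open>K / N\<close> if the short vector has norm
  \<open>M \<ge> N\<close>, or else by \<open>K / M\<close>. As \<open>K * N \<le> p\<close>, the
  first two contribute \<open>O(N * K)\<close> in total. In the third case the short vector is
  itself a coincidence between boxes of volume at most \<open>2 ^ l * N\<close>, and these are
  controlled by \<open>Q\<close>.\<close>

lemma energy_upper:
  assumes A: "A < p" "A \<le> 2 ^ L" and N: "card G > 0"
    and Q: "Q \<ge> 1" "\<And>F. length F = l \<Longrightarrow> set F \<subseteq> {1..A} \<Longrightarrow> prod_list F \<le> 2 ^ l * card G \<Longrightarrow>
      energy G F \<le> Q * (real (card G) * real (prod_list F))"
    and v: "length v = l" "set v \<subseteq> {1..A}" "prod_list v * card G \<le> p"
  shows "energy G v \<le> 20 * real D ^ (2 * l) * 2 ^ l * real (L + 1) ^ (2 * l) * Q * (real (card G) * real (prod_list v))"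
proof -
  define N where "N = card G"
  define K where "K = prod_list v"
  have N0: "N > 0" using assms by (simp add: N_def)
  have K0: "K > 0" unfolding K_def using v(2) by (induction v) auto
  have vp: "\<forall>a\<in>set v. a < p" using v(2) A by auto
  have Kp: "K \<le> p" using v(3) N0 by (metis K_def N_def le_trans mult_le_mono2 nat_mult_1_right Suc_leI One_nat_def)
  define I where "I = prod_list ` tuples v"
  have I: "0 < x \<and> x \<le> K \<and> x < p" if xI: "x \<in> I" for x
  proof -
    obtain d where d: "d \<in> tuples v" "x = prod_list d" using xI by (auto simp: I_def)
    have "0 < x \<and> x \<le> K" using tuples_prod[OF d(1)] by (simp add: d K_def)
    moreover have "\<not> p dvd x" using tuples_not_dvd[OF d(1) vp] d by simp
    ultimately show ?thesis using Kp by (metis dvd_refl le_neq_implies_less le_trans)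
  qed
  have finI: "finite I" by (simp add: I_def)
  define sol where "sol = (\<lambda>(g, g'). {(x, y) \<in> I \<times> I. [g * int x = g' * int y] (mod int p)})"
  have sol_sub: "sol (g, g') \<subseteq> solutions K g g'" for g g' using I by (auto simp: sol_def solutions_def Suc_leI)
  have finsol: "finite (sol z)" for z by (rule finite_subset[of _ "I \<times> I"]) (auto simp: sol_def finI split: prod.splits)
  have finG: "finite G" using G by (rule finG)
  define h where "h = (\<lambda>((g::int, d::nat list), (g'::int, d'::nat list)). ((g, g'), (prod_list d, prod_list d')))"
  \<comment> \<open>Passing from tuples to their products loses, on either side, at most the number
    of factorizations into \<open>l\<close> factors.\<close>
  have step1: "card (box_pairs G v v) \<le> (D ^ l * D ^ l) * card (Sigma (G \<times> G) sol)"
  proof (rule card_le_fibers[where f = h])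
    show "finite (Sigma (G \<times> G) sol)" using finG finsol by auto
    show "h ` box_pairs G v v \<subseteq> Sigma (G \<times> G) sol" by (auto simp: h_def box_pairs_def sol_def I_def)
    fix t assume "t \<in> Sigma (G \<times> G) sol"
    then obtain g g' x y where t: "t = ((g, g'), (x, y))" "x \<in> I" "y \<in> I" by (auto simp: sol_def)
    have "{s \<in> box_pairs G v v. h s = t} \<subseteq> (\<lambda>(d, d'). ((g, d), (g', d'))) ` ({d \<in> tuples v. prod_list d = x} \<times> {d \<in> tuples v. prod_list d = y})"
      using t(1) by (auto simp: box_pairs_def h_def)
    then have "card {s \<in> box_pairs G v v. h s = t} \<le> card ({d \<in> tuples v. prod_list d = x} \<times> {d \<in> tuples v. prod_list d = y})"
      by (intro surj_card_le) auto
    also have "\<dots> = rep_count v x * rep_count v y" by (simp add: card_cartesian_product rep_count_def)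
    also have "\<dots> \<le> D ^ l * D ^ l"
    proof (rule mult_le_mono)
      have "rep_count v x \<le> D ^ l" if "x \<in> I" for x
      proof -
        have "rep_count v x \<le> card {d. d dvd x} ^ length v" using I[OF that] by (intro rep_count_le_divisors) auto
        also have "\<dots> \<le> D ^ l" unfolding v(1) using I[OF that] by (intro power_mono D) auto
        finally show ?thesis .
      qed
      then show "rep_count v x \<le> D ^ l" "rep_count v y \<le> D ^ l" using t by auto
    qed
    finally show "card {s \<in> box_pairs G v v. h s = t} \<le> D ^ l * D ^ l" .
  qed
  define Dy where "Dy = (\<lambda>a. min (2 ^ a) A) ` {..L}"
  define Bx where "Bx = {F. length F = l \<and> set F \<subseteq> Dy - {0} \<and> prod_list F \<le> 2 ^ l * N}"
  have finBx: "finite Bx" unfolding Bx_def Dy_def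
    by (rule finite_subset[OF _ finite_lists_length_eq[of "Dy" l]]) (auto simp: Dy_def)
  have cardBx: "card Bx \<le> (L + 1) ^ l"
  proof -
    have "card Bx \<le> card {F. set F \<subseteq> Dy \<and> length F = l}" unfolding Bx_def
      by (intro card_mono finite_lists_length_eq) (auto simp: Dy_def)
    also have "\<dots> = card Dy ^ l" by (intro card_lists_length_eq) (auto simp: Dy_def)
    also have "\<dots> \<le> (L + 1) ^ l" using card_image_le[of "{..L}" "\<lambda>a. min (2 ^ a) A"] by (intro power_mono) (auto simp: Dy_def)
    finally show ?thesis .
  qed
  have BxA: "set F \<subseteq> {1..A}" if "F \<in> Bx" for F using that by (force simp: Bx_def Dy_def)
  have Bxpos: "prod_list F > 0" if "F \<in> Bx" for F
  proof -
    have "set F \<subseteq> {1..A}" using BxA[OF that] .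
    then show ?thesis by (induction F) auto
  qed
  \<comment> \<open>Pairs \<open>(g, g')\<close> with at least one coincidence between the boxes
    \<open>F\<close> and \<open>F'\<close>, each counted once.\<close>
  define cr where "cr = (\<lambda>(F, F'). (\<lambda>(z, z'). (fst z, fst z')) ` box_pairs G F F')"
  have fincr: "finite (cr FF)" for FF using finite_box_pairs[OF G] by (cases FF) (auto simp: cr_def)
  \<comment> \<open>The boxes around a short vector of norm \<open>M\<close> have volume at most
    \<open>2 ^ l * M\<close>, so this weight is at least \<open>K / M\<close>. Its denominator is
    the geometric mean that Cauchy-Schwarz produces in the count of \<open>cr\<close>, and the
    volumes cancel.\<close>
  define wt where "wt = (\<lambda>(F, F'). real K * 2 ^ l / sqrt (real (prod_list F) * real (prod_list F')))"
  have wt0: "wt FF \<ge> 0" for FF by (cases FF) (auto simp: wt_def)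
  have crsub: "cr FF \<subseteq> G \<times> G" for FF by (cases FF) (auto simp: cr_def box_pairs_def)
  have card_cr: "real (card (cr FF)) * wt FF \<le> real K * 2 ^ l * Q * real N" if FFB: "FF \<in> Bx \<times> Bx" for FF
  proof -
    obtain F F' where FF: "FF = (F, F')" "F \<in> Bx" "F' \<in> Bx" using FFB by auto
    define s where "s = sqrt (real (prod_list F) * real (prod_list F'))"
    have s0: "s > 0" using Bxpos FF by (auto simp: s_def)
    have "card (cr FF) \<le> card (box_pairs G F F')" unfolding FF cr_def using finite_box_pairs[OF G] by (auto intro: card_image_le)
    then have "real (card (cr FF)) \<le> real (card (box_pairs G F F'))" by simp
    also have "\<dots> \<le> sqrt (energy G F * energy G F')"
      using BxA FF A by (intro card_box_pairs_le[OF G]) (fastforce simp: subset_iff)+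
    also have "\<dots> \<le> sqrt ((Q * (real N * real (prod_list F))) * (Q * (real N * real (prod_list F'))))"
      using FF BxA Q(1) energy_nonneg unfolding N_def
      by (intro real_sqrt_le_mono mult_mono Q(2)) (auto simp: Bx_def N_def)
    also have "(Q * (real N * real (prod_list F))) * (Q * (real N * real (prod_list F'))) =
       (Q * real N)\<^sup>2 * (real (prod_list F) * real (prod_list F'))" by (simp add: power2_eq_square)
    also have "sqrt \<dots> = Q * real N * s" using Q(1) by (simp add: real_sqrt_mult s_def)
    finally have "real (card (cr FF)) * (real K * 2 ^ l / s) \<le> Q * real N * s * (real K * 2 ^ l / s)"
      using s0 by (intro mult_right_mono) auto
    also have "\<dots> = real K * 2 ^ l * Q * real N" using s0 by simp
    finally show ?thesis by (simp add: FF wt_def s_def)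
  qed
  have pt: "real (card (sol z)) \<le> 18 * (real K)\<^sup>2 / real p + real K / real N + (\<Sum>FF\<in>Bx \<times> Bx. if z \<in> cr FF then wt FF else 0)"
    if z: "z \<in> G \<times> G" for z
  proof -
    obtain g g' where gg: "z = (g, g')" "g \<in> G" "g' \<in> G" using z by auto
    have sum0: "0 \<le> (\<Sum>FF\<in>Bx \<times> Bx. if z \<in> cr FF then wt FF else 0)" using wt0 by (intro sum_nonneg) auto
    have le: "real (card (sol z)) \<le> real (card (solutions K g g'))" using card_mono[OF finite_solutions sol_sub] by (simp add: gg)
    have nd: "\<not> int p dvd g" "\<not> int p dvd g'" using gg G by (auto dest!: zdvd_imp_le)
    consider (e) "sol z = {}" | (a) "card (solutions K g g') * p \<le> 18 * K\<^sup>2" |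
      (b) M x0 y0 where "sol z \<noteq> {}" "M > 0" "card (solutions K g g') * M \<le> K" "0 < x0" "0 < y0" "max x0 y0 = M"
        "[g * int x0 = g' * int y0] (mod int p)" "\<forall>(x, y)\<in>solutions K g g'. x0 dvd x \<and> y0 dvd y"
      using lattice_count[OF nd, of K] sol_sub[of g g'] gg by blast
    then show ?thesis
    proof cases
      case e
      then show ?thesis using sum0 by simp
    next
      case a
      then have "real (card (solutions K g g') * p) \<le> real (18 * K\<^sup>2)" by (simp only: of_nat_le_iff)
      then have "real (card (solutions K g g')) \<le> 18 * (real K)\<^sup>2 / real p" using p2 by (simp add: pos_le_divide_eq)
      moreover have "0 \<le> real K / real N" by simp
      ultimately show ?thesis using le sum0 by linarith
    next
      case b
      have "real (card (solutions K g g') * M) \<le> real K" using b(3) by (simp only: of_nat_le_iff)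
      then have cM: "real (card (solutions K g g')) \<le> real K / real M" using b(2) by (simp add: pos_le_divide_eq)
      show ?thesis
      proof (cases "M \<ge> N")
        case True
        then have "real K / real M \<le> real K / real N" using N0 by (intro divide_left_mono) auto
        moreover have "0 \<le> 18 * (real K)\<^sup>2 / real p" by simp
        ultimately show ?thesis using le cM sum0 by linarith
      next
        case False
        obtain x y where xy: "(x, y) \<in> sol z" using b(1) by auto
        then have "(x, y) \<in> solutions K g g'" using sol_sub gg by auto
        then have dv: "x0 dvd x" "y0 dvd y" using b(8) by auto
        have box: "\<exists>F\<in>Bx. \<exists>f\<in>tuples F. prod_list f = x0 \<and> prod_list F \<le> 2 ^ l * x0" if xI: "x \<in> I" "x0 dvd x" "x0 \<le> M" "0 < x0" for x x0
        proof -
          obtain d where d: "d \<in> tuples v" "x = prod_list d" using xI by (auto simp: I_def)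
          obtain f where f: "list_all2 (dvd) f d" "prod_list f = x0" using dvd_prod_list_factor xI(2) d(2) by blast
          have lf: "length f = l" using f(1) tuples_length[OF d(1)] v(1) list_all2_lengthD by fastforce
          have "set f \<subseteq> {1..A}"
          proof
            fix c assume "c \<in> set f"
            then obtain i where i: "i < length f" "c = f ! i" by (metis in_set_conv_nth)
            have "c dvd d ! i" using f(1) i by (simp add: list_all2_conv_all_nth)
            moreover have "d ! i \<in> {1..v ! i}" "v ! i \<le> A"
              using d(1) i lf v by (auto simp: tuples_def list_all2_conv_all_nth subset_iff)
            ultimately have "c \<le> A" "c > 0" using dvd_imp_le[of c "d ! i"] by (auto intro!: Nat.gr0I)
            then show "c \<in> {1..A}" by simp
          qed
          then obtain F where F: "length F = l" "set F \<subseteq> Dy" "f \<in> tuples F" "prod_list F \<le> 2 ^ l * x0"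
            using dyadic_box[OF A(2), of f] lf f(2) unfolding Dy_def by auto
          have "0 \<notin> set F"
          proof
            assume "0 \<in> set F"
            then have "prod_list F = 0" by (simp add: prod_list_zero_iff)
            then show False using tuples_prod[OF F(3)] by linarith
          qed
          moreover have "2 ^ l * x0 \<le> 2 ^ l * N" using xI(3) False by (intro mult_le_mono) auto
          then have "prod_list F \<le> 2 ^ l * N" using F(4) by linarith
          ultimately have "F \<in> Bx" using F by (auto simp: Bx_def)
          then show ?thesis using F f by auto
        qed
        have xyI: "x \<in> I" "y \<in> I" using xy gg by (auto simp: sol_def)
        obtain F f where F: "F \<in> Bx" "f \<in> tuples F" "prod_list f = x0" "prod_list F \<le> 2 ^ l * x0"
          using box[OF xyI(1) dv(1) _ b(4)] b(6) by auto
        obtain F' f' where F': "F' \<in> Bx" "f' \<in> tuples F'" "prod_list f' = y0" "prod_list F' \<le> 2 ^ l * y0"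
          using box[OF xyI(2) dv(2) _ b(5)] b(6) by auto
        have "((g, f), (g', f')) \<in> box_pairs G F F'" using F F' gg b(7) by (simp add: box_pairs_def)
        then have zc: "z \<in> cr (F, F')" using gg unfolding cr_def by force
        have "real (prod_list F) * real (prod_list F') \<le> real (2 ^ l * M) * real (2 ^ l * M)"
          using F(4) F'(4) b(6) by (intro mult_mono of_nat_mono) (auto intro: order_trans)
        then have "sqrt (real (prod_list F) * real (prod_list F')) \<le> sqrt ((real (2 ^ l * M))\<^sup>2)"
          unfolding power2_eq_square by (rule real_sqrt_le_mono)
        then have sM: "sqrt (real (prod_list F) * real (prod_list F')) \<le> 2 ^ l * real M" by simp
        have s0: "sqrt (real (prod_list F) * real (prod_list F')) > 0" using Bxpos F(1) F'(1) by auto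
        have "real K / real M = real K * 2 ^ l / (2 ^ l * real M)" by simp
        also have "\<dots> \<le> wt (F, F')" unfolding wt_def prod.case using sM s0 b(2) by (intro divide_left_mono) auto
        also have "\<dots> = (\<Sum>FF\<in>{(F, F')}. if z \<in> cr FF then wt FF else 0)" using zc by simp
        also have "\<dots> \<le> (\<Sum>FF\<in>Bx \<times> Bx. if z \<in> cr FF then wt FF else 0)"
          using F(1) F'(1) finBx wt0 by (intro sum_mono2) auto
        finally have "real K / real M \<le> (\<Sum>FF\<in>Bx \<times> Bx. if z \<in> cr FF then wt FF else 0)" .
        moreover have "0 \<le> 18 * (real K)\<^sup>2 / real p" "0 \<le> real K / real N" by simp_all
        ultimately show ?thesis using le cM by linarith
      qed
    qed
  qed
  have "real (card (Sigma (G \<times> G) sol)) = (\<Sum>z\<in>G \<times> G. real (card (sol z)))"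
    using finG finsol by (subst card_SigmaI) auto
  also have "\<dots> \<le> (\<Sum>z\<in>G \<times> G. 18 * (real K)\<^sup>2 / real p + real K / real N + (\<Sum>FF\<in>Bx \<times> Bx. if z \<in> cr FF then wt FF else 0))"
    by (rule sum_mono) (rule pt)
  also have "\<dots> = real (N * N) * (18 * (real K)\<^sup>2 / real p + real K / real N) + (\<Sum>z\<in>G \<times> G. \<Sum>FF\<in>Bx \<times> Bx. if z \<in> cr FF then wt FF else 0)"
    by (simp add: sum.distrib N_def card_cartesian_product)
  also have "(\<Sum>z\<in>G \<times> G. \<Sum>FF\<in>Bx \<times> Bx. if z \<in> cr FF then wt FF else 0) = (\<Sum>FF\<in>Bx \<times> Bx. \<Sum>z\<in>G \<times> G. if z \<in> cr FF then wt FF else 0)"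
    by (rule sum.swap)
  also have "\<dots> = (\<Sum>FF\<in>Bx \<times> Bx. real (card (cr FF)) * wt FF)"
  proof (rule sum.cong[OF refl])
    fix FF
    have "(\<Sum>z\<in>G \<times> G. if z \<in> cr FF then wt FF else 0) = (\<Sum>z\<in>{z \<in> G \<times> G. z \<in> cr FF}. wt FF)"
      using finG by (intro sum.inter_filter[symmetric]) auto
    also have "{z \<in> G \<times> G. z \<in> cr FF} = cr FF" using crsub[of FF] by auto
    finally show "(\<Sum>z\<in>G \<times> G. if z \<in> cr FF then wt FF else 0) = real (card (cr FF)) * wt FF" by simp
  qed
  also have "\<dots> \<le> (\<Sum>FF\<in>Bx \<times> Bx. real K * 2 ^ l * Q * real N)" by (rule sum_mono) (rule card_cr)
  also have "\<dots> = real (card Bx * card Bx) * (real K * 2 ^ l * Q * real N)" by (simp add: card_cartesian_product)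
  also have "\<dots> \<le> real ((L + 1) ^ l * (L + 1) ^ l) * (real K * 2 ^ l * Q * real N)"
    using cardBx Q(1) by (intro mult_right_mono of_nat_mono mult_le_mono) auto
  also have "real ((L + 1) ^ l * (L + 1) ^ l) = real (L + 1) ^ (2 * l)" by (simp add: mult_2 power_add)
  also have "real (N * N) * (18 * (real K)\<^sup>2 / real p + real K / real N) \<le> 19 * (real N * real K)"
  proof -
    have "real (K * N) \<le> real p" using v(3) by (simp only: K_def N_def of_nat_le_iff)
    then have "(real K * real N) * (real K * real N) \<le> (real K * real N) * real p" by (intro mult_left_mono) auto
    then have "(real K * real N) * (real K * real N) / real p \<le> real K * real N" using p2 by (simp add: pos_divide_le_eq)
    moreover have "real (N * N) * (18 * (real K)\<^sup>2 / real p + real K / real N) =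
       18 * ((real K * real N) * (real K * real N) / real p) + real N * real K" using N0 by (simp add: power2_eq_square field_simps)
    ultimately show ?thesis by (simp add: mult.commute)
  qed
  finally have fin: "real (card (Sigma (G \<times> G) sol)) \<le> 19 * (real N * real K) + real (L + 1) ^ (2 * l) * (real K * 2 ^ l * Q * real N)"
    by (simp add: add_mono)
  define B where "B = real (L + 1) ^ (2 * l) * 2 ^ l * Q"
  have B1: "1 \<le> B"
  proof -
    have "1 * 1 * 1 \<le> B" unfolding B_def using Q(1) by (intro mult_mono) (auto intro: one_le_power)
    then show ?thesis by simp
  qed
  have "19 * (real N * real K) * 1 \<le> 19 * (real N * real K) * B" using B1 by (intro mult_left_mono) auto
  then have fin2: "real (card (Sigma (G \<times> G) sol)) \<le> 20 * B * (real N * real K)" using fin by (simp add: B_def mult_ac)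
  have "energy G v = real (card (box_pairs G v v))" using vp by (rule energy_eq[OF G])
  also have "\<dots> \<le> real ((D ^ l * D ^ l) * card (Sigma (G \<times> G) sol))" using step1 by (simp only: of_nat_le_iff)
  also have "\<dots> = real D ^ (2 * l) * real (card (Sigma (G \<times> G) sol))" by (simp add: mult_2 power_add)
  also have "\<dots> \<le> real D ^ (2 * l) * (20 * B * (real N * real K))" using fin2 by (intro mult_left_mono) auto
  finally show ?thesis by (simp add: B_def N_def K_def mult_ac)
qed

end

context
  fixes G :: "int set" and D :: nat
  assumes G: "G \<subseteq> {1..<int p}"
    and D: "\<And>n. 0 < n \<Longrightarrow> n < p \<Longrightarrow> card {d. d dvd n} \<le> D"
begin

text \<open>One of the entries equal to 1 makes room for doubling an entry \<open>a\<close>; log-convexity then removes \<open>a\<close> at the cost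
  of a square root of the trivial bound \<open>Y\<close>.\<close>

lemma energy_chain:
  assumes Y: "Y \<ge> 1" and up: "\<And>v. length v = l \<Longrightarrow> set v \<subseteq> {1..A} \<Longrightarrow> prod_list v * card G \<le> p \<Longrightarrow>
      energy G v \<le> Y * (real (card G) * real (prod_list v))"
    and R: "R * A * card G \<le> p" and A: "A \<ge> 1"
    and w: "length w < l" "set w \<subseteq> {1..A}" "prod_list w \<le> R"
  shows "energy G (replicate (l - length w) 1 @ w) \<le> Y powr (1 - (1 / 2) ^ length w) * (real (card G) * real (prod_list w))"
  using w
proof (induction w)
  case Nil
  then show ?case using energy_ones[OF G, of l] Y by simp
next
  case (Cons a w)
  obtain n where ll: "l - length w = Suc (Suc n)" "l - length (a # w) = Suc n"
    using Cons.prems(1) by (metis One_nat_def add_diff_cancel_left' diff_Suc_Suc less_imp_Suc_add list.size(4) Suc_diff_Suc Suc_lessD add.right_neutral add_Suc_right)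
  define u where "u = replicate n 1 @ w"
  have aA: "1 \<le> a" "a \<le> A" "set w \<subseteq> {1..A}" using Cons.prems by auto
  have pu: "prod_list u = prod_list w" by (simp add: u_def)
  have m1: "energy G (replicate (l - length (a # w)) 1 @ a # w) = energy G (a # 1 # u)"
    unfolding ll u_def by (rule energy_mset) simp
  have e1: "energy G (1 # 1 # u) \<le> Y powr (1 - (1 / 2) ^ length w) * (real (card G) * real (prod_list w))"
  proof -
    have "1 * prod_list w \<le> a * prod_list w" using aA(1) by (rule mult_le_mono1)
    then have "prod_list w \<le> R" using Cons.prems(3) unfolding prod_list.Cons mult_1 by (rule order_trans)
    then have "energy G (replicate (l - length w) 1 @ w) \<le> Y powr (1 - (1 / 2) ^ length w) * (real (card G) * real (prod_list w))"
      using Cons.IH Cons.prems by simp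
    then show ?thesis unfolding ll(1) u_def by simp
  qed
  have e2: "energy G (a # a # u) \<le> Y * (real (card G) * real (prod_list (a # a # u)))"
  proof (rule up)
    show "length (a # a # u) = l" using ll Cons.prems by (simp add: u_def)
    show "set (a # a # u) \<subseteq> {1..A}" using aA A by (auto simp: u_def)
    have "a * (a * prod_list w) \<le> A * R" using aA Cons.prems by (intro mult_le_mono) auto
    then have "a * (a * prod_list w) * card G \<le> A * R * card G" by (rule mult_le_mono1)
    then show "prod_list (a # a # u) * card G \<le> p" using R by (simp only: prod_list.Cons pu mult.commute[of A R])
  qed
  define Z where "Z = Y powr (1 - (1 / 2) ^ length (a # w)) * (real (card G) * real (prod_list (a # w)))"
  have "(energy G (a # 1 # u))\<^sup>2 \<le> energy G (a # a # u) * energy G (1 # 1 # u)" by (rule energy_log_convex[OF G])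
  also have "\<dots> \<le> (Y * (real (card G) * real (prod_list (a # a # u)))) * (Y powr (1 - (1 / 2) ^ length w) * (real (card G) * real (prod_list w)))"
    using e1 e2 energy_nonneg Y by (intro mult_mono) auto
  also have "\<dots> = (Y powr 1 * Y powr (1 - (1 / 2) ^ length w)) * (real (card G) * real (prod_list (a # w)))\<^sup>2"
    using Y by (simp add: pu power2_eq_square mult_ac)
  also have "Y powr 1 * Y powr (1 - (1 / 2) ^ length w) = (Y powr (1 - (1 / 2) ^ length (a # w)))\<^sup>2"
    unfolding power2_eq_square powr_add[symmetric] by simp
  finally have "(energy G (a # 1 # u))\<^sup>2 \<le> Z\<^sup>2" by (simp only: Z_def power_mult_distrib)
  moreover have "Z \<ge> 0" by (simp add: Z_def)
  ultimately have "energy G (a # 1 # u) \<le> Z" by (rule power2_le_imp_le)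
  then show ?case unfolding m1 Z_def .
qed

text \<open>Of four sides, two disjoint pairs cannot both have a product above \<open>A\<close>,
  since the volume is at most \<open>R \<le> A\<^sup>2\<close>. One pair is merged, which frees a
  side 1, and \<open>energy_chain\<close> applies to the other \<open>l - 1\<close> sides.\<close>

lemma energy_improved:
  assumes Y: "Y \<ge> 1" and up: "\<And>v. length v = l \<Longrightarrow> set v \<subseteq> {1..A} \<Longrightarrow> prod_list v * card G \<le> p \<Longrightarrow>
      energy G v \<le> Y * (real (card G) * real (prod_list v))"
    and R: "R * A * card G \<le> p" "R \<le> A\<^sup>2" and A: "A \<ge> 1" "A < p" and l: "l \<ge> 4"
    and F: "length F = l" "set F \<subseteq> {1..A}" "prod_list F \<le> R"
  shows "energy G F \<le> real (D\<^sup>2) * Y powr (1 - (1 / 2) ^ (l - 1)) * (real (card G) * real (prod_list F))"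
proof -
  have pos: "set w \<subseteq> {1..A} \<Longrightarrow> 1 \<le> prod_list w" for w by (induction w) auto
  have "\<exists>a b w. mset F = mset (a # b # w) \<and> a * b \<le> A"
  proof -
    obtain a F1 where "F = a # F1" "length F1 \<ge> 3" using F(1) l by (cases F) auto
    moreover then obtain b F2 where "F1 = b # F2" "length F2 \<ge> 2" by (cases F1) auto
    moreover then obtain c F3 where "F2 = c # F3" "length F3 \<ge> 1" by (cases F2) auto
    moreover then obtain d w where "F3 = d # w" by (cases F3) auto
    ultimately have F4: "F = a # b # c # d # w" by simp
    show ?thesis
    proof (cases "a * b \<le> A")
      case True
      then show ?thesis using F4 by blast
    next
      case ab: False
      have "c * d \<le> A"
      proof (rule ccontr)
        assume "\<not> c * d \<le> A"
        then have "(A + 1) * (A + 1) \<le> (a * b) * (c * d)" using ab by (intro mult_le_mono) auto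
        moreover have "prod_list w \<ge> 1" using pos[of w] F(2) F4 by simp
        then have "(a * b) * (c * d) * 1 \<le> (a * b) * (c * d) * prod_list w" by (rule mult_le_mono2)
        moreover have "(a * b) * (c * d) * prod_list w = prod_list F" by (simp add: F4)
        ultimately have "(A + 1) * (A + 1) \<le> A * A" using F(3) R(2) unfolding power2_eq_square by linarith
        then show False by simp
      qed
      moreover have "mset F = mset (c # d # a # b # w)" by (simp add: F4)
      ultimately show ?thesis by blast
    qed
  qed
  then obtain a b w where abw: "mset F = mset (a # b # w)" "a * b \<le> A" by blast
  have sF: "set F = set (a # b # w)" using abw(1) by (rule mset_eq_setD)
  have lF: "length w = l - 2" using mset_eq_length[OF abw(1)] F(1) by simp
  have pF: "prod_list F = a * b * prod_list w" using abw(1) by (metis prod_mset_prod_list prod_list.Cons mult.assoc)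
  have ab0: "1 \<le> a" "1 \<le> b" using sF F(2) by auto
  have wA: "set w \<subseteq> {1..A}" using sF F(2) by auto
  have "energy G F = energy G (a # b # w)" using abw(1) by (rule energy_mset)
  also have "\<dots> \<le> real (D\<^sup>2) * energy G ((a * b) # 1 # w)"
    using ab0 abw(2) A wA by (intro energy_merge[OF G D]) auto
  also have "energy G ((a * b) # 1 # w) = energy G (replicate (l - length ((a * b) # w)) 1 @ ((a * b) # w))"
  proof (rule energy_mset)
    have "l - length ((a * b) # w) = 1" using lF l by simp
    then show "mset ((a * b) # 1 # w) = mset (replicate (l - length ((a * b) # w)) 1 @ ((a * b) # w))" by simp
  qed
  also have "real (D\<^sup>2) * \<dots> \<le> real (D\<^sup>2) * (Y powr (1 - (1 / 2) ^ length ((a * b) # w)) * (real (card G) * real (prod_list ((a * b) # w))))"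
  proof (intro mult_left_mono energy_chain[OF Y up R(1) A(1)])
    show "length ((a * b) # w) < l" using lF l by simp
    show "set ((a * b) # w) \<subseteq> {1..A}" using wA abw(2) ab0 by auto
    show "prod_list ((a * b) # w) \<le> R" using F(3) pF by simp
  qed auto
  also have "length ((a * b) # w) = l - 1" using lF l by simp
  also have "prod_list ((a * b) # w) = prod_list F" by (simp add: pF)
  finally show ?thesis by (simp add: mult.assoc)
qed

text \<open>Let \<open>Q\<close> be the best constant for boxes of volume at most
  \<open>2 ^ l * card G\<close>. By \<open>energy_upper\<close>, \<open>Y = B * Q\<close> serves all
  admissible boxes; by \<open>energy_improved\<close>,
  \<open>Q \<le> max 1 (D\<^sup>2 * Y powr (1 - \<theta>))\<close> with
  \<open>\<theta> = (1 / 2) ^ (l - 1)\<close>. The exponent below 1 closes the circle: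
  \<open>Y powr \<theta> \<le> D\<^sup>2 * B\<close>.\<close>

lemma energy_bound:
  assumes N: "card G > 0" and A: "1 \<le> A" "A < p" "A \<le> 2 ^ L" and l: "l \<ge> 4"
    and R: "2 ^ l * card G * A * card G \<le> p" "2 ^ l * card G \<le> A\<^sup>2"
    and v: "length v = l" "set v \<subseteq> {1..A}" "prod_list v * card G \<le> p"
  shows "energy G v \<le> (real (D\<^sup>2) * (20 * real D ^ (2 * l) * 2 ^ l * real (L + 1) ^ (2 * l))) ^ (2 ^ (l - 1)) *
    (real (card G) * real (prod_list v))"
proof -
  define B where "B = 20 * real D ^ (2 * l) * 2 ^ l * real (L + 1) ^ (2 * l)"
  define S where "S = {F. length F = l \<and> set F \<subseteq> {1..A} \<and> prod_list F \<le> 2 ^ l * card G}"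
  have finS: "finite S" unfolding S_def by (rule finite_lists_prod)
  define q where "q F = energy G F / (real (card G) * real (prod_list F))" for F
  \<comment> \<open>A best constant exists because there are finitely many such boxes; inserting 1
    ensures \<open>Q \<ge> 1\<close>.\<close>
  define Q where "Q = Max (insert 1 (q ` S))"
  have Q1: "Q \<ge> 1" unfolding Q_def using finS by (intro Max_ge) auto
  have pos: "prod_list F > 0" if "set F \<subseteq> {1..A}" for F using that by (induction F) auto
  have Qb: "energy G F \<le> Q * (real (card G) * real (prod_list F))"
    if F: "length F = l" "set F \<subseteq> {1..A}" "prod_list F \<le> 2 ^ l * card G" for F
  proof -
    have "q F \<le> Q" unfolding Q_def using finS F by (intro Max_ge) (auto simp: S_def)
    then show ?thesis using pos[OF F(2)] N by (simp add: q_def pos_divide_le_eq)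
  qed
  have D1: "D \<ge> 1"
  proof -
    have "card {d::nat. d dvd 1} = 1" by simp
    then show ?thesis using D[of 1] p2 by simp
  qed
  have B1: "B \<ge> 1"
  proof -
    have "1 * 1 * 1 * 1 \<le> B" unfolding B_def using D1 by (intro mult_mono one_le_power) auto
    then show ?thesis by simp
  qed
  define Y where "Y = B * Q"
  have Y1: "Y \<ge> 1" using mult_mono[of 1 B 1 Q] B1 Q1 by (simp add: Y_def)
  have up: "energy G v \<le> Y * (real (card G) * real (prod_list v))"
    if "length v = l" "set v \<subseteq> {1..A}" "prod_list v * card G \<le> p" for v
    unfolding Y_def B_def using energy_upper[OF G D A(2,3) N Q1 Qb that] by simp
  define C where "C = real (D\<^sup>2) * B"
  have C1: "C \<ge> 1" using mult_mono[of 1 "real (D\<^sup>2)" 1 B] B1 D1 by (simp add: C_def)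
  have "Y \<le> C ^ (2 ^ (l - 1))"
  proof -
    define \<theta> :: real where "\<theta> = (1 / 2) ^ (l - 1)"
    have th: "\<theta> > 0" by (simp add: \<theta>_def)
    have "Q \<in> insert 1 (q ` S)" unfolding Q_def using finS by (intro Max_in) auto
    then have "Q \<le> real (D\<^sup>2) * Y powr (1 - \<theta>)"
    proof
      assume "Q = 1"
      have "1 * 1 \<le> real (D\<^sup>2) * Y powr (1 - \<theta>)"
        using D1 Y1 by (intro mult_mono ge_one_powr_ge_zero) (auto simp: \<theta>_def power_le_one)
      then show ?thesis using \<open>Q = 1\<close> by simp
    next
      assume "Q \<in> q ` S"
      then obtain F where F: "Q = q F" "F \<in> S" by auto
      then have "energy G F \<le> real (D\<^sup>2) * Y powr (1 - (1 / 2) ^ (l - 1)) * (real (card G) * real (prod_list F))"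
        by (intro energy_improved[OF Y1 up R A(1,2) l]) (auto simp: S_def)
      moreover have "prod_list F > 0" using F pos by (simp add: S_def)
      ultimately show ?thesis using N by (simp add: F q_def \<theta>_def pos_divide_le_eq)
    qed
    then have "B * Q \<le> B * (real (D\<^sup>2) * Y powr (1 - \<theta>))" using B1 by (intro mult_left_mono) auto
    then have "Y \<le> C * Y powr (1 - \<theta>)" by (simp add: C_def Y_def mult_ac)
    also have "Y powr (1 - \<theta>) = Y / Y powr \<theta>" using Y1 by (simp add: powr_diff)
    finally have "Y * Y powr \<theta> \<le> C * Y" using Y1 by (simp add: pos_le_divide_eq)
    then have "Y powr \<theta> \<le> C" using Y1 by (simp add: mult.commute)
    then have "(Y powr \<theta>) ^ (2 ^ (l - 1)) \<le> C ^ (2 ^ (l - 1))" by (intro power_mono) auto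
    moreover have "(Y powr \<theta>) ^ (2 ^ (l - 1)) = Y"
    proof -
      have "(Y powr \<theta>) ^ (2 ^ (l - 1)) = Y powr (\<theta> * 2 ^ (l - 1))"
        using Y1 by (subst powr_realpow[symmetric]) (auto simp: powr_powr)
      also have "\<theta> * 2 ^ (l - 1) = 1" by (simp add: \<theta>_def flip: power_mult_distrib)
      finally show ?thesis using Y1 by simp
    qed
    ultimately show ?thesis by simp
  qed
  then have "Y * (real (card G) * real (prod_list v)) \<le> C ^ (2 ^ (l - 1)) * (real (card G) * real (prod_list v))"
    by (intro mult_right_mono) auto
  then show ?thesis using up[OF v] by (simp add: C_def B_def)
qed

end

end

theorem energy_estimate:
  fixes \<kappa> :: real and l :: nat
  assumes \<kappa>: "\<kappa> > 0" and l: "l \<ge> 4"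
  shows "\<exists>C>0. \<forall>p A v (G::int set). prime p \<longrightarrow> G \<subseteq> {1..<int p} \<longrightarrow> card G > 0 \<longrightarrow> 1 \<le> A \<longrightarrow> A < p \<longrightarrow>
    2 ^ l * card G * A * card G \<le> p \<longrightarrow> 2 ^ l * card G \<le> A\<^sup>2 \<longrightarrow> length v = l \<longrightarrow> set v \<subseteq> {1..A} \<longrightarrow>
    prod_list v * card G \<le> p \<longrightarrow>
    prime_mod.energy p G v \<le> C * real p powr \<kappa> * (real (card G) * real (prod_list v))"
proof -
  \<comment> \<open>\<open>energy_bound\<close> contains \<open>D\<close> to the power
    \<open>2 + 2 * l\<close> and \<open>L + 1\<close> to the power \<open>2 * l\<close>, all raised
    to \<open>2 ^ (l - 1)\<close>. With both bases \<open>O(p powr \<mu>)\<close>, this is the total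
    number of factors \<open>p powr \<mu>\<close>.\<close>
  define e where "e = (4 * l + 2) * 2 ^ (l - 1)"
  define \<mu> where "\<mu> = \<kappa> / real e"
  have e0: "e > 0" by (simp add: e_def)
  have mu: "\<mu> > 0" using \<kappa> e0 by (simp add: \<mu>_def)
  obtain Cd where Cd: "Cd \<ge> 1" "\<forall>n::nat. n > 0 \<longrightarrow> real (card {d. d dvd n}) \<le> Cd * real n powr \<mu>"
    using divisor_bound[OF mu] by auto
  \<comment> \<open>From \<open>ln p \<le> p powr \<mu> / \<mu>\<close>; the 3 leaves room for the
    rounding in \<open>L\<close> and for the \<open>+ 1\<close>.\<close>
  define Cl where "Cl = 3 + 1 / (\<mu> * ln 2)"
  have Cl0: "Cl > 0" unfolding Cl_def using mu by (intro add_pos_pos) auto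
  define C where "C = (Cd\<^sup>2 * (20 * Cd ^ (2 * l) * 2 ^ l * Cl ^ (2 * l))) ^ (2 ^ (l - 1))"
  show ?thesis
  proof (intro exI[of _ C] conjI allI impI)
    show "C > 0" using Cd(1) Cl0 by (simp add: C_def)
    fix p A v and G :: "int set"
    assume as: "prime p" "G \<subseteq> {1..<int p}" "card G > 0" "1 \<le> A" "A < p"
      "2 ^ l * card G * A * card G \<le> p" "2 ^ l * card G \<le> A\<^sup>2" "length v = l" "set v \<subseteq> {1..A}" "prod_list v * card G \<le> p"
    interpret prime_mod p by standard (rule as(1))
    define x where "x = real p powr \<mu>"
    have p1: "real p \<ge> 2" using p2 by simp
    have x1: "x \<ge> 1" unfolding x_def using p1 mu by (intro ge_one_powr_ge_zero) auto
    define D where "D = nat \<lfloor>Cd * x\<rfloor>"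
    have Dx: "real D \<le> Cd * x" unfolding D_def using Cd(1) x1 by simp
    have D: "card {d. d dvd n} \<le> D" if "0 < n" "n < p" for n
    proof -
      have "real (card {d. d dvd n}) \<le> Cd * real n powr \<mu>" using Cd(2) that by simp
      also have "\<dots> \<le> Cd * x" unfolding x_def using that Cd(1) mu by (intro mult_left_mono powr_mono2) auto
      finally show ?thesis unfolding D_def by (simp add: le_nat_floor)
    qed
    define L where "L = nat \<lceil>log 2 (real p)\<rceil>"
    have AL: "A \<le> 2 ^ L"
    proof -
      have "real p = 2 powr log 2 (real p)" using p1 by simp
      also have "\<dots> \<le> 2 powr real L" unfolding L_def by (intro powr_mono) (auto intro: real_nat_ceiling_ge)
      finally have "real p \<le> real (2 ^ L)" by (simp add: powr_realpow)
      then have "p \<le> 2 ^ L" by (simp only: of_nat_le_iff)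
      then show ?thesis using as(5) by simp
    qed
    have Lx: "real (L + 1) \<le> Cl * x"
    proof -
      have "ln (real p) \<le> x / \<mu>" unfolding x_def using p1 mu by (intro ln_powr_bound) auto
      then have "log 2 (real p) \<le> x / \<mu> / ln 2" unfolding log_def by (intro divide_right_mono) auto
      moreover have "log 2 (real p) \<ge> 0" using p1 by simp
      then have "real L \<le> log 2 (real p) + 1" unfolding L_def by linarith
      moreover have "x / \<mu> / ln 2 + 3 \<le> Cl * x" using x1 by (simp add: Cl_def field_simps)
      ultimately show ?thesis by linarith
    qed
    define NK where "NK = real (card G) * real (prod_list v)"
    have "energy G v \<le> (real (D\<^sup>2) * (20 * real D ^ (2 * l) * 2 ^ l * real (L + 1) ^ (2 * l))) ^ (2 ^ (l - 1)) * NK"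
      unfolding NK_def by (rule energy_bound[OF as(2) D as(3,4,5) AL l as(6-10)])
    also have "\<dots> \<le> ((Cd * x)\<^sup>2 * (20 * (Cd * x) ^ (2 * l) * 2 ^ l * (Cl * x) ^ (2 * l))) ^ (2 ^ (l - 1)) * NK"
      unfolding of_nat_power using Dx Lx Cd(1) Cl0 x1
      by (intro mult_right_mono power_mono mult_mono) (auto simp: NK_def)
    also have "(Cd * x)\<^sup>2 * (20 * (Cd * x) ^ (2 * l) * 2 ^ l * (Cl * x) ^ (2 * l)) =
        (Cd\<^sup>2 * (20 * Cd ^ (2 * l) * 2 ^ l * Cl ^ (2 * l))) * (x ^ 2 * x ^ (2 * l) * x ^ (2 * l))"
      by (simp add: power_mult_distrib mult_ac)
    also have "x ^ 2 * x ^ (2 * l) * x ^ (2 * l) = x ^ (4 * l + 2)" by (simp flip: power_add)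
    also have "(Cd\<^sup>2 * (20 * Cd ^ (2 * l) * 2 ^ l * Cl ^ (2 * l)) * x ^ (4 * l + 2)) ^ (2 ^ (l - 1)) = C * x ^ e"
      by (simp only: C_def e_def power_mult_distrib power_mult)
    also have "x ^ e = real p powr \<kappa>"
    proof -
      have "x ^ e = real p powr (\<mu> * real e)" unfolding x_def using p1 by (subst powr_realpow[symmetric]) (auto simp: powr_powr)
      also have "\<mu> * real e = \<kappa>" using e0 by (simp add: \<mu>_def)
      finally show ?thesis .
    qed
    finally show "energy G v \<le> C * real p powr \<kappa> * (real (card G) * real (prod_list v))" by (simp add: NK_def)
  qed
qed

section \<open>Residues that are not represented\<close>

lemma card_tuples: "card (tuples v) = prod_list v"
proof (induction v)
  case (Cons a v)
  have "inj_on (\<lambda>(x, d). x # d) ({1..a} \<times> tuples v)" by (auto simp: inj_on_def)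
  then show ?case using Cons by (simp add: tuples_Cons card_image card_cartesian_product)
qed simp

context prime_mod
begin

lemma energy_pad: "energy G (replicate n 1 @ v) = energy G v"
proof -
  have "interval_sum p k (Suc 0) = 1" for k by (simp add: interval_sum_def dchar_1)
  then have "prod_list (map (interval_sum p k) (replicate n 1 @ v)) = prod_list (map (interval_sum p k) v)" for k by simp
  then show ?thesis unfolding energy_def box_sum_def by (simp only:)
qed

text \<open>No product from \<open>G\<close> and the box lies in \<open>E\<close>, so the box sums
  and the sums over \<open>E\<close> have correlation 0. The principal character contributes
  \<open>card E * card G * prod_list v\<close>, which the other characters must cancel; by
  Cauchy-Schwarz this needs a large second moment, as the sums over \<open>E\<close> have second
  moment \<open>(p - 1) * card E\<close>.\<close>

lemma card_unrepresented_le: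
  assumes G: "G \<subseteq> {1..<int p}" and v: "\<forall>a\<in>set v. a < p" and E: "E \<subseteq> {1..<int p}"
    and no: "\<And>g d x. g \<in> G \<Longrightarrow> d \<in> tuples v \<Longrightarrow> x \<in> E \<Longrightarrow> \<not> [g * int (prod_list d) = x] (mod int p)"
  shows "real (card E) * (real (card G) * real (prod_list v))\<^sup>2 \<le> real (p - 1) * (\<Sum>k=1..<p - 1. (cmod (box_sum G v k))\<^sup>2)"
proof (cases "card E = 0")
  case True
  then show ?thesis by (simp add: sum_nonneg)
next
  case False
  have fin: "finite G" "finite E" using G E finite_subset by blast+
  define s where "s k = (\<Sum>x\<in>E. dchar p k x)" for k
  have nE: "\<not> int p dvd x" if "x \<in> E" for x using that E by (auto dest!: zdvd_imp_le)
  have nG: "\<not> int p dvd x" if "x \<in> G" for x using that G by (auto dest!: zdvd_imp_le)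
  have emp: "{(z, x) \<in> (G \<times> tuples v) \<times> E. [fst z * int (prod_list (snd z)) = x] (mod int p)} = {}" using no by auto
  have "(\<Sum>k<p - 1. box_sum G v k * cnj (s k)) =
      of_nat ((p - 1) * card {(z, x) \<in> (G \<times> tuples v) \<times> E. [fst z * int (prod_list (snd z)) = x] (mod int p)})"
    unfolding box_sum_eq s_def using fin box_elem_not_dvd[OF G v] nE by (intro bilinear_orthogonality) auto
  then have z: "(\<Sum>k<p - 1. box_sum G v k * cnj (s k)) = 0" unfolding emp by simp
  have ins: "{..<p - 1} = insert 0 {1..<p - 1}" using p2 by auto
  have z2: "box_sum G v 0 * cnj (s 0) + (\<Sum>k=1..<p - 1. box_sum G v k * cnj (s k)) = 0"
    using z unfolding ins by (subst (asm) sum.insert) auto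
  have b0: "box_sum G v 0 = of_nat (card G * prod_list v)"
  proof -
    have "box_sum G v 0 = (\<Sum>z\<in>G \<times> tuples v. 1)"
      unfolding box_sum_eq using box_elem_not_dvd[OF G v] by (intro sum.cong refl) (simp only: dchar_principal if_False)
    then show ?thesis by (simp add: card_cartesian_product card_tuples)
  qed
  have s0: "s 0 = of_nat (card E)" unfolding s_def using nE by (simp add: dchar_principal)
  define NK where "NK = real (card G) * real (prod_list v)"
  have "NK * real (card E) = cmod (box_sum G v 0 * cnj (s 0))" by (simp add: b0 s0 norm_mult NK_def)
  also have "box_sum G v 0 * cnj (s 0) = - (\<Sum>k=1..<p - 1. box_sum G v k * cnj (s k))" using z2 by (simp add: eq_neg_iff_add_eq_0)
  also have "cmod \<dots> \<le> (\<Sum>k=1..<p - 1. cmod (box_sum G v k) * cmod (s k))"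
    using norm_sum[of "\<lambda>k. box_sum G v k * cnj (s k)" "{1..<p - 1}"] by (simp add: norm_mult)
  also have "\<dots> \<le> L2_set (\<lambda>k. cmod (box_sum G v k)) {1..<p - 1} * L2_set (\<lambda>k. cmod (s k)) {1..<p - 1}"
    using L2_set_mult_ineq[of "\<lambda>k. cmod (box_sum G v k)" "\<lambda>k. cmod (s k)" "{1..<p - 1}"] by simp
  finally have "(NK * real (card E))\<^sup>2 \<le> (L2_set (\<lambda>k. cmod (box_sum G v k)) {1..<p - 1} * L2_set (\<lambda>k. cmod (s k)) {1..<p - 1})\<^sup>2"
    by (intro power_mono) (auto simp: NK_def)
  also have "\<dots> = (L2_set (\<lambda>k. cmod (box_sum G v k)) {1..<p - 1})\<^sup>2 * (L2_set (\<lambda>k. cmod (s k)) {1..<p - 1})\<^sup>2" by (rule power_mult_distrib)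
  also have "(L2_set (\<lambda>k. cmod (box_sum G v k)) {1..<p - 1})\<^sup>2 = (\<Sum>k=1..<p - 1. (cmod (box_sum G v k))\<^sup>2)"
    unfolding L2_set_def by (rule real_sqrt_pow2) (rule sum_nonneg, simp)
  also have "(L2_set (\<lambda>k. cmod (s k)) {1..<p - 1})\<^sup>2 = (\<Sum>k=1..<p - 1. (cmod (s k))\<^sup>2)"
    unfolding L2_set_def by (rule real_sqrt_pow2) (rule sum_nonneg, simp)
  also have "\<dots> \<le> (\<Sum>k<p - 1. (cmod (s k))\<^sup>2)" by (intro sum_mono2) auto
  also have "\<dots> = real ((p - 1) * card {(x, y) \<in> E \<times> E. [x = y] (mod int p)})"
    unfolding s_def using fin(2) nE by (rule energy_identity)
  also have "{(x, y) \<in> E \<times> E. [x = y] (mod int p)} = (\<lambda>x. (x, x)) ` E"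
  proof -
    have "x = y" if "x \<in> E" "y \<in> E" "[x = y] (mod int p)" for x y
      using that E by (intro cong_less_imp_eq_int[of x "int p" y]) auto
    then show ?thesis by auto
  qed
  also have "card \<dots> = card E" by (intro card_image) (auto simp: inj_on_def)
  finally have "(NK * real (card E))\<^sup>2 \<le> (\<Sum>k=1..<p - 1. (cmod (box_sum G v k))\<^sup>2) * real ((p - 1) * card E)"
    by (simp add: mult_left_mono sum_nonneg)
  then have "real (card E) * (real (card E) * NK\<^sup>2) \<le> real (card E) * (real (p - 1) * (\<Sum>k=1..<p - 1. (cmod (box_sum G v k))\<^sup>2))"
    by (simp add: power2_eq_square mult_ac)
  then show ?thesis using False by (simp add: NK_def)
qed

text \<open>Frequencies with a small character sum over \<open>{1..U}\<close> lose one factor of that sum; at all others the sum over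
  \<open>{1..U}\<close> is so large that the saving in the sum over \<open>{1..U ^ m}\<close> pays for trading it for \<open>m - 1\<close> sums over \<open>{1..U}\<close>.\<close>

lemma box_sum_split:
  assumes U: "U > 0" and \<eta>: "\<eta> > 0" and m: "m > 0" and j: "j > 0"
    and \<rho>: "\<And>k. 0 < k \<Longrightarrow> k < p - 1 \<Longrightarrow> cmod (interval_sum p k A) \<le> \<rho> * real A"
  shows "(\<Sum>k=1..<p - 1. (cmod (box_sum G (A # replicate j U) k))\<^sup>2) \<le> real (p - 1) *
    ((real U * \<eta>)\<^sup>2 * energy G (A # replicate (j - 1) U) +
     (\<rho> * real A / (real U * \<eta>) ^ (m - 1))\<^sup>2 * energy G (replicate (m + j - 1) U))"
proof -
  define P where "P k = cmod (box_sum G (A # replicate (j - 1) U) k)" for k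
  define R where "R k = cmod (box_sum G (replicate (m + j - 1) U) k)" for k
  define c where "c = \<rho> * real A / (real U * \<eta>) ^ (m - 1)"
  have U\<eta>: "real U * \<eta> > 0" using U \<eta> by simp
  have pt: "(cmod (box_sum G (A # replicate j U) k))\<^sup>2 \<le> (real U * \<eta>)\<^sup>2 * (P k)\<^sup>2 + c\<^sup>2 * (R k)\<^sup>2"
    if k: "k \<in> {1..<p - 1}" for k
  proof -
    define a where "a = cmod (\<Sum>g\<in>G. dchar p k g)"
    define b where "b = cmod (interval_sum p k A)"
    define x where "x = cmod (interval_sum p k U)"
    have nn: "a \<ge> 0" "b \<ge> 0" "x \<ge> 0" by (simp_all add: a_def b_def x_def)
    have bx: "cmod (box_sum G (A # replicate j U) k) = a * b * x ^ j"
      by (simp add: box_sum_def a_def b_def x_def norm_mult norm_power)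
    have Pk: "P k = a * b * x ^ (j - 1)" by (simp add: P_def box_sum_def a_def b_def x_def norm_mult norm_power)
    have Rk: "R k = a * x ^ (m + j - 1)" by (simp add: R_def box_sum_def a_def x_def norm_mult norm_power)
    have xj: "x ^ j = x * x ^ (j - 1)" using j by (cases j) auto
    show ?thesis
    proof (cases "x \<le> real U * \<eta>")
      case True
      then have "x * P k \<le> real U * \<eta> * P k" by (intro mult_right_mono) (simp_all add: P_def)
      then have "a * b * x ^ j \<le> real U * \<eta> * P k" by (simp add: Pk xj mult_ac)
      then have "(a * b * x ^ j)\<^sup>2 \<le> (real U * \<eta> * P k)\<^sup>2" using nn by (intro power_mono) auto
      then show ?thesis unfolding bx power_mult_distrib[of "real U * \<eta>"] by (smt (verit) zero_le_power2 zero_le_mult_iff)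
    next
      case False
      have b: "b \<le> \<rho> * real A" using \<rho> k by (simp add: b_def)
      have "(real U * \<eta>) ^ (m - 1) \<le> x ^ (m - 1)" using False U\<eta> by (intro power_mono) auto
      then have "1 \<le> x ^ (m - 1) / (real U * \<eta>) ^ (m - 1)" using U\<eta> by simp
      then have "a * b * x ^ j * 1 \<le> a * b * x ^ j * (x ^ (m - 1) / (real U * \<eta>) ^ (m - 1))"
        using nn by (intro mult_left_mono) auto
      also have "\<dots> \<le> a * (\<rho> * real A) * x ^ j * (x ^ (m - 1) / (real U * \<eta>) ^ (m - 1))"
        using nn b U\<eta> by (intro mult_right_mono mult_left_mono) auto
      also have "\<dots> = c * (a * (x ^ j * x ^ (m - 1)))" by (simp add: c_def)
      also have "x ^ j * x ^ (m - 1) = x ^ (m + j - 1)" using m by (simp add: add.commute flip: power_add)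
      finally have "a * b * x ^ j \<le> c * R k" by (simp add: Rk)
      then have "(a * b * x ^ j)\<^sup>2 \<le> (c * R k)\<^sup>2" using nn by (intro power_mono) auto
      then show ?thesis unfolding bx power_mult_distrib[of c] by (smt (verit) zero_le_power2 zero_le_mult_iff)
    qed
  qed
  have "(\<Sum>k=1..<p - 1. (cmod (box_sum G (A # replicate j U) k))\<^sup>2) \<le> (\<Sum>k=1..<p - 1. (real U * \<eta>)\<^sup>2 * (P k)\<^sup>2 + c\<^sup>2 * (R k)\<^sup>2)"
    by (rule sum_mono) (rule pt)
  also have "\<dots> \<le> (\<Sum>k<p - 1. (real U * \<eta>)\<^sup>2 * (P k)\<^sup>2 + c\<^sup>2 * (R k)\<^sup>2)"
    by (intro sum_mono2) auto
  also have "\<dots> = (real U * \<eta>)\<^sup>2 * (\<Sum>k<p - 1. (P k)\<^sup>2) + c\<^sup>2 * (\<Sum>k<p - 1. (R k)\<^sup>2)"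
    by (simp only: sum.distrib sum_distrib_left)
  also have "(\<Sum>k<p - 1. (P k)\<^sup>2) = real (p - 1) * energy G (A # replicate (j - 1) U)"
    using p2 by (simp add: energy_def P_def)
  also have "(\<Sum>k<p - 1. (R k)\<^sup>2) = real (p - 1) * energy G (replicate (m + j - 1) U)"
    using p2 by (simp add: energy_def R_def)
  finally show ?thesis by (simp add: c_def algebra_simps)
qed

text \<open>Both energies belong to boxes of volume \<open>U ^ (m + j - 1)\<close>, one factor
  \<open>U\<close> below the box that is counted, and by \<open>big\<close> this volume times
  \<open>card G\<close> cancels one factor \<open>p\<close>. The relation \<open>A = U ^ m\<close>
  makes the trade in \<open>box_sum_split\<close> neutral except for the factor
  \<open>\<rho> / \<eta> ^ (m - 1)\<close>.\<close>

lemma unrepresented_bound: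
  assumes G: "G \<subseteq> {1..<int p}" "card G > 0" and U: "U > 0" and \<eta>: "\<eta> > 0" and m: "m > 0" and j: "j > 0"
    and A: "A = U ^ m" "A < p"
    and \<rho>: "\<And>k. 0 < k \<Longrightarrow> k < p - 1 \<Longrightarrow> cmod (interval_sum p k A) \<le> \<rho> * real A"
    and c: "energy G (A # replicate (j - 1) U) \<le> c * (real (card G) * real (U ^ (m + j - 1)))"
      "energy G (replicate (m + j - 1) U) \<le> c * (real (card G) * real (U ^ (m + j - 1)))"
    and big: "real p \<le> 2 * (real (card G) * real (U ^ (m + j - 1)))"
    and E: "E \<subseteq> {1..<int p}"
      "\<And>g h x. g \<in> G \<Longrightarrow> h \<in> {1..U ^ (m + j)} \<Longrightarrow> x \<in> E \<Longrightarrow> \<not> [g * int h = x] (mod int p)"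
  shows "real (card E) \<le> 2 * c * real p * (\<eta>\<^sup>2 + \<rho>\<^sup>2 / (\<eta> ^ (m - 1))\<^sup>2)"
proof -
  define v where "v = A # replicate j U"
  define n where "n = m + j - 1"
  have nmj: "m + j = Suc n" "m = Suc (m - 1)" using m by (auto simp: n_def)
  define N where "N = real (card G)"
  define u where "u = real U"
  have u0: "u > 0" using U by (simp add: u_def)
  have N0: "N > 0" using G(2) by (simp add: N_def)
  have UA: "U \<le> A" unfolding A(1) using m U by (simp add: self_le_power)
  have pv: "prod_list v = U ^ Suc n"
  proof -
    have "prod_list v = A * U ^ j" by (simp add: v_def)
    also have "\<dots> = U ^ (m + j)" unfolding A(1) by (rule power_add[symmetric])
    finally show ?thesis by (simp only: nmj(1))
  qed
  have vp: "\<forall>a\<in>set v. a < p" using UA A(2) by (auto simp: v_def)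
  have p0: "real (p - 1) \<ge> 0" "real (p - 1) \<le> real p" by auto
  have "real (card E) * (real (card G) * real (prod_list v))\<^sup>2 \<le> real (p - 1) * (\<Sum>k=1..<p - 1. (cmod (box_sum G v k))\<^sup>2)"
  proof (rule card_unrepresented_le[OF G(1) vp E(1)])
    fix g d x assume "g \<in> G" "d \<in> tuples v" "x \<in> E"
    moreover then have "prod_list d \<in> {1..U ^ (m + j)}" using tuples_prod[of d v] pv by (simp add: nmj(1) Suc_leI)
    ultimately show "\<not> [g * int (prod_list d) = x] (mod int p)" using E(2) by blast
  qed
  also have "\<dots> \<le> real (p - 1) * (real (p - 1) * ((real U * \<eta>)\<^sup>2 * energy G (A # replicate (j - 1) U) +
     (\<rho> * real A / (real U * \<eta>) ^ (m - 1))\<^sup>2 * energy G (replicate (m + j - 1) U)))"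
    unfolding v_def by (intro mult_left_mono box_sum_split[OF U \<eta> m j \<rho>]) auto
  also have "\<dots> \<le> real (p - 1) * (real (p - 1) * ((real U * \<eta>)\<^sup>2 * (c * (N * u ^ n)) +
     (\<rho> * real A / (real U * \<eta>) ^ (m - 1))\<^sup>2 * (c * (N * u ^ n))))"
    using c by (intro mult_left_mono add_mono) (auto simp: N_def u_def n_def)
  also have "\<rho> * real A / (real U * \<eta>) ^ (m - 1) = u * (\<rho> / \<eta> ^ (m - 1))"
  proof -
    have "real A = u * u ^ (m - 1)" unfolding A(1) u_def of_nat_power by (subst nmj(2)) simp
    then show ?thesis using u0 by (simp add: power_mult_distrib flip: u_def)
  qed
  also have "real (p - 1) * (real (p - 1) * ((real U * \<eta>)\<^sup>2 * (c * (N * u ^ n)) + (u * (\<rho> / \<eta> ^ (m - 1)))\<^sup>2 * (c * (N * u ^ n)))) =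
      (real (p - 1))\<^sup>2 * (c * (\<eta>\<^sup>2 + \<rho>\<^sup>2 / (\<eta> ^ (m - 1))\<^sup>2)) * (N * u ^ n * u\<^sup>2)"
  proof -
    have alg: "q * (q * ((y * \<eta>)\<^sup>2 * (c * z) + (y * t)\<^sup>2 * (c * z))) = q\<^sup>2 * (c * (\<eta>\<^sup>2 + t\<^sup>2)) * (z * y\<^sup>2)" for q y z t :: real
      by (simp add: power2_eq_square algebra_simps)
    show ?thesis unfolding power_divide[symmetric] u_def by (rule alg)
  qed
  finally have main: "real (card E) * (N * u ^ Suc n)\<^sup>2 \<le> (real (p - 1))\<^sup>2 * (c * (\<eta>\<^sup>2 + \<rho>\<^sup>2 / (\<eta> ^ (m - 1))\<^sup>2)) * (N * u ^ n * u\<^sup>2)"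
    by (simp add: pv N_def u_def)
  define Z where "Z = c * (\<eta>\<^sup>2 + \<rho>\<^sup>2 / (\<eta> ^ (m - 1))\<^sup>2)"
  define w where "w = N * u ^ n"
  have w0: "w > 0" using u0 N0 by (simp add: w_def)
  have "real (card E) * w * (w * u\<^sup>2) \<le> (real (p - 1))\<^sup>2 * Z * (w * u\<^sup>2)"
    using main by (simp add: Z_def w_def power2_eq_square mult_ac)
  then have ew: "real (card E) * w \<le> (real (p - 1))\<^sup>2 * Z" using w0 u0 by (simp add: mult_le_cancel_right)
  have c0: "c \<ge> 0"
  proof -
    have "0 \<le> c * (N * u ^ n)" using energy_nonneg c(2) unfolding N_def u_def n_def of_nat_power by (rule order_trans)
    then show ?thesis using w0 unfolding w_def by (simp add: zero_le_mult_iff)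
  qed
  have Z0: "Z \<ge> 0" using c0 by (simp add: Z_def)
  have "real (card E) * real p \<le> real (card E) * (2 * w)" using big by (intro mult_left_mono) (auto simp: w_def N_def u_def n_def)
  also have "\<dots> \<le> 2 * ((real (p - 1))\<^sup>2 * Z)" using ew by simp
  also have "\<dots> \<le> 2 * ((real p)\<^sup>2 * Z)" using p0 Z0 by (intro mult_left_mono mult_right_mono power_mono) auto
  finally have "real p * real (card E) \<le> real p * (2 * real p * Z)" by (simp add: power2_eq_square mult_ac)
  then have "real (card E) \<le> 2 * real p * Z" using p2 by simp
  then show ?thesis by (simp add: Z_def mult_ac)
qed

end

section \<open>Choice of the parameters\<close>

lemma real_of_nat_le_powr_mono: "2 \<le> p \<Longrightarrow> a \<le> b \<Longrightarrow> real p powr a \<le> real p powr b" for p :: nat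
  by (intro powr_mono) auto

text \<open>With \<open>x = p\<close> and \<open>U\<close> near \<open>x powr u\<close>, the side
  \<open>A = U ^ m\<close> is near \<open>x powr (1 / 4 + \<beta>)\<close> and \<open>U ^ n\<close>
  is slightly above \<open>x powr (3 / 8)\<close>. The box \<open>A * U ^ n\<close> of volume
  \<open>V\<close> leaves room for \<open>N = p div V\<close> elements, at most
  \<open>x powr (3 / 8 - \<beta>)\<close>. One further side \<open>U\<close>, on which the saving is
  made, still fits below \<open>x powr (5 / 8 + \<epsilon>)\<close>.\<close>

theorem few_unrepresented:
  fixes \<epsilon> :: real
  assumes \<epsilon>: "0 < \<epsilon>" "\<epsilon> \<le> 1 / 16"
  shows "\<exists>\<delta>>0. \<delta> \<le> 1 \<and> (\<exists>C\<ge>0. \<forall>p H G E. prime p \<longrightarrow> G \<subseteq> {1..<int p} \<longrightarrow> real p powr (3 / 8) \<le> real (card G) \<longrightarrow>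
    real p powr (5 / 8 + \<epsilon>) \<le> real H \<longrightarrow> E \<subseteq> {1..<int p} \<longrightarrow>
    (\<forall>g\<in>G. \<forall>h\<in>{1..H}. \<forall>x\<in>E. \<not> [g * int h = x] (mod int p)) \<longrightarrow>
    real (card E) \<le> C * real p powr (1 - \<delta>))"
proof -
  \<comment> \<open>Half of \<open>\<epsilon>\<close> lifts \<open>A\<close> into the range of
    Burgess' bound; the other half pays for rounding \<open>n\<close> and \<open>U\<close> and for
    the extra side \<open>U\<close>.\<close>
  define \<beta> where "\<beta> = \<epsilon> / 2"
  have \<beta>: "0 < \<beta>" "\<beta> \<le> 1 / 8" using \<epsilon> by (auto simp: \<beta>_def)
  obtain \<delta>0 C1 where B: "\<delta>0 > 0" "C1 > 0" "\<forall>p k A. prime p \<longrightarrow> 0 < k \<longrightarrow> k < p - 1 \<longrightarrow> real p powr (1 / 4 + \<beta>) \<le> real A \<longrightarrow>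
    real A \<le> 2 * real p powr (1 / 4 + \<beta>) \<longrightarrow> cmod (interval_sum p k A) \<le> C1 * real A * real p powr (- \<delta>0)"
    using burgess_bound[OF \<beta>] by (elim exE conjE) (rule that)
  define \<delta>1 where "\<delta>1 = min \<delta>0 1"
  have d1: "0 < \<delta>1" "\<delta>1 \<le> 1" "\<delta>1 \<le> \<delta>0" using B(1) by (auto simp: \<delta>1_def)
  \<comment> \<open>This makes \<open>u \<le> \<epsilon> / 8\<close>; the lower bound 4 secures
    \<open>l \<ge> 4\<close> for the energy estimate.\<close>
  define m where "m = max 4 (nat \<lceil>8 * (1 / 4 + \<beta>) / \<epsilon>\<rceil>)"
  have m4: "m \<ge> 4" by (simp add: m_def)
  define u where "u = (1 / 4 + \<beta>) / real m"
  have um: "u * real m = 1 / 4 + \<beta>" using m4 by (simp add: u_def)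
  have u0: "u > 0" using m4 \<beta> by (simp add: u_def)
  have ue: "u \<le> \<epsilon> / 8"
  proof -
    have "8 * (1 / 4 + \<beta>) / \<epsilon> \<le> real m" unfolding m_def by linarith
    then have "8 * (1 / 4 + \<beta>) \<le> real m * \<epsilon>" using \<epsilon> by (simp add: pos_divide_le_eq)
    then have "8 * (1 / 4 + \<beta>) / real m \<le> \<epsilon>" using m4 by (simp add: pos_divide_le_eq mult.commute)
    then show ?thesis unfolding u_def by (simp add: mult.commute)
  qed
  \<comment> \<open>The least \<open>n\<close> with \<open>u * n \<ge> 3 / 8\<close>, so that
    \<open>U ^ n\<close> dominates \<open>2 ^ l * N\<close>.\<close>
  define n where "n = nat \<lceil>3 / (8 * u)\<rceil>"
  have un: "3 / 8 \<le> u * real n" "u * real n \<le> 3 / 8 + u"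
  proof -
    have "3 / (8 * u) \<ge> 0" using u0 by simp
    then have "3 / (8 * u) \<le> real n" "real n \<le> 3 / (8 * u) + 1" unfolding n_def by linarith+
    then have "3 \<le> real n * (8 * u)" "(real n - 1) * (8 * u) \<le> 3"
      using u0 by (simp_all add: pos_divide_le_eq pos_le_divide_eq flip: diff_le_eq)
    then show "3 / 8 \<le> u * real n" "u * real n \<le> 3 / 8 + u" by (simp_all add: algebra_simps)
  qed
  define l where "l = m + n"
  have l4: "l \<ge> 4" using m4 by (simp add: l_def)
  \<comment> \<open>Both the saving \<open>\<eta> = x powr (- \<tau>)\<close> and the loss in the
    energy estimate use \<open>\<tau>\<close>; squaring the saving leaves a net
    \<open>x powr (- \<tau>)\<close>. As \<open>\<tau> * m = \<delta>1 * (1 / 4 + \<beta>)\<close>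
    is below \<open>\<delta>1 / 2\<close>, the quotient \<open>\<rho> / \<eta> ^ (m - 1)\<close> is
    still \<open>O(x powr (- \<tau>))\<close>.\<close>
  define \<tau> where "\<tau> = u * \<delta>1"
  have tau: "0 < \<tau>" "\<tau> \<le> \<delta>1 / 2" "\<tau> \<le> 1"
  proof -
    show "0 < \<tau>" using u0 d1 by (simp add: \<tau>_def)
    have "u * \<delta>1 \<le> (1 / 2) * \<delta>1" using ue \<epsilon> d1 by (intro mult_right_mono) auto
    then show "\<tau> \<le> \<delta>1 / 2" by (simp add: \<tau>_def)
    then show "\<tau> \<le> 1" using d1 by simp
  qed
  obtain C2 where C2: "C2 > 0" "\<forall>p A v (G::int set). prime p \<longrightarrow> G \<subseteq> {1..<int p} \<longrightarrow> card G > 0 \<longrightarrow> 1 \<le> A \<longrightarrow> A < p \<longrightarrow>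
    2 ^ l * card G * A * card G \<le> p \<longrightarrow> 2 ^ l * card G \<le> A\<^sup>2 \<longrightarrow> length v = l \<longrightarrow> set v \<subseteq> {1..A} \<longrightarrow>
    prod_list v * card G \<le> p \<longrightarrow>
    prime_mod.energy p G v \<le> C2 * real p powr \<tau> * (real (card G) * real (prod_list v))"
    using energy_estimate[OF tau(1) l4] by (elim exE conjE) (rule that)
  \<comment> \<open>Rounding \<open>x powr u\<close> up to \<open>U\<close> costs at most a factor
    \<open>1 + x powr - u\<close> per side, and for large \<open>x\<close> all sides together lose
    less than a factor 2.\<close>
  have "((\<lambda>x. (1 + x powr - u) ^ (m + Suc n)) \<longlongrightarrow> (1 + 0) ^ (m + Suc n)) at_top"
    by (intro tendsto_intros tendsto_neg_powr u0 filterlim_ident) (use u0 in auto)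
  then have ev1: "eventually (\<lambda>x. (1 + x powr - u) ^ (m + Suc n) < 2) at_top"
    by (rule order_tendstoD) simp
  have pw: "eventually (\<lambda>x. c \<le> x powr a) at_top" if "a > 0" for a c :: real
    using filterlim_at_top[of "\<lambda>x. x powr a" at_top] real_powr_at_top[OF that] by auto
  have "eventually (\<lambda>x::real. (1 + x powr - u) ^ (m + Suc n) < 2 \<and> 2 \<le> x powr (\<epsilon> / 4) \<and> 2 ^ l \<le> x powr \<beta>) at_top"
    using ev1 pw[of "\<epsilon> / 4" 2] pw[of \<beta> "2 ^ l"] \<epsilon> \<beta> by (intro eventually_conj) auto
  then obtain x0 :: real where x0: "\<And>x. x \<ge> x0 \<Longrightarrow> (1 + x powr - u) ^ (m + Suc n) < 2 \<and> 2 \<le> x powr (\<epsilon> / 4) \<and> 2 ^ l \<le> x powr \<beta>"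
    unfolding eventually_at_top_linorder by blast
  \<comment> \<open>The summand \<open>max 0 x0\<close> covers the primes below \<open>x0\<close>,
    where \<open>card E \<le> p\<close> is enough.\<close>
  define C where "C = 2 * C2 * (1 + C1\<^sup>2) + max 0 x0"
  have C0: "C \<ge> 0" using C2(1) by (simp add: C_def)
  show ?thesis
  proof (rule exI[of _ \<tau>], intro conjI tau, rule exI[of _ C], intro conjI allI impI C0)
    fix p H and G E :: "int set"
    assume as: "prime p" "G \<subseteq> {1..<int p}" "real p powr (3 / 8) \<le> real (card G)" "real p powr (5 / 8 + \<epsilon>) \<le> real H"
      "E \<subseteq> {1..<int p}" "\<forall>g\<in>G. \<forall>h\<in>{1..H}. \<forall>x\<in>E. \<not> [g * int h = x] (mod int p)"
    interpret prime_mod p by standard (rule as(1))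
    define x where "x = real p"
    have x2: "x \<ge> 2" using p2 by (simp add: x_def)
    note mono = real_of_nat_le_powr_mono[OF p2, folded x_def]
    show "real (card E) \<le> C * real p powr (1 - \<tau>)"
    proof (cases "x \<ge> x0")
      case False
      have "card E \<le> card {1..<int p}" using as(5) by (intro card_mono) auto
      then have "real (card E) \<le> x" by (simp add: x_def)
      also have "\<dots> \<le> C * 1"
      proof -
        have "0 \<le> 2 * C2 * (1 + C1\<^sup>2)" using C2(1) by simp
        moreover have "x \<le> max 0 x0" using False by simp
        ultimately show ?thesis unfolding C_def mult_1_right by linarith
      qed
      also have "\<dots> \<le> C * x powr (1 - \<tau>)"
      proof (rule mult_left_mono[OF _ C0])
        show "1 \<le> x powr (1 - \<tau>)" using x2 tau(3) by (intro ge_one_powr_ge_zero) simp_all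
      qed
      finally show ?thesis unfolding x_def .
    next
      case True
      have big: "(1 + x powr - u) ^ (m + Suc n) \<le> 2" "2 \<le> x powr (\<epsilon> / 4)" "2 ^ l \<le> x powr \<beta>" using x0[OF True] by auto
      define U where "U = nat \<lceil>x powr u\<rceil>"
      have xu: "x powr u \<ge> 1" using x2 u0 by (intro ge_one_powr_ge_zero) auto
      have Ul: "x powr u \<le> real U" unfolding U_def by linarith
      have Uu: "real U \<le> x powr u * (1 + x powr - u)"
      proof -
        have "real U \<le> x powr u + 1" unfolding U_def using xu by linarith
        also have "\<dots> = x powr u * (1 + x powr - u)" using x2 by (simp add: ring_distribs flip: powr_add)
        finally show ?thesis .
      qed
      have U0: "U > 0" using Ul xu by simp
      have pk: "(x powr u) ^ k = x powr (u * real k)" for k using x2 by (subst powr_realpow[symmetric]) (auto simp: powr_powr)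
      have Ulk: "x powr (u * real k) \<le> real (U ^ k)" for k
        unfolding pk[symmetric] of_nat_power using Ul by (intro power_mono) auto
      have Uuk: "real (U ^ k) \<le> 2 * x powr (u * real k)" if "k \<le> m + Suc n" for k
      proof -
        have "real (U ^ k) \<le> (x powr u * (1 + x powr - u)) ^ k" unfolding of_nat_power using Uu by (intro power_mono) auto
        also have "\<dots> = x powr (u * real k) * (1 + x powr - u) ^ k" by (simp add: power_mult_distrib pk)
        also have "\<dots> \<le> x powr (u * real k) * (1 + x powr - u) ^ (m + Suc n)"
          using that by (intro mult_left_mono power_increasing) auto
        also have "\<dots> \<le> x powr (u * real k) * 2" using big(1) by (intro mult_left_mono) auto
        finally show ?thesis by simp
      qed
      define A where "A = U ^ m"
      have Ab: "x powr (1 / 4 + \<beta>) \<le> real A" "real A \<le> 2 * x powr (1 / 4 + \<beta>)"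
        using Ulk[of m] Uuk[of m] by (simp_all add: A_def um)
      have top: "real (U ^ (m + Suc n)) \<le> x powr (5 / 8 + \<epsilon>)"
      proof -
        have "u * real (m + Suc n) = 1 / 4 + \<beta> + u * real n + u" using um by (simp add: algebra_simps)
        then have "u * real (m + Suc n) \<le> 5 / 8 + 3 * \<epsilon> / 4" using un(2) ue by (simp add: \<beta>_def)
        then have "x powr (u * real (m + Suc n)) \<le> x powr (5 / 8 + 3 * \<epsilon> / 4)" by (rule mono)
        then have "2 * x powr (u * real (m + Suc n)) \<le> x powr (\<epsilon> / 4) * x powr (5 / 8 + 3 * \<epsilon> / 4)"
          using big(2) by (intro mult_mono) auto
        also have "\<dots> = x powr (5 / 8 + \<epsilon>)" by (simp add: add.commute flip: powr_add)
        finally show ?thesis using Uuk[of "m + Suc n"] by simp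
      qed
      have topH: "U ^ (m + Suc n) \<le> H"
      proof -
        have "real (U ^ (m + Suc n)) \<le> real H" using top as(4) unfolding x_def by (rule order_trans)
        then show ?thesis by (simp only: of_nat_le_iff)
      qed
      have topp: "U ^ (m + Suc n) < p"
      proof -
        have "x powr (5 / 8 + \<epsilon>) < x powr 1" using x2 \<epsilon> by (intro powr_less_mono) auto
        then have "real (U ^ (m + Suc n)) < real p" using top x2 by (simp add: x_def)
        then show ?thesis by (simp only: of_nat_less_iff)
      qed
      define V where "V = U ^ (m + n)"
      have V0: "V > 0" using U0 by (simp add: V_def)
      have Vp: "V < p"
      proof -
        have "V \<le> U ^ (m + Suc n)" unfolding V_def using U0 by (intro power_increasing) auto
        then show ?thesis using topp by simp
      qed
      have Ap: "A < p"
      proof -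
        have "A \<le> V" unfolding V_def A_def using U0 by (intro power_increasing) auto
        then show ?thesis using Vp by simp
      qed
      \<comment> \<open>The largest size with \<open>N * V \<le> p\<close>, as the energy estimate
        demands; \<open>G\<close> is thinned out to it. Since \<open>p \<le> 2 * (N * V)\<close>,
        only a factor 2 is lost.\<close>
      define N where "N = p div V"
      have N0: "N > 0" using Vp V0 by (simp add: N_def div_greater_zero_iff)
      have NV: "N * V \<le> p" by (simp add: N_def)
      have pNV: "p \<le> 2 * (N * V)"
      proof -
        have "p < N * V + V" unfolding N_def using dividend_less_div_times[OF V0, of p] by (simp add: add.commute)
        moreover have "V \<le> N * V" using N0 by simp
        ultimately show ?thesis by linarith
      qed
      have Nx: "real N \<le> x powr (3 / 8 - \<beta>)"
      proof -
        have "u * real (m + n) = 1 / 4 + \<beta> + u * real n" using um by (simp add: algebra_simps)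
        then have "5 / 8 + \<beta> \<le> u * real (m + n)" using un(1) by simp
        then have "x powr (5 / 8 + \<beta>) \<le> x powr (u * real (m + n))" by (rule mono)
        then have "x powr (5 / 8 + \<beta>) \<le> real V" using Ulk[of "m + n"] unfolding V_def by (rule order_trans)
        then have "real N * x powr (5 / 8 + \<beta>) \<le> real N * real V" by (intro mult_left_mono) auto
        also have "\<dots> \<le> x" using NV unfolding x_def of_nat_mult[symmetric] of_nat_le_iff .
        finally have "real N \<le> x / x powr (5 / 8 + \<beta>)" using x2 by (simp add: pos_le_divide_eq)
        also have "\<dots> = x powr (1 - (5 / 8 + \<beta>))" using x2 by (subst powr_diff) simp
        finally show ?thesis by simp
      qed
      have "real N \<le> real (card G)"
      proof -
        have "x powr (3 / 8 - \<beta>) \<le> x powr (3 / 8)" using \<beta> by (intro mono) auto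
        then show ?thesis using Nx as(3) by (simp add: x_def)
      qed
      then obtain G' where G': "G' \<subseteq> G" "card G' = N" using obtain_subset_with_card_n[of N G] by auto
      have cG': "card G' > 0" using N0 G' by simp
      have m0: "m > 0" using m4 by simp
      have G'p: "G' \<subseteq> {1..<int p}" using G' as(2) by auto
      have lN: "2 ^ l * real N \<le> x powr (3 / 8)"
      proof -
        have "2 ^ l * real N \<le> x powr \<beta> * x powr (3 / 8 - \<beta>)" using big(3) Nx by (intro mult_mono) auto
        then show ?thesis by (simp flip: powr_add)
      qed
      have c1: "2 ^ l * N \<le> U ^ n"
      proof -
        have "x powr (3 / 8) \<le> x powr (u * real n)" using un by (intro mono) auto
        then have "real (2 ^ l * N) \<le> real (U ^ n)" using lN Ulk[of n] by simp
        then show ?thesis by (simp only: of_nat_le_iff)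
      qed
      \<comment> \<open>\<open>2 ^ l * N \<le> U ^ n\<close> trades one of the two factors
        \<open>N\<close> for \<open>U ^ n\<close>, and \<open>A * U ^ n * N = V * N\<close>.\<close>
      have cond1: "2 ^ l * card G' * A * card G' \<le> p"
      proof -
        have "(2 ^ l * N) * (A * N) \<le> U ^ n * (A * N)" using c1 by (rule mult_le_mono1)
        also have "\<dots> = N * V" by (simp add: A_def V_def power_add)
        finally have "(2 ^ l * N) * (A * N) \<le> p" using NV by linarith
        then show ?thesis unfolding G'(2) mult.assoc .
      qed
      have cond2: "2 ^ l * card G' \<le> A\<^sup>2"
      proof -
        have "x powr (3 / 8) \<le> x powr (1 / 4 + \<beta> + (1 / 4 + \<beta>))" using \<beta> by (intro mono) auto
        also have "\<dots> = x powr (1 / 4 + \<beta>) * x powr (1 / 4 + \<beta>)" by (rule powr_add)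
        also have "\<dots> \<le> real A * real A" using Ab by (intro mult_mono) auto
        finally have "real (2 ^ l * N) \<le> real (A\<^sup>2)" using lN by (simp add: power2_eq_square)
        then show ?thesis unfolding G'(2) by (simp only: of_nat_le_iff)
      qed
      have A1: "1 \<le> A" using U0 by (simp add: A_def Suc_leI)
      have UA: "U \<le> A" unfolding A_def using U0 m4 by (simp add: self_le_power)
      note est = C2(2)[rule_format, OF as(1) G'p _ A1 Ap cond1 cond2]
      have prV: "A * U ^ n = V" by (simp add: A_def V_def power_add)
      have e1: "energy G' (A # replicate n U) \<le> C2 * x powr \<tau> * (real (card G') * real V)"
      proof -
        \<comment> \<open>Sides 1 bring the box to the length \<open>l = m + n\<close> of the energy
          estimate without changing its energy.\<close>
        define v where "v = replicate (m - 1) 1 @ (A # replicate n U)"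
        have pv: "prod_list v = V" by (simp add: v_def prV)
        have "energy G' v \<le> C2 * real p powr \<tau> * (real (card G') * real (prod_list v))"
        proof (rule est)
          show "card G' > 0" using N0 G' by simp
          show "length v = l" using m4 by (simp add: v_def l_def)
          show "set v \<subseteq> {1..A}" using A1 UA U0 by (auto simp: v_def)
          show "prod_list v * card G' \<le> p" using NV by (simp add: pv G' mult.commute)
        qed
        then show ?thesis unfolding pv unfolding v_def energy_pad x_def .
      qed
      have e2: "energy G' (replicate l U) \<le> C2 * x powr \<tau> * (real (card G') * real V)"
      proof -
        have pv: "prod_list (replicate l U) = V" by (simp add: V_def l_def)
        have "energy G' (replicate l U) \<le> C2 * real p powr \<tau> * (real (card G') * real (prod_list (replicate l U)))"
        proof (rule est)
          show "card G' > 0" using N0 G' by simp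
          show "set (replicate l U) \<subseteq> {1..A}" using UA U0 by auto
          show "prod_list (replicate l U) * card G' \<le> p" using NV unfolding pv G' by (simp add: mult.commute)
        qed auto
        then show ?thesis unfolding pv x_def .
      qed
      define \<eta> where "\<eta> = x powr (- \<tau>)"
      define \<rho> where "\<rho> = C1 * x powr (- \<delta>1)"
      have \<eta>0: "\<eta> > 0" using x2 by (simp add: \<eta>_def)
      have rho: "cmod (interval_sum p k A) \<le> \<rho> * real A" if "0 < k" "k < p - 1" for k
      proof -
        have "cmod (interval_sum p k A) \<le> C1 * real A * x powr (- \<delta>0)"
          unfolding x_def by (rule B(3)[rule_format, OF as(1) that Ab[unfolded x_def]])
        also have "\<dots> \<le> C1 * real A * x powr (- \<delta>1)" using B(2) d1 by (intro mult_left_mono mono) auto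
        finally show ?thesis by (simp add: \<rho>_def mult_ac)
      qed
      have "real (card E) \<le> 2 * (C2 * x powr \<tau>) * real p * (\<eta>\<^sup>2 + \<rho>\<^sup>2 / (\<eta> ^ (m - 1))\<^sup>2)"
      proof (rule unrepresented_bound[OF G'p cG' U0 \<eta>0 m0 zero_less_Suc A_def Ap rho])
        show "energy G' (A # replicate (Suc n - 1) U) \<le> C2 * x powr \<tau> * (real (card G') * real (U ^ (m + Suc n - 1)))"
          using e1 by (simp add: V_def)
        show "energy G' (replicate (m + Suc n - 1) U) \<le> C2 * x powr \<tau> * (real (card G') * real (U ^ (m + Suc n - 1)))"
          using e2 by (simp add: V_def l_def)
        have "real p \<le> real (2 * (N * V))" using pNV by (simp only: of_nat_le_iff)
        then show "real p \<le> 2 * (real (card G') * real (U ^ (m + Suc n - 1)))" by (simp add: V_def G')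
        fix g h y assume "g \<in> G'" "h \<in> {1..U ^ (m + Suc n)}" "y \<in> E"
        then have "g \<in> G" "h \<in> {1..H}" "y \<in> E" using G'(1) topH by auto
        then show "\<not> [g * int h = y] (mod int p)" using as(6) by blast
      qed (use as(5) in simp_all)
      also have "\<dots> \<le> 2 * (C2 * x powr \<tau>) * real p * ((1 + C1\<^sup>2) * x powr (- 2 * \<tau>))"
      proof -
        have "\<eta>\<^sup>2 = x powr (- 2 * \<tau>)" by (simp add: \<eta>_def power2_eq_square flip: powr_add)
        moreover have "\<rho>\<^sup>2 / (\<eta> ^ (m - 1))\<^sup>2 \<le> C1\<^sup>2 * x powr (- 2 * \<tau>)"
        proof -
          have "\<eta> ^ (m - 1) = x powr (- \<tau> * real (m - 1))"
            unfolding \<eta>_def using x2 by (subst powr_realpow[symmetric]) (auto simp: powr_powr)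
          then have "\<rho> / \<eta> ^ (m - 1) = C1 * x powr (- \<delta>1 - (- \<tau> * real (m - 1)))"
            unfolding \<rho>_def by (simp only: powr_diff times_divide_eq_right)
          also have "\<dots> \<le> C1 * x powr (- \<tau>)"
          proof (intro mult_left_mono mono)
            have "\<tau> * real (m - 1) \<le> \<tau> * real m" using tau by (intro mult_left_mono) auto
            also have "\<dots> = \<delta>1 * (1 / 4 + \<beta>)" by (simp add: \<tau>_def mult_ac flip: um)
            also have "\<dots> \<le> \<delta>1 * (1 / 2)" using d1 \<beta> by (intro mult_left_mono) auto
            finally show "- \<delta>1 - (- \<tau> * real (m - 1)) \<le> - \<tau>" using tau(2) by simp
          qed (use B(2) in auto)
          finally have "(\<rho> / \<eta> ^ (m - 1))\<^sup>2 \<le> (C1 * x powr (- \<tau>))\<^sup>2"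
            using B(2) \<eta>0 by (intro power_mono) (auto simp: \<rho>_def)
          also have "\<dots> = C1\<^sup>2 * x powr (- 2 * \<tau>)" by (simp add: power_mult_distrib power2_eq_square flip: powr_add)
          finally show ?thesis by (simp add: power_divide)
        qed
        ultimately have "\<eta>\<^sup>2 + \<rho>\<^sup>2 / (\<eta> ^ (m - 1))\<^sup>2 \<le> (1 + C1\<^sup>2) * x powr (- 2 * \<tau>)" by (simp add: ring_distribs)
        then show ?thesis using C2(1) by (intro mult_left_mono) auto
      qed
      also have "\<dots> = 2 * C2 * (1 + C1\<^sup>2) * (x powr \<tau> * x powr 1 * x powr (- 2 * \<tau>))" using x2 by (simp add: x_def mult_ac)
      also have "x powr \<tau> * x powr 1 * x powr (- 2 * \<tau>) = x powr (1 - \<tau>)" unfolding powr_add[symmetric] by simp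
      also have "2 * C2 * (1 + C1\<^sup>2) * x powr (1 - \<tau>) \<le> C * x powr (1 - \<tau>)" by (intro mult_right_mono) (auto simp: C_def)
      finally show ?thesis by (simp add: x_def)
    qed
  qed
qed

theorem theorem3:
  fixes \<epsilon> :: real
  assumes "\<epsilon> > 0"
  shows "\<exists>\<delta>::real. \<delta> > 0 \<and> (\<exists>C::real. \<forall>(p::nat) (H::nat) (G::int set).
    prime p \<longrightarrow> H > 0 \<longrightarrow> card (interval_mod p H) = H \<longrightarrow>
    (subgroup G (mult_of (residue_ring (int p))) \<or>
     (\<exists>(g::nat) (N::nat). residue_primroot p g \<and> G = power_set_mod p g N \<and> card G = N)) \<longrightarrow>
    real (card (interval_mod p H)) > real p powr (5 / 8 + \<epsilon>) \<longrightarrow>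
    real (card G) > real p powr (3 / 8) \<longrightarrow>
    \<bar>real (card (interval_mod p H <#>\<^bsub>residue_ring (int p)\<^esub> G)) - real p\<bar>
      \<le> C * real p powr (1 - \<delta>))"
proof -
  \<comment> \<open>The hypothesis on the interval is stronger for larger \<open>\<epsilon>\<close>,
    so it may be used with at most 1/16.\<close>
  define \<epsilon>' where "\<epsilon>' = min \<epsilon> (1 / 16)"
  have e': "0 < \<epsilon>'" "\<epsilon>' \<le> 1 / 16" "\<epsilon>' \<le> \<epsilon>" using assms by (auto simp: \<epsilon>'_def)
  obtain \<delta> C where d: "\<delta> > 0" "\<delta> \<le> 1" "C \<ge> 0" and few: "\<forall>p H G E. prime p \<longrightarrow> G \<subseteq> {1..<int p} \<longrightarrow> real p powr (3 / 8) \<le> real (card G) \<longrightarrow>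
    real p powr (5 / 8 + \<epsilon>') \<le> real H \<longrightarrow> E \<subseteq> {1..<int p} \<longrightarrow>
    (\<forall>g\<in>G. \<forall>h\<in>{1..H}. \<forall>x\<in>E. \<not> [g * int h = x] (mod int p)) \<longrightarrow>
    real (card E) \<le> C * real p powr (1 - \<delta>)"
    using few_unrepresented[OF e'(1,2)] by (elim exE conjE) (rule that)
  show ?thesis
  proof (rule exI[of _ \<delta>], intro conjI d, rule exI[of _ "C + 1"], intro allI impI)
    fix p H :: nat and G :: "int set"
    assume as: "prime p" "H > 0" "card (interval_mod p H) = H"
      "subgroup G (mult_of (residue_ring (int p))) \<or> (\<exists>g N. residue_primroot p g \<and> G = power_set_mod p g N \<and> card G = N)"
      "real p powr (5 / 8 + \<epsilon>) < real (card (interval_mod p H))" "real p powr (3 / 8) < real (card G)"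
    have p2: "p \<ge> 2" using as(1) by (rule prime_ge_2_nat)
    define P where "P = interval_mod p H <#>\<^bsub>residue_ring (int p)\<^esub> G"
    have P: "P = {(int h mod int p) * g mod int p | h g. h \<in> {1..H} \<and> g \<in> G}"
      unfolding P_def set_mult_def interval_mod_def residue_ring_def by (auto; blast)
    have Psub: "P \<subseteq> {0..<int p}" using p2 by (auto simp: P)
    have finP: "finite P" using Psub finite_subset by blast
    have cP: "card P \<le> p" using card_mono[OF _ Psub] by simp
    have G: "G \<subseteq> {1..<int p}"
      using as(4)
    proof
      assume "subgroup G (mult_of (residue_ring (int p)))"
      then have "G \<subseteq> carrier (mult_of (residue_ring (int p)))" by (rule subgroup.subset)
      then show ?thesis by (auto simp: residue_ring_def)
    next
      assume "\<exists>g N. residue_primroot p g \<and> G = power_set_mod p g N \<and> card G = N"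
      then obtain g N where g: "residue_primroot p g" "G = power_set_mod p g N" by blast
      have "coprime p g" using g(1) by (simp add: residue_primroot_def)
      have "int g ^ i mod int p \<in> {1..<int p}" for i
      proof -
        have "coprime p (g ^ i)" using \<open>coprime p g\<close> by simp
        then have "\<not> p dvd g ^ i" using coprime_common_divisor[of p "g ^ i" p] p2 by auto
        then have "\<not> int p dvd int (g ^ i)" unfolding int_dvd_int_iff .
        then have "int g ^ i mod int p \<noteq> 0" by (simp add: dvd_eq_mod_eq_0)
        moreover have "0 \<le> int g ^ i mod int p" "int g ^ i mod int p < int p" using p2 by simp_all
        ultimately show ?thesis by simp
      qed
      then show ?thesis by (auto simp: g(2) power_set_mod_def)
    qed
    define E where "E = {1..<int p} - P"
    have "real (card E) \<le> C * real p powr (1 - \<delta>)"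
    proof (rule few[rule_format, OF as(1) G])
      show "real p powr (3 / 8) \<le> real (card G)" using as(6) by simp
      have "real p powr (5 / 8 + \<epsilon>') \<le> real p powr (5 / 8 + \<epsilon>)" using e' p2 by (intro powr_mono) auto
      then show "real p powr (5 / 8 + \<epsilon>') \<le> real H" using as(3,5) by simp
      show "E \<subseteq> {1..<int p}" by (auto simp: E_def)
      fix g h x assume ghx: "g \<in> G" "h \<in> {1..H}" "x \<in> E"
      show "\<not> [g * int h = x] (mod int p)"
      proof
        assume "[g * int h = x] (mod int p)"
        then have "x = (int h mod int p) * g mod int p"
          using ghx(3) by (simp add: E_def unique_euclidean_semiring_class.cong_def mod_mult_right_eq mult.commute)
        then have "x \<in> P" using ghx by (auto simp: P)
        then show False using ghx(3) by (simp add: E_def)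
      qed
    qed
    \<comment> \<open>The 1 stands for the residue 0, which \<open>E\<close> leaves out; it raises
      the constant to \<open>C + 1\<close>.\<close>
    moreover have "real p \<le> real (card P) + real (card E) + 1"
    proof -
      have "{0..<int p} \<subseteq> insert 0 (P \<union> E)" by (auto simp: E_def)
      then have "card {0..<int p} \<le> card (insert 0 (P \<union> E))" using finP by (intro card_mono) (auto simp: E_def)
      also have "\<dots> \<le> card (P \<union> E) + 1" using finP by (simp add: card_insert_le_m1 card_insert_if E_def)
      also have "\<dots> \<le> card P + card E + 1" using card_Un_le[of P E] by simp
      finally show ?thesis by simp
    qed
    moreover have "1 \<le> real p powr (1 - \<delta>)" using p2 d by (intro ge_one_powr_ge_zero) auto
    moreover have "real (card P) \<le> real p" using cP by simp
    ultimately show "\<bar>real (card (interval_mod p H <#>\<^bsub>residue_ring (int p)\<^esub> G)) - real p\<bar> \<le> (C + 1) * real p powr (1 - \<delta>)"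
      unfolding P_def[symmetric] by (simp add: ring_distribs)
  qed
qed

end
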